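(* Let $X$ be the Ornstein–Uhlenbeck process $dX_t=\mu(\theta-X_t)\,dt+\sigma\,dB_t$ with constants $\mu,\sigma>0$, $\theta\in\mathbb{R}$, driven by a standard Brownian motion $B$, and let $r,c_s,c_b>0$ be constants. Let $h_s(x)=e^x-c_s$, $h_b(x)=e^x+c_b$, \[F(x)=\int_0^\infty u^{\frac{r}{\mu}-1}e^{\sqrt{\frac{2\mu}{\sigma^2}}(x-\theta)u-\frac{u^2}{2}}\,du,\] \[f_b(x)=(\mu\theta+\tfrac12\sigma^2-r)-\mu x-rc_be^{-x},\] and let $b^*$ denote the unique solution of $e^bF(b)=(e^b-c_s)F'(b)$. Define the optimal switching problems \[\tilde J(x)=\sup_{\Lambda_0}\mathbb{E}_x\Big\{\sum_{n=1}^\infty[e^{-r\tau_n}h_s(X_{\tau_n})-e^{-r\nu_n}h_b(X_{\nu_n})]\Big\},\] \[\tilde V(x)=\sup_{\Lambda_1}\mathbb{E}_x\Big\{e^{-r\tau_1}h_s(X_{\tau_1})+\sum_{n=2}^\infty[e^{-r\tau_n}h_s(X_{\tau_n})-e^{-r\nu_n}h_b(X_{\nu_n})]\Big\},\] where $\Lambda_0=(\nu_1,\tau_1,\nu_2,\tau_2,\dots)$ and $\Lambda_1=(\tau_1,\nu_2,\tau_2,\nu_3,\dots)$ range over sequences of stopping times (w.r.t. the filtration of $B$) with $0\le\nu_1\le\tau_1\le\nu_2\le\tau_2\le\cdots$. Suppose one of the following mutually exclusive conditions holds: (i) the equation $f_b(x)=0$ has no root or a single root; (ii) $f_b(x)=0$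 has two distinct roots $x_{b1}<x_{b2}$, there exists $\tilde a^*\in(x_{b1},x_{b2})$ with $F(\tilde a^* )e^{\tilde a^*}=F'(\tilde a^* )(e^{\tilde a^*}+c_b)$, and $\frac{e^{\tilde a^*}+c_b}{F(\tilde a^* )}\ge\frac{e^{b^*}-c_s}{F(b^* )}$; (iii) $f_b(x)=0$ has two distinct roots $x_{b1}<x_{b2}$ but there is no $\tilde a^*\in(x_{b1},x_{b2})$ with $F(\tilde a^* )e^{\tilde a^*}=F'(\tilde a^* )(e^{\tilde a^*}+c_b)$. Then $\tilde J(x)=0$ for all $x\in\mathbb{R}$, and \[\tilde V(x)=\begin{cases}\dfrac{e^{b^*}-c_s}{F(b^* )}F(x), & x<b^*,\\[2mm] e^x-c_s, & x\ge b^*.\end{cases}\]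
   Context: $\mathbb{E}_x$ denotes expectation given $X_0=x$. $F$ is the positive increasing solution of $\frac{\sigma^2}{2}u''+\mu(\theta-x)u'=ru$. *)

theory Defs
  imports "HOL-Probability.Probability"
begin

definition standard_BM :: "'a measure \<Rightarrow> (real \<Rightarrow> 'a \<Rightarrow> real) \<Rightarrow> bool" where
  "standard_BM M B \<longleftrightarrow>
     prob_space M \<and>
     (\<forall>t\<ge>0. B t \<in> borel_measurable M) \<and>
     (\<forall>\<omega>\<in>space M. B 0 \<omega> = 0 \<and> continuous_on {0..} (\<lambda>t. B t \<omega>)) \<and>
     (\<forall>s t. 0 \<le> s \<and> s < t \<longrightarrow>
        distributed M lborel (\<lambda>\<omega>. B t \<omega> - B s \<omega>)
          (\<lambda>y. ennreal (normal_density 0 (sqrt (t - s)) y))) \<and>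
     (\<forall>ts :: nat \<Rightarrow> real. 0 \<le> ts 0 \<and> (\<forall>i. ts i < ts (Suc i)) \<longrightarrow>
        prob_space.indep_vars M (\<lambda>_. borel) (\<lambda>i \<omega>. B (ts (Suc i)) \<omega> - B (ts i) \<omega>) UNIV)"

definition nat_filtration :: "'a measure \<Rightarrow> (real \<Rightarrow> 'a \<Rightarrow> real) \<Rightarrow> real \<Rightarrow> 'a measure" where
  "nat_filtration M B t =
     sigma (space M) (\<Union>u\<in>{0..t}. {B u -` A \<inter> space M | A. A \<in> sets borel})"

definition is_stopping_time :: "'a measure \<Rightarrow> (real \<Rightarrow> 'a \<Rightarrow> real) \<Rightarrow> ('a \<Rightarrow> ennreal) \<Rightarrow> bool" where
  "is_stopping_time M B \<tau> \<longleftrightarrow>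
     (\<forall>t\<ge>0. {\<omega>\<in>space M. \<tau> \<omega> \<le> ennreal t} \<in> sets (nat_filtration M B t))"

definition disc_pay :: "real \<Rightarrow> (real \<Rightarrow> real) \<Rightarrow> (real \<Rightarrow> 'a \<Rightarrow> real) \<Rightarrow> ('a \<Rightarrow> ennreal) \<Rightarrow> 'a \<Rightarrow> real" where
  "disc_pay r h X \<tau> \<omega> =
     (if \<tau> \<omega> = \<infinity> then 0 else exp (- r * enn2real (\<tau> \<omega>)) * h (X (enn2real (\<tau> \<omega>)) \<omega>))"

text \<open>Admissible strategy: all times are stopping times, and the total payoff series
  converges a.s. with an integrable sum (so that its expectation is well defined).\<close>
definition admissible_pay :: "'a measure \<Rightarrow> (nat \<Rightarrow> 'a \<Rightarrow> real) \<Rightarrow> bool" where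
  "admissible_pay M g \<longleftrightarrow>
     (AE \<omega> in M. summable (\<lambda>n. g n \<omega>)) \<and> integrable M (\<lambda>\<omega>. \<Sum>n. g n \<omega>)"

text \<open>Value with start in the "flat" position (Lambda_0 = (nu_1, tau_1, nu_2, ...)),
  indices shifted to start at 0: nu 0 \<le> tau 0 \<le> nu 1 \<le> tau 1 \<le> ...\<close>
definition J_tilde :: "'a measure \<Rightarrow> (real \<Rightarrow> 'a \<Rightarrow> real) \<Rightarrow> (real \<Rightarrow> 'a \<Rightarrow> real) \<Rightarrow> real
    \<Rightarrow> (real \<Rightarrow> real) \<Rightarrow> (real \<Rightarrow> real) \<Rightarrow> ereal" where
  "J_tilde M B X r hs hb =
     (SUP g \<in> {g. \<exists>\<nu> \<tau>. (\<forall>n. is_stopping_time M B (\<nu> n) \<and> is_stopping_time M B (\<tau> n)) \<and>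
                 (\<forall>\<omega>\<in>space M. \<forall>n. \<nu> n \<omega> \<le> \<tau> n \<omega> \<and> \<tau> n \<omega> \<le> \<nu> (Suc n) \<omega>) \<and>
                 g = (\<lambda>n \<omega>. disc_pay r hs X (\<tau> n) \<omega> - disc_pay r hb X (\<nu> n) \<omega>) \<and>
                 admissible_pay M g}.
        ereal (integral\<^sup>L M (\<lambda>\<omega>. \<Sum>n. g n \<omega>)))"

text \<open>Value with start in the "long" position (Lambda_1 = (tau_1, nu_2, tau_2, ...)),
  indices shifted: tau 0 \<le> nu 1 \<le> tau 1 \<le> nu 2 \<le> ... (nu 0 unused).\<close>
definition V_tilde :: "'a measure \<Rightarrow> (real \<Rightarrow> 'a \<Rightarrow> real) \<Rightarrow> (real \<Rightarrow> 'a \<Rightarrow> real) \<Rightarrow> real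
    \<Rightarrow> (real \<Rightarrow> real) \<Rightarrow> (real \<Rightarrow> real) \<Rightarrow> ereal" where
  "V_tilde M B X r hs hb =
     (SUP g \<in> {g. \<exists>\<nu> \<tau>. (\<forall>n. is_stopping_time M B (\<nu> (Suc n)) \<and> is_stopping_time M B (\<tau> n)) \<and>
                 (\<forall>\<omega>\<in>space M. \<forall>n. \<tau> n \<omega> \<le> \<nu> (Suc n) \<omega> \<and> \<nu> (Suc n) \<omega> \<le> \<tau> (Suc n) \<omega>) \<and>
                 g = (\<lambda>n \<omega>. if n = 0 then disc_pay r hs X (\<tau> 0) \<omega>
                            else disc_pay r hs X (\<tau> n) \<omega> - disc_pay r hb X (\<nu> n) \<omega>) \<and>
                 admissible_pay M g}.
        ereal (integral\<^sup>L M (\<lambda>\<omega>. \<Sum>n. g n \<omega>)))"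

definition F_OU :: "real \<Rightarrow> real \<Rightarrow> real \<Rightarrow> real \<Rightarrow> real \<Rightarrow> real" where
  "F_OU \<mu> \<theta> \<sigma> r x =
     (LBINT u:{0<..}. u powr (r / \<mu> - 1) *
        exp (sqrt (2 * \<mu> / \<sigma>\<^sup>2) * (x - \<theta>) * u - u\<^sup>2 / 2))"

end

(*
  The claimed V is shown to be r-excessive for the Ornstein-Uhlenbeck semigroup. The transition
  kernel is Gaussian and F and its mirror image phi are r-harmonic for it by an explicit Fubini
  computation. By the Wronskian of F with a smooth u, monotonicity of u/F is governed by the sign
  of (generator - r) u. This shows that b* maximises (e^x - c_s)/F, that V is at each point touched
  from above by a combination of F and phi (hence excessive, with no appeal to Ito's formula), and
  that each of the conditions (i)-(iii) gives V <= e^x + c_b.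

  Optional sampling, by dyadic approximation, then makes the mean of every round trip nonpositive
  and that of the first sale at most V(x). For infinitely many trades one needs in addition that the
  sum of the positive parts of the trade payoffs is integrable: the cost c_b forces the price to
  rise by more than c_b in a profitable trade, so such trades are controlled by discounted
  upcrossings of a sequence of levels. Equality for V is attained by the first hitting time of
  [b*, infinity).
*)
theory Submission
  imports Defs
begin

section \<open>A parabolic cylinder integral\<close>

text \<open>Admissibility only asks that the payoff series converge almost surely with an integrable
  sum. Nothing dominates the partial sums: as in a doubling strategy, each of them may have
  nonpositive mean while the limit has positive mean. A bound on the positive parts that is uniform
  over strategies is therefore indispensable. A pair of levels l < l' contributes at most F(x) /
  (F(l') - F(l)) in mean discounted upcrossings, and summing over infinitely many pairs works
  because F outgrows every power of the price.

  The same growth is an obstacle elsewhere: F is not bounded by the price plus a constant, so limits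
  along dyadic times are not dominated for it. Truncated functions take its place where upper bounds
  are wanted, and the martingale property of F itself is used only up to a finite horizon.

  The integral below is Gamma(p + 1) exp(z^2 / 4) times the parabolic cylinder function D of order -
  p - 1 at - z. With general p it contains F, its mirror image and their derivatives alike.\<close>

definition hermite_int :: "real \<Rightarrow> real \<Rightarrow> real" where
  "hermite_int p z = (LBINT u:{0<..}. u powr p * exp (z * u - u\<^sup>2 / 2))"

text \<open>Completing the square with (u - (z + 1))^2 bounds the exponent by (z + 1)^2 / 2 - u,
  which leaves the integrand of Gamma(p + 1).\<close>

lemma hermite_int_integrable:
  assumes "p > -1"
  shows "set_integrable lborel {0<..} (\<lambda>u::real. u powr p * exp (z * u - u\<^sup>2 / 2))"
proof -
  let ?g = "\<lambda>t::real. indicator {0..} t * t powr (p + 1 - 1) / exp t"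
  have g: "integrable lborel ?g"
  proof (rule integrableI_nonneg)
    have "(\<integral>\<^sup>+t. ennreal (?g t) \<partial>lborel) = ennreal (Gamma (p + 1))"
      using Gamma_conv_nn_integral_real[of "p + 1"] assms by simp
    then show "(\<integral>\<^sup>+t. ennreal (?g t) \<partial>lborel) < \<infinity>"
      by simp
  qed auto
  show ?thesis
    unfolding set_integrable_def
  proof (rule Bochner_Integration.integrable_bound)
    show "integrable lborel (\<lambda>t. exp ((z + 1)\<^sup>2 / 2) * ?g t)"
      using g by (rule integrable_mult_right)
    have *: "z * u - u\<^sup>2 / 2 \<le> (z + 1)\<^sup>2 / 2 - u" for u :: real
    proof -
      have "0 \<le> (u - (z + 1))\<^sup>2 / 2" by simp
      then show ?thesis by (simp add: power2_eq_square field_simps)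
    qed
    have "exp (z * u - u\<^sup>2 / 2) \<le> exp ((z + 1)\<^sup>2 / 2) / exp u" for u :: real
      using * by (simp add: exp_diff[symmetric])
    from mult_left_mono[OF this, of "u powr p" for u]
    show "AE u in lborel. norm (indicator {0<..} u *\<^sub>R (u powr p * exp (z * u - u\<^sup>2 / 2)))
        \<le> norm (exp ((z + 1)\<^sup>2 / 2) * ?g u)"
      by (intro AE_I2) (auto simp: indicator_def abs_mult mult_ac)
  qed auto
qed

lemma hermite_int_pos:
  assumes "p > -1"
  shows "hermite_int p z > 0"
proof -
  let ?f = "\<lambda>u. indicator {0<..} u *\<^sub>R (u powr p * exp (z * u - u\<^sup>2 / 2))"
  have int: "integrable lborel ?f"
    using hermite_int_integrable[OF assms, of z] unfolding set_integrable_def .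
  have "hermite_int p z \<noteq> 0"
  proof
    assume "hermite_int p z = 0"
    then have "AE u in lborel. ?f u = 0"
      using integral_nonneg_eq_0_iff_AE[OF int]
      unfolding hermite_int_def set_lebesgue_integral_def by auto
    then have "AE u in lborel. u \<notin> {0<..<1::real}"
      by eventually_elim (auto simp: indicator_def)
    then have "emeasure lborel {0<..<1::real} = 0"
      by (subst (asm) AE_iff_measurable[OF _ refl]) (auto simp: greaterThanLessThan_def greaterThan_def lessThan_def Collect_conj_eq)
    then show False by simp
  qed
  moreover have "hermite_int p z \<ge> 0"
    unfolding hermite_int_def set_lebesgue_integral_def
    by (intro integral_nonneg_AE) auto
  ultimately show ?thesis by simp
qed

text \<open>Taylor's formula with remainder. It serves twice: for the derivative under the integral
  sign and for the error of the discretised integrating factor.\<close>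

lemma exp_second_order_bound:
  fixes y :: real
  shows "\<bar>exp y - 1 - y\<bar> \<le> y\<^sup>2 * exp \<bar>y\<bar>"
proof -
  obtain t where t: "\<bar>t\<bar> \<le> \<bar>y\<bar>" "exp y = (\<Sum>m<2. y ^ m / fact m) + exp t / fact 2 * y ^ 2"
    using Maclaurin_exp_le[of y 2] by auto
  then have "exp y - 1 - y = exp t / 2 * y\<^sup>2"
    by (simp add: numeral_2_eq_2)
  moreover have "exp t / 2 * y\<^sup>2 \<ge> 0" by simp
  ultimately have "\<bar>exp y - 1 - y\<bar> = exp t / 2 * y\<^sup>2" by linarith
  also have "\<dots> \<le> exp \<bar>y\<bar> * y\<^sup>2"
  proof (rule mult_right_mono)
    have "exp t \<le> exp \<bar>y\<bar>" using t(1) by simp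
    moreover have "0 < exp t" by simp
    ultimately show "exp t / 2 \<le> exp \<bar>y\<bar>" by linarith
  qed simp
  finally show ?thesis by (simp add: mult.commute)
qed

text \<open>Differentiation in z brings down a factor u. For |h| \<le> 1 the second order remainder
  is at most h^2 times the integrand with exponent p + 2 at z + 1, so the difference quotient is off
  by at most |h| \<open>C\<close> with \<open>C\<close> independent of h.\<close>

lemma hermite_int_deriv:
  assumes p: "p > -1"
  shows "(hermite_int p has_real_derivative hermite_int (p + 1) z) (at z)"
proof -
  let ?k = "\<lambda>q z u. indicator {0<..} u *\<^sub>R (u powr q * exp (z * u - u\<^sup>2 / 2)) :: real"
  have int: "integrable lborel (?k q z)" if "q > -1" for q z
    using hermite_int_integrable[OF that, of z] unfolding set_integrable_def .
  have H: "hermite_int q z = integral\<^sup>L lborel (?k q z)" for q z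
    unfolding hermite_int_def set_lebesgue_integral_def ..
  define C where "C = hermite_int (p + 2) (z + 1)"
  have C: "C \<ge> 0" unfolding C_def using hermite_int_pos[of "p+2"] p by (simp add: less_imp_le)
  have bound: "\<bar>hermite_int p (z + h) - hermite_int p z - h * hermite_int (p + 1) z\<bar> \<le> h\<^sup>2 * C"
    if h: "\<bar>h\<bar> \<le> 1" for h
  proof -
    have pw: "\<bar>?k p (z + h) u - ?k p z u - h * ?k (p + 1) z u\<bar> \<le> h\<^sup>2 * ?k (p + 2) (z + 1) u" for u
    proof (cases "u > 0")
      case True
      define P E G where "P = u powr p" and "E = exp (z * u - u\<^sup>2 / 2)" and "G = exp (h * u)"
      have e1: "exp ((z + h) * u - u\<^sup>2 / 2) = E * G"
        unfolding E_def G_def exp_add[symmetric] by (simp add: algebra_simps)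
      have e2: "u powr (p + 1) = P * u" "u powr (p + 2) = P * u\<^sup>2"
        using True by (simp_all add: powr_add P_def)
      have e3: "exp ((z + 1) * u - u\<^sup>2 / 2) = E * exp u"
        unfolding E_def exp_add[symmetric] by (simp add: algebra_simps)
      have ind: "indicator {0<..} u = (1::real)" using True by simp
      have "?k p (z + h) u - ?k p z u - h * ?k (p + 1) z u
          = P * (E * G) - P * E - h * (P * u * E)"
        unfolding ind e1 e2 by (simp add: P_def E_def)
      also have "\<dots> = u powr p * exp (z * u - u\<^sup>2 / 2) * (exp (h * u) - 1 - h * u)"
        unfolding P_def[symmetric] E_def[symmetric] G_def[symmetric] by (simp add: algebra_simps)
      also have "\<bar>\<dots>\<bar> \<le> u powr p * exp (z * u - u\<^sup>2 / 2) * ((h * u)\<^sup>2 * exp \<bar>h * u\<bar>)"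
        using exp_second_order_bound[of "h * u"] by (simp add: abs_mult mult_left_mono)
      also have "\<dots> \<le> u powr p * exp (z * u - u\<^sup>2 / 2) * ((h * u)\<^sup>2 * exp u)"
        using True h by (intro mult_left_mono) (auto simp: abs_mult mult_left_le_one_le)
      also have "\<dots> = h\<^sup>2 * (u powr p * u\<^sup>2) * (exp (z * u - u\<^sup>2 / 2) * exp u)"
        by (simp add: power_mult_distrib)
      also have "\<dots> = h\<^sup>2 * ?k (p + 2) (z + 1) u"
        unfolding ind e3 e2 by (simp add: P_def E_def)
      finally show ?thesis .
    qed simp
    have i1: "integrable lborel (\<lambda>u. ?k p (z + h) u - ?k p z u - h * ?k (p + 1) z u)"
      using p by (intro Bochner_Integration.integrable_diff integrable_mult_right int) auto
    have i2: "integrable lborel (\<lambda>u. h\<^sup>2 * ?k (p + 2) (z + 1) u)"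
      using p by (intro integrable_mult_right int) auto
    have eq: "hermite_int p (z + h) - hermite_int p z - h * hermite_int (p + 1) z
        = (\<integral>u. ?k p (z + h) u - ?k p z u - h * ?k (p + 1) z u \<partial>lborel)"
      using p int[of p] int[of "p + 1"] by (simp add: H)
    have "\<bar>hermite_int p (z + h) - hermite_int p z - h * hermite_int (p + 1) z\<bar>
        \<le> (\<integral>u. h\<^sup>2 * ?k (p + 2) (z + 1) u \<partial>lborel)"
      unfolding eq real_norm_def[symmetric]
      by (rule Bochner_Integration.integral_norm_bound_integral[OF i1 i2]) (unfold real_norm_def, rule pw)
    then show ?thesis unfolding C_def H[of "p + 2"] by (subst (asm) integral_mult_right_zero)
  qed
  show ?thesis
    unfolding DERIV_def
  proof (rule LIM_I)
    fix e :: real assume e: "e > 0"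
    show "\<exists>s>0. \<forall>h. h \<noteq> 0 \<and> norm (h - 0) < s \<longrightarrow>
        norm ((hermite_int p (z + h) - hermite_int p z) / h - hermite_int (p + 1) z) < e"
    proof (intro exI[of _ "min 1 (e / (C + 1))"] conjI allI impI)
      show "min 1 (e / (C + 1)) > 0" using e C by simp
      fix h :: real assume h: "h \<noteq> 0 \<and> norm (h - 0) < min 1 (e / (C + 1))"
      let ?d = "hermite_int p (z + h) - hermite_int p z - h * hermite_int (p + 1) z"
      have "(hermite_int p (z + h) - hermite_int p z) / h - hermite_int (p + 1) z = ?d / h"
        using h by (simp add: field_simps)
      then have "norm ((hermite_int p (z + h) - hermite_int p z) / h - hermite_int (p + 1) z) = \<bar>?d\<bar> / \<bar>h\<bar>"
        by simp
      also have "\<dots> \<le> \<bar>h\<bar> * C"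
        using bound[of h] h by (simp add: divide_le_eq power2_eq_square mult_ac)
      also have "\<dots> \<le> \<bar>h\<bar> * (C + 1)" by (intro mult_left_mono) auto
      also have "\<dots> < e" using h C by (simp add: field_simps)
      finally show "norm ((hermite_int p (z + h) - hermite_int p z) / h - hermite_int (p + 1) z) < e" .
    qed
  qed
qed

text \<open>Integration of the derivative of u^(p + 1) exp(z u - u^2 / 2), whose boundary values
  vanish at infinity and, because p + 1 > 0, at 0. Since a derivative in z raises p by one, this is
  the differential equation H'' = z H' + (p + 1) H.\<close>

lemma hermite_int_recurrence:
  assumes p: "p > -1"
  shows "hermite_int (p + 2) z = z * hermite_int (p + 1) z + (p + 1) * hermite_int p z"
proof -
  let ?k = "\<lambda>q u. u powr q * exp (z * u - u\<^sup>2 / 2) :: real"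
  let ?G = "\<lambda>u. u powr (p + 1) * exp (z * u - u\<^sup>2 / 2)"
  let ?g = "\<lambda>u. (p + 1) * ?k p u + z * ?k (p + 1) u - ?k (p + 2) u"
  have int: "set_integrable lborel {0<..} (?k q)" if "q > -1" for q
    using hermite_int_integrable[OF that, of z] .
  have e: "einterval 0 \<infinity> = {0::real<..}" by (auto simp: einterval_def zero_ereal_def)
  have der: "(?G has_vector_derivative ?g u) (at u)" if "0 < ereal u" for u
  proof -
    from that have u: "u > 0" by simp
    have d1: "((\<lambda>u. u powr (p + 1)) has_real_derivative (p + 1) * u powr p) (at u)"
      using has_real_derivative_powr[OF u, of "p + 1"] by simp
    have d2: "((\<lambda>u. exp (z * u - u\<^sup>2 / 2)) has_real_derivative (z - u) * exp (z * u - u\<^sup>2 / 2)) (at u)"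
      by (auto intro!: derivative_eq_intros)
    have pw: "u powr (p + 1) = u * u powr p" "u powr (p + 2) = u\<^sup>2 * u powr p"
      using u by (simp_all add: powr_add)
    show ?thesis
      unfolding has_real_derivative_iff_has_vector_derivative[symmetric]
      by (rule DERIV_cong[OF DERIV_mult[OF d1 d2]]) (unfold pw, simp add: algebra_simps power2_eq_square)
  qed
  have cont: "isCont ?g u" if "0 < ereal u" for u
    using that by (intro continuous_intros) auto
  have sint: "set_integrable lborel (einterval 0 \<infinity>) ?g"
      unfolding e using p by (intro set_integral_add set_integral_diff set_integrable_mult_right int) auto
  have lim0: "((?G \<circ> real_of_ereal) \<longlongrightarrow> 0) (at_right 0)"
  proof -
    have "((\<lambda>u::real. u powr (p + 1) * exp (z * u - u\<^sup>2 / 2)) \<longlongrightarrow> 0 powr (p+1) * exp (z * 0 - 0\<^sup>2 / 2)) (at_right 0)"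
      using p by (intro tendsto_intros tendsto_powr2) (auto intro!: eventually_at_rightI[of 0 1])
    then show ?thesis
      by (simp add: zero_ereal_def ereal_tendsto_simps)
  qed
  have lim1: "((?G \<circ> real_of_ereal) \<longlongrightarrow> 0) (at_left \<infinity>)"
  proof -
    have b: "?G u \<le> exp ((z + 1)\<^sup>2 / 2) * (u powr (p + 1) / exp u)" for u
    proof -
      have "0 \<le> (u - (z + 1))\<^sup>2 / 2" by simp
      then have "z * u - u\<^sup>2 / 2 \<le> (z + 1)\<^sup>2 / 2 - u" by (simp add: power2_eq_square field_simps)
      then have "exp (z * u - u\<^sup>2 / 2) \<le> exp ((z + 1)\<^sup>2 / 2) / exp u"
        by (simp add: exp_diff[symmetric])
      from mult_left_mono[OF this, of "u powr (p + 1)"] show ?thesis by (simp add: mult_ac)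
    qed
    obtain n :: nat where n: "p + 1 \<le> real n" using real_arch_simple by blast
    have lim: "((\<lambda>u::real. exp ((z + 1)\<^sup>2 / 2) * (u ^ n / exp u)) \<longlongrightarrow> 0) at_top"
      using tendsto_mult[OF tendsto_const[of "exp ((z + 1)\<^sup>2 / 2)"] tendsto_power_div_exp_0[of n]]
      by (simp only: mult_zero_right)
    have "(?G \<longlongrightarrow> 0) at_top"
    proof (rule tendsto_sandwich[OF _ _ tendsto_const lim])
      show "\<forall>\<^sub>F u in at_top. 0 \<le> ?G u" by simp
      show "\<forall>\<^sub>F u in at_top. ?G u \<le> exp ((z + 1)\<^sup>2 / 2) * (u ^ n / exp u)"
        using eventually_ge_at_top[of 1]
      proof eventually_elim
        case (elim u)
        have "u powr (p + 1) \<le> u powr real n" using n elim by (intro powr_mono) auto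
        also have "\<dots> = u ^ n" using elim by (simp add: powr_realpow)
        finally show ?case
          using b[of u] by (elim order.trans) (auto intro!: mult_left_mono divide_right_mono)
      qed
    qed
    then show ?thesis
      by (simp add: ereal_tendsto_simps)
  qed
  have "(LBINT u=0..\<infinity>. ?g u) = 0 - 0"
    by (rule interval_integral_FTC_integrable[OF _ der cont sint lim0 lim1]) simp_all
  moreover have "(LBINT u=0..\<infinity>. ?g u) = (LBINT u:{0<..}. ?g u)"
    by (simp add: interval_lebesgue_integral_def e)
  moreover have "(LBINT u:{0<..}. ?g u)
      = (p + 1) * hermite_int p z + z * hermite_int (p + 1) z - hermite_int (p + 2) z"
    using int[of p] int[of "p+1"] int[of "p+2"] p
    by (simp add: hermite_int_def set_integral_add set_integral_diff)
  ultimately show ?thesis by simp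
qed

lemma nn_integral_hermite_int:
  assumes "p > -1"
  shows "(\<integral>\<^sup>+u. ennreal (indicator {0<..} u * (u powr p * exp (z * u - u\<^sup>2 / 2))) \<partial>lborel) = ennreal (hermite_int p z)"
proof -
  have "integrable lborel (\<lambda>u. indicator {0<..} u * (u powr p * exp (z * u - u\<^sup>2 / 2)))"
    using hermite_int_integrable[OF assms, of z] unfolding set_integrable_def by simp
  then show ?thesis
    unfolding hermite_int_def set_lebesgue_integral_def by (subst nn_integral_eq_integral) auto
qed

lemma nn_integral_exp_std_normal:
  "(\<integral>\<^sup>+w. ennreal (exp (a + b * w)) \<partial>std_normal_distribution) = ennreal (exp (a + b\<^sup>2 / 2))"
proof -
  have "(\<integral>\<^sup>+w. ennreal (exp (a + b * w)) \<partial>std_normal_distribution)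
      = (\<integral>\<^sup>+w. ennreal (std_normal_density w) * ennreal (exp (a + b * w)) \<partial>lborel)"
    by (subst nn_integral_density) auto
  also have "\<dots> = (\<integral>\<^sup>+w. ennreal (exp (a + b\<^sup>2 / 2)) * ennreal (std_normal_density (w - b)) \<partial>lborel)"
  proof (intro nn_integral_cong)
    fix w :: real
    have "std_normal_density w * exp (a + b * w) = exp (a + b\<^sup>2 / 2) * std_normal_density (w - b)"
      by (simp add: std_normal_density_def exp_add[symmetric] field_simps power2_eq_square)
    then show "ennreal (std_normal_density w) * ennreal (exp (a + b * w))
      = ennreal (exp (a + b\<^sup>2 / 2)) * ennreal (std_normal_density (w - b))"
      by (simp add: ennreal_mult'[symmetric])
  qed
  also have "\<dots> = ennreal (exp (a + b\<^sup>2 / 2)) * (\<integral>\<^sup>+w. ennreal (std_normal_density (w - b)) \<partial>lborel)"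
    by (subst nn_integral_cmult) auto
  also have "(\<integral>\<^sup>+w. ennreal (std_normal_density (w - b)) \<partial>lborel) = (\<integral>\<^sup>+w. ennreal (std_normal_density w) \<partial>lborel)"
    using nn_integral_real_affine[of "\<lambda>w. ennreal (std_normal_density w)" 1 "- b"]
    by (simp add: algebra_simps)
  also have "(\<integral>\<^sup>+w. ennreal (std_normal_density w) \<partial>lborel) = 1"
    by (subst nn_integral_eq_integral) (auto simp: integrable_normal_density integral_normal_density)
  finally show ?thesis by simp
qed

text \<open>The argument c z + s w is an Ornstein-Uhlenbeck step in Mehler form. After Fubini the
  Gaussian mean of exp(s u w) is exp(s^2 u^2 / 2), and s^2 = 1 - c^2 turns the exponent into z (c u)
  - (c u)^2 / 2; substituting c u yields the power of c. Only the square of s is prescribed, so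
  either sign may be used.\<close>

lemma hermite_int_gaussian:
  assumes p: "p > -1" and c: "0 < c" and s: "s\<^sup>2 = 1 - c\<^sup>2"
  shows "(\<integral>\<^sup>+w. ennreal (hermite_int p (c * z + s * w)) \<partial>std_normal_distribution)
    = ennreal (c powr (- (p + 1)) * hermite_int p z)"
proof -
  let ?k = "\<lambda>z u. indicator {0<..} u * (u powr p * exp (z * u - u\<^sup>2 / 2)) :: real"
  interpret N: prob_space std_normal_distribution by (rule prob_space_normal_density) simp
  interpret P: pair_sigma_finite std_normal_distribution lborel
    by standard
  have "(\<integral>\<^sup>+w. ennreal (hermite_int p (c * z + s * w)) \<partial>std_normal_distribution)
     = (\<integral>\<^sup>+w. (\<integral>\<^sup>+u. ennreal (?k (c * z + s * w) u) \<partial>lborel) \<partial>std_normal_distribution)"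
    by (simp add: nn_integral_hermite_int[OF p])
  also have "\<dots> = (\<integral>\<^sup>+u. (\<integral>\<^sup>+w. ennreal (?k (c * z + s * w) u) \<partial>std_normal_distribution) \<partial>lborel)"
    by (rule P.Fubini'[symmetric]) (auto simp: case_prod_beta)
  also have "\<dots> = (\<integral>\<^sup>+u. ennreal (c powr (- p) * ?k z (c * u)) \<partial>lborel)"
  proof (rule nn_integral_cong)
    fix u :: real
    have "(\<integral>\<^sup>+w. ennreal (?k (c * z + s * w) u) \<partial>std_normal_distribution)
       = (\<integral>\<^sup>+w. ennreal (indicator {0<..} u * u powr p) * ennreal (exp ((c * z * u - u\<^sup>2 / 2) + (s * u) * w)) \<partial>std_normal_distribution)"
      by (intro nn_integral_cong) (simp add: ennreal_mult'[symmetric] algebra_simps)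
    also have "\<dots> = ennreal (indicator {0<..} u * u powr p) * ennreal (exp ((c * z * u - u\<^sup>2 / 2) + (s * u)\<^sup>2 / 2))"
      by (subst nn_integral_cmult) (simp_all add: nn_integral_exp_std_normal)
    also have "(c * z * u - u\<^sup>2 / 2) + (s * u)\<^sup>2 / 2 = z * (c * u) - (c * u)\<^sup>2 / 2"
      by (simp add: power_mult_distrib s field_simps)
    also have "ennreal (indicator {0<..} u * u powr p) * ennreal (exp (z * (c * u) - (c * u)\<^sup>2 / 2))
       = ennreal (c powr (- p) * ?k z (c * u))"
      using c by (auto simp: ennreal_mult'[symmetric] indicator_def powr_mult powr_minus zero_less_mult_iff)
    finally show "(\<integral>\<^sup>+w. ennreal (?k (c * z + s * w) u) \<partial>std_normal_distribution) = ennreal (c powr (- p) * ?k z (c * u))" .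
  qed
  also have "\<dots> = ennreal (c powr (- p)) * (\<integral>\<^sup>+u. ennreal (?k z (c * u)) \<partial>lborel)"
    by (subst nn_integral_cmult[symmetric]) (auto simp: ennreal_mult')
  also have "(\<integral>\<^sup>+u. ennreal (?k z (c * u)) \<partial>lborel) = ennreal (1 / c) * (\<integral>\<^sup>+u. ennreal (?k z u) \<partial>lborel)"
    using nn_integral_real_affine[of "\<lambda>u. ennreal (?k z u)" c 0] c
    by (simp add: mult.assoc[symmetric] ennreal_mult'[symmetric])
  also have "ennreal (c powr (- p)) * (ennreal (1 / c) * (\<integral>\<^sup>+u. ennreal (?k z u) \<partial>lborel))
     = ennreal (c powr (- (p + 1)) * hermite_int p z)"
    unfolding nn_integral_hermite_int[OF p]
    using c by (simp add: ennreal_mult'[symmetric] powr_diff powr_minus_divide divide_simps flip: ennreal_mult)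
  finally show ?thesis .
qed

text \<open>Restricting the integral to u \<ge> l for z \<ge> 0, and to u \<le> l for z \<le> 0,
  ensures z u \<ge> l z; the remaining Gaussian weight is a positive constant.\<close>

lemma exp_le_hermite_int:
  assumes p: "p > -1" and l: "l > 0"
  shows "\<exists>C>0. \<forall>z. exp (l * z) \<le> C * hermite_int p z"
proof -
  let ?k = "\<lambda>z u. u powr p * exp (z * u - u\<^sup>2 / 2) :: real"
  \<comment> \<open>The sign \<open>s\<close> treats both half lines at once. The interval from
    \<open>a\<close> to \<open>b\<close> certifies that \<open>A\<close> has positive
    measure.\<close>
  have main: "\<exists>C>0. \<forall>z. s * z \<ge> 0 \<longrightarrow> exp (l * z) \<le> C * hermite_int p z"
    if A: "A \<in> sets lborel" "A \<subseteq> {0<..}" "\<And>u. u \<in> A \<Longrightarrow> s * (u - l) \<ge> 0" "{a<..<b} \<subseteq> A" "0 \<le> a" "a < b"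
      and s: "s = 1 \<or> s = -1"
    for A s a b
  proof -
    define c where "c = (LBINT u:A. ?k 0 u)"
    have int: "set_integrable lborel A (?k z)" for z
      by (rule set_integrable_subset[OF hermite_int_integrable[OF p, of z]]) (use A in auto)
    have "c \<noteq> 0"
    proof
      assume "c = 0"
      then have "AE u in lborel. indicator A u *\<^sub>R ?k 0 u = 0"
        using integral_nonneg_eq_0_iff_AE[OF int[of 0, unfolded set_integrable_def]]
        unfolding c_def set_lebesgue_integral_def by auto
      then have "AE u in lborel. u \<notin> {a<..<b}"
        by eventually_elim (use A in \<open>auto simp: indicator_def split: if_splits\<close>)
      then have "emeasure lborel {a<..<b} = 0"
        by (subst (asm) AE_iff_measurable[OF _ refl]) (auto simp: greaterThanLessThan_def greaterThan_def lessThan_def Collect_conj_eq)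
      then show False using A by simp
    qed
    moreover have "c \<ge> 0" unfolding c_def set_lebesgue_integral_def by (intro integral_nonneg_AE) auto
    ultimately have c: "c > 0" by simp
    have "exp (l * z) \<le> 1 / c * hermite_int p z" if z: "s * z \<ge> 0" for z
    proof -
      have "exp (l * z) * c = (LBINT u:A. exp (l * z) * ?k 0 u)"
        unfolding c_def by simp
      also have "\<dots> \<le> (LBINT u:A. ?k z u)"
      proof (rule set_integral_mono)
        show "set_integrable lborel A (\<lambda>u. exp (l * z) * ?k 0 u)"
          using int[of 0] by (intro set_integrable_mult_right) simp
        fix u assume u: "u \<in> A"
        have "0 \<le> (s * z) * (s * (u - l))" using z A(3)[OF u] by (rule mult_nonneg_nonneg)
        then have "l * z \<le> z * u" using s by (auto simp: algebra_simps)
        then have "exp (l * z) * exp (- u\<^sup>2 / 2) \<le> exp (z * u - u\<^sup>2 / 2)"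
          by (simp add: exp_add[symmetric])
        then show "exp (l * z) * ?k 0 u \<le> ?k z u"
          by (simp add: mult.left_commute mult_left_mono)
      qed (rule int)
      also have "\<dots> \<le> (LBINT u:{0<..}. ?k z u)"
        unfolding set_lebesgue_integral_def
      proof (rule integral_mono)
        show "indicator A u *\<^sub>R ?k z u \<le> indicator {0<..} u *\<^sub>R ?k z u" for u
          using A(2) by (auto simp: indicator_def)
      qed (use int hermite_int_integrable[OF p] in \<open>auto simp: set_integrable_def\<close>)
      finally have "exp (l * z) * c \<le> hermite_int p z" unfolding hermite_int_def .
      then show ?thesis using c by (simp add: field_simps)
    qed
    with c show ?thesis by (intro exI[of _ "1 / c"]) auto
  qed
  obtain C1 where C1: "C1 > 0" "\<And>z. z \<ge> 0 \<Longrightarrow> exp (l * z) \<le> C1 * hermite_int p z"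
    using main[of "{l..}" 1 l "l + 1"] l by (fastforce simp: subset_eq)
  obtain C2 where C2: "C2 > 0" "\<And>z. z \<le> 0 \<Longrightarrow> exp (l * z) \<le> C2 * hermite_int p z"
    using main[of "{0<..l}" "-1" 0 l] l by (fastforce simp: subset_eq)
  have "exp (l * z) \<le> max C1 C2 * hermite_int p z" for z
  proof (cases "z \<ge> 0")
    case True
    have "C1 * hermite_int p z \<le> max C1 C2 * hermite_int p z"
      using hermite_int_pos[OF p, of z] by (intro mult_right_mono) auto
    with C1(2)[OF True] show ?thesis by linarith
  next
    case False
    have "C2 * hermite_int p z \<le> max C1 C2 * hermite_int p z"
      using hermite_int_pos[OF p, of z] by (intro mult_right_mono) auto
    with C2(2)[of z] False show ?thesis by linarith
  qed
  then show ?thesis using C1(1) by (intro exI[of _ "max C1 C2"]) auto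
qed

section \<open>Brownian motion and the transition kernel\<close>

text \<open>A discretised integrating factor: it identifies the noise of the process as a limit of sums
  of Brownian increments without a stochastic integral.\<close>

lemma ou_riemann_sum:
  fixes y \<beta> :: "real \<Rightarrow> real"
  assumes cont: "continuous_on {a..b} y" and ab: "a < b" and \<mu>: "\<mu> > 0"
    and eq: "\<And>u v. a \<le> u \<Longrightarrow> u \<le> v \<Longrightarrow> v \<le> b \<Longrightarrow> \<beta> v - \<beta> u = y v - y u + \<mu> * integral {u..v} y"
  shows "(\<lambda>n. \<Sum>j<n. exp (\<mu> * (a + real j * ((b - a) / real n))) *
             (\<beta> (a + real (Suc j) * ((b - a) / real n)) - \<beta> (a + real j * ((b - a) / real n))))
         \<longlonglongrightarrow> exp (\<mu> * b) * y b - exp (\<mu> * a) * y a"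
proof -
  define L where "L = b - a"
  have L: "L > 0" using ab by (simp add: L_def)
  obtain K where K: "K > 0" "\<And>u. u \<in> {a..b} \<Longrightarrow> \<bar>y u\<bar> \<le> K"
    using compact_imp_bounded[OF compact_continuous_image[OF cont compact_Icc]]
    by (auto simp: bounded_pos)
  have unif: "\<exists>d>0. \<forall>u\<in>{a..b}. \<forall>v\<in>{a..b}. \<bar>v - u\<bar> < d \<longrightarrow> \<bar>y v - y u\<bar> < e" if "e > 0" for e
    using compact_uniformly_continuous[OF cont compact_Icc] that
    unfolding uniformly_continuous_on_def dist_real_def by blast
  \<comment> \<open>\<open>C1\<close> collects the second order Taylor errors of the
    \<open>n\<close> steps, each of size 1 / n^2; \<open>C2\<close> multiplies the oscillation of
    \<open>y\<close> over one step.\<close>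
  define C1 where "C1 = exp (\<mu> * b) * (\<mu>\<^sup>2 * L\<^sup>2 * exp (\<mu> * L) * K)"
  define C2 where "C2 = exp (\<mu> * b) * \<mu> * L"
  have C: "C1 \<ge> 0" "C2 \<ge> 0" using \<mu> L K(1) by (auto simp: C1_def C2_def)
  have bound: "\<bar>(\<Sum>j<n. exp (\<mu> * (a + real j * (L / n))) * (\<beta> (a + real (Suc j) * (L / n)) - \<beta> (a + real j * (L / n))))
       - (exp (\<mu> * b) * y b - exp (\<mu> * a) * y a)\<bar> \<le> C1 / n + C2 * e"
    if n: "n > 0" and d: "\<And>u v. u \<in> {a..b} \<Longrightarrow> v \<in> {a..b} \<Longrightarrow> \<bar>v - u\<bar> < d \<Longrightarrow> \<bar>y v - y u\<bar> < e" and nd: "L / n < d"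
    for n :: nat and d e
  proof -
    define \<delta> where "\<delta> = L / n"
    define t where "t j = a + real j * \<delta>" for j
    have \<delta>: "\<delta> > 0" "\<delta> \<le> L" using L n by (auto simp: \<delta>_def divide_le_eq)
    have t0: "t 0 = a" "t n = b" using n by (auto simp: t_def \<delta>_def L_def)
    have tS: "t (Suc j) = t j + \<delta>" for j by (simp add: t_def algebra_simps)
    have t_mem: "t j \<in> {a..b}" if "j \<le> n" for j
    proof -
      have "real j * \<delta> \<le> real n * \<delta>" using that \<delta> by (intro mult_right_mono) auto
      then show ?thesis using t0 \<delta> by (auto simp: t_def)
    qed
    define R where "R j = exp (\<mu> * t j) * (\<beta> (t (Suc j)) - \<beta> (t j)) - (exp (\<mu> * t (Suc j)) * y (t (Suc j)) - exp (\<mu> * t j) * y (t j))" for j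
    have R: "\<bar>R j\<bar> \<le> exp (\<mu> * b) * (\<mu>\<^sup>2 * \<delta>\<^sup>2 * exp (\<mu> * L) * K + \<mu> * \<delta> * e)" if j: "j < n" for j
    proof -
      let ?u = "t j" and ?v = "t (Suc j)"
      have uv: "?u \<in> {a..b}" "?v \<in> {a..b}" using t_mem[of j] t_mem[of "Suc j"] j by auto
      have le: "?u \<le> ?v" using tS \<delta> by simp
      have sub: "{?u..?v} \<subseteq> {a..b}" using uv by auto
      have inty: "y integrable_on {?u..?v}"
        by (rule integrable_continuous_real[OF continuous_on_subset[OF cont sub]])
      have I: "integral {?u..?v} (\<lambda>s. y ?v - y s) = \<delta> * y ?v - integral {?u..?v} y"
        using inty tS \<delta> by (subst integral_diff) auto
      have Ib: "\<bar>integral {?u..?v} (\<lambda>s. y ?v - y s)\<bar> \<le> e * (?v - ?u)"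
        unfolding real_norm_def[symmetric]
      proof (rule integral_bound[OF le])
        show "continuous_on {?u..?v} (\<lambda>s. y ?v - y s)"
          by (intro continuous_intros continuous_on_subset[OF cont sub])
        fix s assume s: "s \<in> {?u..?v}"
        then have "\<bar>?v - s\<bar> < d" using tS nd by (auto simp: \<delta>_def)
        then show "norm (y ?v - y s) \<le> e" using d[of s ?v] s sub uv by (auto intro: less_imp_le)
      qed
      \<comment> \<open>Replacing the integral of \<open>y\<close> over the step by \<delta> times
        the right end value leaves two errors: the Taylor remainder of exp(\<mu> \<delta>) times
        that value, and the integral of the deviation from it.\<close>
      have Rj: "R j = exp (\<mu> * ?u) * (- ((exp (\<mu> * \<delta>) - 1 - \<mu> * \<delta>) * y ?v) - \<mu> * integral {?u..?v} (\<lambda>s. y ?v - y s))"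
      proof -
        define J where "J = integral {?u..?v} y"
        have e1: "\<beta> ?v - \<beta> ?u = y ?v - y ?u + \<mu> * J" unfolding J_def by (rule eq) (use uv le in auto)
        have e2: "exp (\<mu> * ?v) = exp (\<mu> * ?u) * exp (\<mu> * \<delta>)"
          unfolding tS exp_add[symmetric] by (simp add: algebra_simps)
        have e3: "p * (yv - yu + \<mu> * J) - (p * q * yv - p * yu)
            = p * (- ((q - 1 - \<mu> * \<delta>) * yv) - \<mu> * (\<delta> * yv - J))" for p q yv yu
          by (simp add: algebra_simps)
        show ?thesis unfolding R_def I e1 e2 J_def[symmetric] by (rule e3)
      qed
      have 1: "\<bar>(exp (\<mu> * \<delta>) - 1 - \<mu> * \<delta>) * y ?v\<bar> \<le> ((\<mu> * \<delta>)\<^sup>2 * exp (\<mu> * L)) * K"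
        unfolding abs_mult
      proof (rule mult_mono)
        have "\<bar>exp (\<mu> * \<delta>) - 1 - \<mu> * \<delta>\<bar> \<le> (\<mu> * \<delta>)\<^sup>2 * exp \<bar>\<mu> * \<delta>\<bar>" by (rule exp_second_order_bound)
        also have "\<dots> \<le> (\<mu> * \<delta>)\<^sup>2 * exp (\<mu> * L)" using \<mu> \<delta> by (intro mult_left_mono) auto
        finally show "\<bar>exp (\<mu> * \<delta>) - 1 - \<mu> * \<delta>\<bar> \<le> (\<mu> * \<delta>)\<^sup>2 * exp (\<mu> * L)" .
      qed (use K uv in auto)
      have 2: "\<bar>\<mu> * integral {?u..?v} (\<lambda>s. y ?v - y s)\<bar> \<le> \<mu> * (e * \<delta>)"
        using Ib \<mu> tS[of j] by (simp add: abs_mult)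
      have 3: "\<bar>- A - B'\<bar> \<le> p + q" if "\<bar>A\<bar> \<le> p" "\<bar>B'\<bar> \<le> q" for A B' p q :: real using that by linarith
      have 4: "exp (\<mu> * ?u) \<le> exp (\<mu> * b)" using \<mu> uv by simp
      have "\<bar>R j\<bar> = exp (\<mu> * ?u) * \<bar>- ((exp (\<mu> * \<delta>) - 1 - \<mu> * \<delta>) * y ?v) - \<mu> * integral {?u..?v} (\<lambda>s. y ?v - y s)\<bar>"
        unfolding Rj abs_mult by simp
      also have "\<dots> \<le> exp (\<mu> * b) * (((\<mu> * \<delta>)\<^sup>2 * exp (\<mu> * L)) * K + \<mu> * (e * \<delta>))"
        using 3[OF 1 2] 4 by (intro mult_mono) auto
      finally show ?thesis by (simp add: power_mult_distrib mult_ac)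
    qed
    have "(\<Sum>j<n. exp (\<mu> * t j) * (\<beta> (t (Suc j)) - \<beta> (t j))) = (\<Sum>j<n. R j) + (\<Sum>j<n. exp (\<mu> * t (Suc j)) * y (t (Suc j)) - exp (\<mu> * t j) * y (t j))"
      by (simp add: R_def sum.distrib[symmetric])
    also have "(\<Sum>j<n. exp (\<mu> * t (Suc j)) * y (t (Suc j)) - exp (\<mu> * t j) * y (t j)) = exp (\<mu> * b) * y b - exp (\<mu> * a) * y a"
      by (subst sum_lessThan_telescope) (simp add: t0)
    finally have "(\<Sum>j<n. exp (\<mu> * t j) * (\<beta> (t (Suc j)) - \<beta> (t j))) - (exp (\<mu> * b) * y b - exp (\<mu> * a) * y a) = (\<Sum>j<n. R j)"
      by simp
    moreover have "\<bar>\<Sum>j<n. R j\<bar> \<le> (\<Sum>j<n. exp (\<mu> * b) * (\<mu>\<^sup>2 * \<delta>\<^sup>2 * exp (\<mu> * L) * K + \<mu> * \<delta> * e))"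
      using R by (intro order.trans[OF sum_abs] sum_mono) auto
    moreover have "(\<Sum>j<n. exp (\<mu> * b) * (\<mu>\<^sup>2 * \<delta>\<^sup>2 * exp (\<mu> * L) * K + \<mu> * \<delta> * e)) = C1 / n + C2 * e"
      using n by (simp add: C1_def C2_def \<delta>_def power_divide field_simps) (simp add: power2_eq_square)
    ultimately show ?thesis unfolding t_def \<delta>_def by simp
  qed
  have "(\<lambda>n. \<Sum>j<n. exp (\<mu> * (a + real j * (L / real n))) *
             (\<beta> (a + real (Suc j) * (L / real n)) - \<beta> (a + real j * (L / real n))))
         \<longlonglongrightarrow> exp (\<mu> * b) * y b - exp (\<mu> * a) * y a"
  proof (rule LIMSEQ_I)
    fix e :: real assume e: "e > 0"
    define e' where "e' = e / (2 * (C2 + 1))"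
    have e': "e' > 0" "C2 * e' < e / 2"
      using e C by (auto simp: e'_def field_simps)
    obtain d where d: "d > 0" "\<And>u v. u \<in> {a..b} \<Longrightarrow> v \<in> {a..b} \<Longrightarrow> \<bar>v - u\<bar> < d \<Longrightarrow> \<bar>y v - y u\<bar> < e'"
      using unif[OF e'(1)] by blast
    have lim: "(\<lambda>n. c / real n) \<longlonglongrightarrow> 0" for c :: real
      by (rule lim_const_over_n)
    have "\<forall>\<^sub>F n in sequentially. L / real n < d" using order_tendstoD(2)[OF lim[of L] d(1)] .
    moreover have "\<forall>\<^sub>F n in sequentially. C1 / real n < e / 2"
      using order_tendstoD(2)[OF lim[of C1], of "e/2"] e by simp
    moreover have "\<forall>\<^sub>F n in sequentially. n > (0::nat)" by (rule eventually_gt_at_top)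
    ultimately have "\<forall>\<^sub>F n in sequentially. norm ((\<Sum>j<n. exp (\<mu> * (a + real j * (L / real n))) *
             (\<beta> (a + real (Suc j) * (L / real n)) - \<beta> (a + real j * (L / real n)))) - (exp (\<mu> * b) * y b - exp (\<mu> * a) * y a)) < e"
    proof eventually_elim
      case (elim n)
      show ?case using bound[of n d e', OF elim(3) d(2) elim(1)] elim(2) e'(2) unfolding real_norm_def by linarith
    qed
    then show "\<exists>no. \<forall>n\<ge>no. norm ((\<Sum>j<n. exp (\<mu> * (a + real j * (L / real n))) *
             (\<beta> (a + real (Suc j) * (L / real n)) - \<beta> (a + real j * (L / real n)))) - (exp (\<mu> * b) * y b - exp (\<mu> * a) * y a)) < e"
      by (simp add: eventually_sequentially)
  qed
  then show ?thesis by (simp add: L_def)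
qed

text \<open>The constant path 1 / \<mu> is driven by \<beta> t = t, so the deterministic sum is an
  instance of the previous lemma.\<close>

lemma exp_riemann_sum:
  assumes ab: "a < b" and \<mu>: "\<mu> > (0::real)"
  shows "(\<lambda>n. \<Sum>j<n. exp (\<mu> * (a + real j * ((b - a) / real n))) * ((b - a) / real n))
         \<longlonglongrightarrow> (exp (\<mu> * b) - exp (\<mu> * a)) / \<mu>"
  using ou_riemann_sum[of a b "\<lambda>_. 1 / \<mu>" \<mu> "\<lambda>t. t"] assms
  by (simp add: algebra_simps diff_divide_distrib add_divide_distrib)

section \<open>Sigma-algebras generated by Brownian values\<close>

definition gen_filtration :: "'a measure \<Rightarrow> (real \<Rightarrow> 'a \<Rightarrow> real) \<Rightarrow> real set \<Rightarrow> 'a measure" where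
  "gen_filtration M B U = sigma (space M) (\<Union>u\<in>U. {B u -` A \<inter> space M | A. A \<in> sets borel})"

lemma nat_filtration_eq_gen: "nat_filtration M B t = gen_filtration M B {0..t}"
  by (simp add: nat_filtration_def gen_filtration_def)

lemma space_gen_filtration [simp]: "space (gen_filtration M B U) = space M"
  unfolding gen_filtration_def by (rule space_measure_of) auto

lemma sets_gen_filtration:
  "sets (gen_filtration M B U) = sigma_sets (space M) (\<Union>u\<in>U. {B u -` A \<inter> space M | A. A \<in> sets borel})"
  unfolding gen_filtration_def by (rule sets_measure_of) auto

lemma measurable_gen_filtration: "u \<in> U \<Longrightarrow> B u \<in> borel_measurable (gen_filtration M B U)"
  by (intro measurableI) (auto simp: sets_gen_filtration)

lemma sets_gen_filtration_le:
  assumes "\<And>u. u \<in> U \<Longrightarrow> B u \<in> borel_measurable N" "space N = space M"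
  shows "sets (gen_filtration M B U) \<subseteq> sets N"
  unfolding sets_gen_filtration assms(2)[symmetric]
  using assms(1) by (intro sets.sigma_sets_subset) (auto simp: assms(2)[symmetric] intro: measurable_sets)

lemma sets_gen_filtration_mono: "U \<subseteq> U' \<Longrightarrow> sets (gen_filtration M B U) \<subseteq> sets (gen_filtration M B U')"
  by (intro sets_gen_filtration_le measurable_gen_filtration) auto


lemma measurable_gen_filtration_cong:
  "f \<in> measurable (gen_filtration M B U) N \<Longrightarrow> sets (gen_filtration M B U) \<subseteq> sets M' \<Longrightarrow> space M' = space M \<Longrightarrow> f \<in> measurable M' N"
  by (auto simp: measurable_def)

section \<open>Independence of the past from weighted sums of future increments\<close>

locale brownian =
  fixes M :: "'a measure" and B :: "real \<Rightarrow> 'a \<Rightarrow> real"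
  assumes BM: "standard_BM M B"
begin

sublocale prob_space M using BM unfolding standard_BM_def by blast

lemma B_measurable: "t \<ge> 0 \<Longrightarrow> B t \<in> borel_measurable M"
  and B_zero: "\<omega> \<in> space M \<Longrightarrow> B 0 \<omega> = 0"
  and B_continuous: "\<omega> \<in> space M \<Longrightarrow> continuous_on {0..} (\<lambda>t. B t \<omega>)"
  and B_increment: "0 \<le> s \<Longrightarrow> s < t \<Longrightarrow> distributed M lborel (\<lambda>\<omega>. B t \<omega> - B s \<omega>)
          (\<lambda>y. ennreal (normal_density 0 (sqrt (t - s)) y))"
  and B_indep: "0 \<le> ts (0::nat) \<Longrightarrow> (\<And>i. ts i < ts (Suc i)) \<Longrightarrow>
        indep_vars (\<lambda>_. borel) (\<lambda>i \<omega>. B (ts (Suc i)) \<omega> - B (ts i) \<omega>) UNIV"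
  using BM unfolding standard_BM_def by blast+

lemma sets_filtration_subset: "U \<subseteq> {0..} \<Longrightarrow> sets (gen_filtration M B U) \<subseteq> sets M"
  by (intro sets_gen_filtration_le B_measurable) auto

text \<open>\<open>B_indep\<close> speaks of the increments along one increasing sequence of times,
  so past and future are put on a common uniform grid. The past is a function of the first
  \<open>n0\<close> increments, \<open>Z\<close> of the next \<open>n\<close>, and a weighted sum of
  independent centred normals is normal. The test function is complex because it will be a
  character.\<close>

lemma integral_past_future_grid:
  fixes c :: "real \<Rightarrow> real" and f :: "real \<Rightarrow> complex"
  assumes \<delta>: "\<delta> > 0" and A: "A \<in> sets (gen_filtration M B ((\<lambda>j. real j * \<delta>) ` {..n0}))"
    and c: "\<And>t. c t > 0" and n: "n > 0" and f: "f \<in> borel_measurable borel" "\<And>x. norm (f x) \<le> K"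
  defines "Z \<equiv> \<lambda>\<omega>. \<Sum>j<n. c (real (n0 + j) * \<delta>) * (B (real (n0 + Suc j) * \<delta>) \<omega> - B (real (n0 + j) * \<delta>) \<omega>)"
  shows "(\<integral>\<omega>. indicator A \<omega> *\<^sub>R f (Z \<omega>) \<partial>M)
     = prob A *\<^sub>R (\<integral>w. f (sqrt (\<Sum>j<n. (c (real (n0 + j) * \<delta>))\<^sup>2 * \<delta>) * w) \<partial>std_normal_distribution)"
proof -
  define ts where "ts j = real j * \<delta>" for j
  define \<xi> where "\<xi> j \<omega> = B (ts (Suc j)) \<omega> - B (ts j) \<omega>" for j \<omega>
  have ts: "ts j \<ge> 0" "ts j < ts (Suc j)" "ts (Suc j) - ts j = \<delta>" for j
    using \<delta> by (auto simp: ts_def algebra_simps)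
  have ind: "indep_vars (\<lambda>_. borel) \<xi> UNIV"
    unfolding \<xi>_def using ts by (intro B_indep) auto
  have xi_meas[measurable]: "\<xi> j \<in> borel_measurable M" for j
    unfolding \<xi>_def using ts B_measurable by (intro borel_measurable_diff) auto
  let ?I = "{..<n0}" and ?J = "{n0..<n0 + n}"
  define V1 where "V1 \<omega> = restrict (\<lambda>j. \<xi> j \<omega>) ?I" for \<omega>
  define V2 where "V2 \<omega> = restrict (\<lambda>j. \<xi> j \<omega>) ?J" for \<omega>
  have iv: "indep_var (PiM ?I (\<lambda>_. borel)) V1 (PiM ?J (\<lambda>_. borel)) V2"
    unfolding V1_def V2_def by (rule indep_var_restrict[OF ind]) auto
  \<comment> \<open>The sigma-algebra of the first \<open>n0\<close> increments. It contains the
    grid past because \<open>B\<close> starts at 0 and is the telescoping sum of its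
    increments.\<close>
  define G where "G = vimage_algebra (space M) V1 (PiM ?I (\<lambda>_. borel))"
  have spG: "space G = space M" by (simp add: G_def)
  have V1G: "V1 \<in> measurable G (PiM ?I (\<lambda>_. borel))"
    unfolding G_def by (rule measurable_vimage_algebra1) (auto simp: V1_def space_PiM)
  have "sets (gen_filtration M B ((\<lambda>j. real j * \<delta>) ` {..n0})) \<subseteq> sets G"
  proof (rule sets_gen_filtration_le[OF _ spG])
    fix u assume "u \<in> (\<lambda>j. real j * \<delta>) ` {..n0}"
    then obtain j where j: "j \<le> n0" "u = ts j" by (auto simp: ts_def)
    have "(\<lambda>\<omega>. \<Sum>i<j. V1 \<omega> i) \<in> borel_measurable G"
      using j(1) by (intro borel_measurable_sum measurable_compose[OF V1G] measurable_component_singleton) auto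
    moreover have "(\<Sum>i<j. V1 \<omega> i) = B u \<omega>" if "\<omega> \<in> space G" for \<omega>
    proof -
      have "(\<Sum>i<j. V1 \<omega> i) = (\<Sum>i<j. \<xi> i \<omega>)" using j by (intro sum.cong) (auto simp: V1_def)
      also have "\<dots> = B (ts j) \<omega> - B (ts 0) \<omega>" unfolding \<xi>_def by (rule sum_lessThan_telescope)
      finally show ?thesis using that B_zero spG by (simp add: j ts_def)
    qed
    ultimately show "B u \<in> borel_measurable G" by (subst measurable_cong[of _ _ "\<lambda>\<omega>. \<Sum>i<j. V1 \<omega> i"]) auto
  qed
  with A have "A \<in> sets G" by auto
  then obtain C where C: "C \<in> sets (PiM ?I (\<lambda>_. borel :: real measure))" "A = V1 -` C \<inter> space M"
    unfolding G_def by (auto simp: sets_vimage_algebra2[of V1 "space M" "PiM ?I (\<lambda>_. borel)"] V1_def space_PiM)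
  define g where "g x = (\<Sum>j\<in>?J. c (ts j) * x j)" for x :: "nat \<Rightarrow> real"
  have g[measurable]: "g \<in> borel_measurable (PiM ?J (\<lambda>_. borel))"
    unfolding g_def by measurable
  have ZV: "Z \<omega> = g (V2 \<omega>)" for \<omega>
    unfolding Z_def g_def V2_def
    by (rule sum.reindex_bij_witness[of _ "\<lambda>j. j - n0" "\<lambda>j. n0 + j"]) (auto simp: \<xi>_def ts_def)
  have Zm[measurable]: "Z \<in> borel_measurable M"
  proof -
    have "V2 \<in> measurable M (PiM ?J (\<lambda>_. borel))" unfolding V2_def by measurable
    then show ?thesis unfolding ZV[abs_def] by measurable
  qed
  have fm[measurable]: "f \<in> borel_measurable borel" by fact
  have Am[measurable]: "A \<in> sets M"
  proof -
    have "(\<lambda>j. real j * \<delta>) ` {..n0} \<subseteq> {0..}" using \<delta> by auto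
    from sets_filtration_subset[OF this] A show ?thesis by blast
  qed
  have "indep_var borel ((\<lambda>x. complex_of_real (indicator C x)) \<circ> V1) borel ((\<lambda>x. f (g x)) \<circ> V2)"
    by (rule indep_var_compose[OF iv]) (use C in measurable)
  then have iv': "indep_var borel (\<lambda>\<omega>. complex_of_real (indicator C (V1 \<omega>))) borel (\<lambda>\<omega>. f (Z \<omega>))"
    by (simp add: comp_def ZV)
  have indA: "complex_of_real (indicator A \<omega>) = complex_of_real (indicator C (V1 \<omega>))" if "\<omega> \<in> space M" for \<omega>
    using that by (auto simp: C(2) indicator_def)
  have i2: "integrable M (\<lambda>\<omega>. f (Z \<omega>))"
    by (rule integrable_const_bound[where B=K]) (auto simp: f(2))
  have i1: "integrable M (\<lambda>\<omega>. complex_of_real (indicator C (V1 \<omega>)))"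
  proof -
    have "integrable M (\<lambda>\<omega>. complex_of_real (indicator A \<omega>))"
      by (intro integrable_of_real) (simp add: emeasure_eq_measure)
    then show ?thesis
      by (subst Bochner_Integration.integrable_cong[OF refl, of _ _ "\<lambda>\<omega>. complex_of_real (indicator A \<omega>)"])
         (simp_all add: indA)
  qed
  have "(\<integral>\<omega>. indicator A \<omega> *\<^sub>R f (Z \<omega>) \<partial>M) = (\<integral>\<omega>. complex_of_real (indicator C (V1 \<omega>)) * f (Z \<omega>) \<partial>M)"
    by (intro Bochner_Integration.integral_cong refl) (simp add: indA[symmetric] scaleR_conv_of_real)
  also have "\<dots> = (\<integral>\<omega>. complex_of_real (indicator C (V1 \<omega>)) \<partial>M) * (\<integral>\<omega>. f (Z \<omega>) \<partial>M)"
    by (rule indep_var_lebesgue_integral[OF iv' i1 i2])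
  also have "(\<integral>\<omega>. complex_of_real (indicator C (V1 \<omega>)) \<partial>M) = (\<integral>\<omega>. complex_of_real (indicator A \<omega>) \<partial>M)"
    by (intro Bochner_Integration.integral_cong refl) (simp add: indA)
  also have "\<dots> = complex_of_real (prob A)" by simp
  also have "(\<integral>\<omega>. f (Z \<omega>) \<partial>M) = (\<integral>w. f (sqrt (\<Sum>j<n. (c (real (n0 + j) * \<delta>))\<^sup>2 * \<delta>) * w) \<partial>std_normal_distribution)"
  proof -
    define s where "s = sqrt (\<Sum>j<n. (c (real (n0 + j) * \<delta>))\<^sup>2 * \<delta>)"
    have s: "s > 0"
      unfolding s_def using n \<delta> c by (auto intro!: sum_pos simp: less_imp_neq[symmetric])
    have "distributed M lborel (\<lambda>\<omega>. \<Sum>j\<in>?J. c (ts j) * \<xi> j \<omega>)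
       (normal_density (\<Sum>j\<in>?J. 0) (sqrt (\<Sum>j\<in>?J. (c (ts j) * sqrt \<delta>)\<^sup>2)))"
    proof (rule sum_indep_normal)
      show "indep_vars (\<lambda>_. borel) (\<lambda>j \<omega>. c (ts j) * \<xi> j \<omega>) ?J"
        by (rule indep_vars_compose2[OF indep_vars_subset[OF ind]]) auto
      fix j
      show "distributed M lborel (\<lambda>\<omega>. c (ts j) * \<xi> j \<omega>) (normal_density 0 (c (ts j) * sqrt \<delta>))"
        using normal_density_affine[OF B_increment[OF ts(1) ts(2)], of j "c (ts j)" 0] \<delta> ts c[of "ts j"]
        by (simp add: \<xi>_def abs_of_pos less_imp_neq[symmetric])
      show "0 < c (ts j) * sqrt \<delta>" using c \<delta> by simp
    qed (use n in auto)
    moreover have "(\<Sum>j\<in>?J. (c (ts j) * sqrt \<delta>)\<^sup>2) = (\<Sum>j<n. (c (real (n0 + j) * \<delta>))\<^sup>2 * \<delta>)"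
      by (rule sum.reindex_bij_witness[of _ "\<lambda>j. n0 + j" "\<lambda>j. j - n0"]) (use \<delta> in \<open>auto simp: ts_def power_mult_distrib\<close>)
    moreover have "(\<Sum>j\<in>?J. c (ts j) * \<xi> j \<omega>) = Z \<omega>" for \<omega>
      unfolding ZV g_def V2_def by (intro sum.cong) auto
    ultimately have "distributed M lborel Z (normal_density 0 s)" by (simp add: s_def)
    then have "distributed M lborel (\<lambda>\<omega>. (Z \<omega> - 0) / s) std_normal_density"
      by (subst (asm) normal_standard_normal_convert[OF s]) simp
    then have D: "distr M lborel (\<lambda>\<omega>. Z \<omega> / s) = std_normal_distribution"
      by (simp add: distributed_distr_eq_density)
    have "(\<integral>w. f (s * w) \<partial>std_normal_distribution) = (\<integral>w. f (s * w) \<partial>distr M lborel (\<lambda>\<omega>. Z \<omega> / s))"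
      by (simp add: D)
    also have "\<dots> = (\<integral>\<omega>. f (s * (Z \<omega> / s)) \<partial>M)"
      by (rule integral_distr) measurable
    finally show ?thesis using s unfolding s_def[symmetric] by simp
  qed
  finally show ?thesis by (simp add: scaleR_conv_of_real)
qed

end

text \<open>The conditional law of \<open>Z\<close> given the event \<open>A\<close>, in the form
  that the uniqueness theorem for characteristic functions requires.\<close>

lemma (in prob_space) real_distribution_uniform_distr:
  assumes A: "A \<in> events" "prob A > 0" and Z: "Z \<in> borel_measurable M"
  shows "real_distribution (distr (uniform_measure M A) borel Z)"
    and "C \<in> sets borel \<Longrightarrow> measure (distr (uniform_measure M A) borel Z) C = prob (A \<inter> (Z -` C \<inter> space M)) / prob A"
    and "(\<And>x. norm (f x :: complex) \<le> K) \<Longrightarrow> f \<in> borel_measurable borel \<Longrightarrow>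
       (\<integral>x. f x \<partial>distr (uniform_measure M A) borel Z) = (1 / prob A) *\<^sub>R (\<integral>\<omega>. indicator A \<omega> *\<^sub>R f (Z \<omega>) \<partial>M)"
proof -
  have em: "emeasure M A \<noteq> 0" "emeasure M A \<noteq> \<infinity>" using A by (auto simp: emeasure_eq_measure)
  interpret U: prob_space "uniform_measure M A" by (rule prob_space_uniform_measure[OF em])
  note [measurable] = A(1) Z
  have Zm: "Z \<in> borel_measurable (uniform_measure M A)" by simp
  show "real_distribution (distr (uniform_measure M A) borel Z)"
    by (simp add: real_distribution_def real_distribution_axioms_def U.prob_space_distr)
  show "measure (distr (uniform_measure M A) borel Z) C = prob (A \<inter> (Z -` C \<inter> space M)) / prob A" if "C \<in> sets borel"
  proof -
    have "measure (distr (uniform_measure M A) borel Z) C = measure (uniform_measure M A) (Z -` C \<inter> space M)"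
      using that by (subst measure_distr) auto
    also have "\<dots> = prob (A \<inter> (Z -` C \<inter> space M)) / prob A"
      using that A em by (subst measure_uniform_measure) (auto simp: Int_assoc measurable_sets[OF Z])
    finally show ?thesis .
  qed
  assume f: "\<And>x. norm (f x) \<le> K" "f \<in> borel_measurable borel"
  note [measurable] = f(2)
  have d: "uniform_measure M A = density M (\<lambda>\<omega>. ennreal (indicator A \<omega> / prob A))"
    unfolding uniform_measure_def using A
    by (intro arg_cong2[where f=density] refl ext) (auto simp: emeasure_eq_measure ennreal_indicator[symmetric] divide_ennreal)
  have "(\<integral>x. f x \<partial>distr (uniform_measure M A) borel Z) = (\<integral>\<omega>. f (Z \<omega>) \<partial>uniform_measure M A)"
    by (rule integral_distr) auto
  also have "\<dots> = (\<integral>\<omega>. (indicator A \<omega> / prob A) *\<^sub>R f (Z \<omega>) \<partial>M)"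
    unfolding d by (subst integral_density) auto
  also have "\<dots> = (\<integral>\<omega>. (1 / prob A) *\<^sub>R (indicator A \<omega> *\<^sub>R f (Z \<omega>)) \<partial>M)"
    by (intro Bochner_Integration.integral_cong refl) simp
  also have "\<dots> = (1 / prob A) *\<^sub>R (\<integral>\<omega>. indicator A \<omega> *\<^sub>R f (Z \<omega>) \<partial>M)"
    by (rule integral_scaleR_right)
  finally show "(\<integral>x. f x \<partial>distr (uniform_measure M A) borel Z) = (1 / prob A) *\<^sub>R (\<integral>\<omega>. indicator A \<omega> *\<^sub>R f (Z \<omega>) \<partial>M)" .
qed

definition dyadic :: "nat \<Rightarrow> nat \<Rightarrow> real" where "dyadic k i = real i / 2 ^ k"

lemma dyadic_refine: "dyadic k i = dyadic (k + l) (i * 2 ^ l)"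
  by (simp add: dyadic_def power_add)

text \<open>Rounding down keeps the approximating times at or before \<open>u\<close>, so that they
  remain in the past when grid values are to generate the filtration.\<close>

lemma dyadic_floor_tendsto:
  assumes "u \<ge> 0"
  shows "(\<lambda>l. dyadic (k + l) (nat \<lfloor>u * 2 ^ (k + l)\<rfloor>)) \<longlonglongrightarrow> u"
proof (rule tendsto_sandwich)
  have e: "real (nat \<lfloor>u * 2 ^ n\<rfloor>) = of_int \<lfloor>u * 2 ^ n\<rfloor>" for n using assms by simp
  show "\<forall>\<^sub>F l in sequentially. u - 1 / 2 ^ (k + l) \<le> dyadic (k + l) (nat \<lfloor>u * 2 ^ (k + l)\<rfloor>)"
  proof (intro always_eventually allI)
    fix l
    have "(u - 1 / 2 ^ (k + l)) * 2 ^ (k + l) \<le> of_int \<lfloor>u * 2 ^ (k + l)\<rfloor>"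
      by (simp add: left_diff_distrib)
    then show "u - 1 / 2 ^ (k + l) \<le> dyadic (k + l) (nat \<lfloor>u * 2 ^ (k + l)\<rfloor>)"
      unfolding dyadic_def e by (simp add: le_divide_eq)
  qed
  show "\<forall>\<^sub>F l in sequentially. dyadic (k + l) (nat \<lfloor>u * 2 ^ (k + l)\<rfloor>) \<le> u"
    unfolding dyadic_def e by (intro always_eventually allI) (simp add: divide_le_eq)
  have "(\<lambda>l. (1 / 2 ^ k) * (1 / 2) ^ l :: real) \<longlonglongrightarrow> (1 / 2 ^ k) * 0"
    by (intro tendsto_mult tendsto_const LIMSEQ_power_zero) simp
  then have "(\<lambda>l. 1 / 2 ^ (k + l) :: real) \<longlonglongrightarrow> 0"
    by (simp add: power_add power_one_over)
  then show "(\<lambda>l. u - 1 / 2 ^ (k + l)) \<longlonglongrightarrow> u"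
    using tendsto_diff[OF tendsto_const, of _ 0 sequentially u] by simp
qed (rule tendsto_const)

context brownian
begin

text \<open>Conditionally on an event of the past, the law of \<open>Zl l\<close> is an explicit Gaussian for all
  large \<open>l\<close>, so characteristic functions determine the conditional law of the limit \<open>Z\<close>.\<close>

lemma past_future_independent:
  fixes c :: "real \<Rightarrow> real" and Z :: "'a \<Rightarrow> real" and s :: real and k i :: nat
  defines "Zl \<equiv> \<lambda>l \<omega>. \<Sum>j<2 ^ l. c (dyadic (k + l) (i * 2 ^ l + j)) *
     (B (dyadic (k + l) (i * 2 ^ l + Suc j)) \<omega> - B (dyadic (k + l) (i * 2 ^ l + j)) \<omega>)"
  assumes c: "\<And>t. c t > 0"
    and lim: "\<And>\<omega>. \<omega> \<in> space M \<Longrightarrow> (\<lambda>l. Zl l \<omega>) \<longlonglongrightarrow> Z \<omega>"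
    and var: "(\<lambda>l. \<Sum>j<2 ^ l. (c (dyadic (k + l) (i * 2 ^ l + j)))\<^sup>2 / 2 ^ (k + l)) \<longlonglongrightarrow> s\<^sup>2" and s: "s \<ge> 0"
    and A: "A \<in> sets (nat_filtration M B (dyadic k i))" and D: "D \<in> sets borel"
  shows "Z \<in> borel_measurable M"
    and "prob (A \<inter> (Z -` D \<inter> space M)) = prob A * measure (distr std_normal_distribution borel (\<lambda>w. s * w)) D"
proof -
  have dy: "dyadic n j \<ge> 0" for n j by (simp add: dyadic_def)
  have Zlm[measurable]: "Zl l \<in> borel_measurable M" for l
    unfolding Zl_def using dy by (intro borel_measurable_sum borel_measurable_times borel_measurable_diff B_measurable) auto
  show Zm[measurable]: "Z \<in> borel_measurable M"
    by (rule borel_measurable_LIMSEQ_metric[OF Zlm lim])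
  interpret N: prob_space std_normal_distribution by (rule prob_space_normal_density) simp
  let ?N = "distr std_normal_distribution borel (\<lambda>w. s * w)"
  interpret NS: real_distribution ?N
    by (simp add: real_distribution_def real_distribution_axioms_def N.prob_space_distr)
  \<comment> \<open>The past as seen on the grid of level \<open>k + l\<close>. These algebras
    increase with \<open>l\<close>, so an event of one of them precedes all later sums
    \<open>Zl\<close>.\<close>
  define G where "G l = gen_filtration M B (dyadic (k + l) ` {..i * 2 ^ l})" for l
  have Gmono: "sets (G l) \<subseteq> sets (G l')" if "l \<le> l'" for l l'
    unfolding G_def
  proof (rule sets_gen_filtration_mono, rule image_subsetI)
    fix j assume "j \<in> {..i * 2 ^ l}"
    moreover have "dyadic (k + l) j = dyadic (k + l') (j * 2 ^ (l' - l))"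
      using dyadic_refine[of "k + l" j "l' - l"] that by simp
    moreover have "i * 2 ^ l * 2 ^ (l' - l) = i * 2 ^ l'" using that by (simp add: mult.assoc power_add[symmetric])
    ultimately show "dyadic (k + l) j \<in> dyadic (k + l') ` {..i * 2 ^ l'}"
      by (intro image_eqI[of _ _ "j * 2 ^ (l' - l)"]) (auto simp flip: \<open>i * 2 ^ l * 2 ^ (l' - l) = i * 2 ^ l'\<close>)
  qed
  have dyU: "dyadic n ` U \<subseteq> {0..}" for n U using dy by auto
  have GM: "sets (G l) \<subseteq> events" for l
    unfolding G_def by (rule sets_filtration_subset[OF dyU])
  define sl where "sl l = sqrt (\<Sum>j<2 ^ l. (c (dyadic (k + l) (i * 2 ^ l + j)))\<^sup>2 * (1 / 2 ^ (k + l)))" for l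
  have sl: "sl \<longlonglongrightarrow> s"
    unfolding sl_def using tendsto_real_sqrt[OF var] s by simp
  have conv: "(\<integral>\<omega>. indicator A \<omega> *\<^sub>R f (Z \<omega>) \<partial>M) = prob A *\<^sub>R (\<integral>w. f (s * w) \<partial>std_normal_distribution)"
    if A: "A \<in> sets (G l0)" and f: "continuous_on UNIV f" "\<And>x. norm (f x) \<le> K" for A l0 and f :: "real \<Rightarrow> complex" and K
  proof (rule LIMSEQ_unique)
    have [measurable]: "A \<in> events" using A GM by auto
    have fm[measurable]: "f \<in> borel_measurable borel" using f(1) by (rule borel_measurable_continuous_onI)
    have fc: "isCont f x" for x using f(1) by (simp add: continuous_on_eq_continuous_at)
    show "(\<lambda>l. \<integral>\<omega>. indicator A \<omega> *\<^sub>R f (Zl l \<omega>) \<partial>M) \<longlonglongrightarrow> (\<integral>\<omega>. indicator A \<omega> *\<^sub>R f (Z \<omega>) \<partial>M)"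
    proof (rule integral_dominated_convergence[where w="\<lambda>_. K"])
      show "AE \<omega> in M. (\<lambda>l. indicator A \<omega> *\<^sub>R f (Zl l \<omega>)) \<longlonglongrightarrow> indicator A \<omega> *\<^sub>R f (Z \<omega>)"
        using lim by (intro AE_I2 tendsto_scaleR tendsto_const isCont_tendsto_compose[OF fc])
      have "0 \<le> K" using f(2)[of 0] norm_ge_zero order.trans by blast
      then show "AE \<omega> in M. norm (indicator A \<omega> *\<^sub>R f (Zl l \<omega>)) \<le> K" for l
        using f(2) by (intro AE_I2) (auto simp: indicator_def)
    qed auto
    have "(\<lambda>l. prob A *\<^sub>R (\<integral>w. f (sl l * w) \<partial>std_normal_distribution)) \<longlonglongrightarrow> prob A *\<^sub>R (\<integral>w. f (s * w) \<partial>std_normal_distribution)"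
      by (intro tendsto_scaleR tendsto_const integral_dominated_convergence[where w="\<lambda>_. K"])
        (auto intro!: isCont_tendsto_compose[OF fc] tendsto_mult sl f(2))
    moreover have "\<forall>\<^sub>F l in sequentially. prob A *\<^sub>R (\<integral>w. f (sl l * w) \<partial>std_normal_distribution) = (\<integral>\<omega>. indicator A \<omega> *\<^sub>R f (Zl l \<omega>) \<partial>M)"
      using eventually_ge_at_top[of l0]
    proof eventually_elim
      case (elim l)
      have "A \<in> sets (G l)" using A Gmono[OF elim] by auto
      moreover have d: "dyadic n j = real j * (1 / 2 ^ n)" for n j by (simp add: dyadic_def)
      ultimately have "A \<in> sets (gen_filtration M B ((\<lambda>j. real j * (1 / 2 ^ (k + l))) ` {..i * 2 ^ l}))"
        unfolding G_def by (simp add: dyadic_def[abs_def])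
      from integral_past_future_grid[where c=c, OF _ this c _ fm f(2), of "2 ^ l"]
      show ?case unfolding Zl_def sl_def d by simp
    qed
    ultimately show "(\<lambda>l. \<integral>\<omega>. indicator A \<omega> *\<^sub>R f (Zl l \<omega>) \<partial>M) \<longlonglongrightarrow> prob A *\<^sub>R (\<integral>w. f (s * w) \<partial>std_normal_distribution)"
      by (rule Lim_transform_eventually)
  qed
  have base: "prob (A \<inter> (Z -` D \<inter> space M)) = prob A * measure ?N D" if A: "A \<in> sets (G l0)" for A l0
  proof (cases "prob A = 0")
    case True
    have [measurable]: "A \<in> events" using A GM by auto
    have "prob (A \<inter> (Z -` D \<inter> space M)) \<le> prob A" using D by (intro finite_measure_mono) auto
    with True show ?thesis by (simp add: measure_le_0_iff)
  next
    case False
    then have pA: "prob A > 0" by (simp add: zero_less_measure_iff)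
    have Ae: "A \<in> events" using A GM by auto
    note U = real_distribution_uniform_distr[OF Ae pA Zm]
    have "distr (uniform_measure M A) borel Z = ?N"
    proof (rule Levy_uniqueness[OF U(1)])
      show "real_distribution ?N" by unfold_locales
      show "char (distr (uniform_measure M A) borel Z) = char ?N"
      proof
        fix u
        have cont: "continuous_on UNIV (\<lambda>x. iexp (u * x))" by (intro continuous_intros)
        have "char (distr (uniform_measure M A) borel Z) u = (1 / prob A) *\<^sub>R (\<integral>\<omega>. indicator A \<omega> *\<^sub>R iexp (u * Z \<omega>) \<partial>M)"
          unfolding char_def by (rule U(3)[of _ 1]) auto
        also have "(\<integral>\<omega>. indicator A \<omega> *\<^sub>R iexp (u * Z \<omega>) \<partial>M) = prob A *\<^sub>R (\<integral>w. iexp (u * (s * w)) \<partial>std_normal_distribution)"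
          by (rule conv[OF A cont, of 1]) simp
        also have "(\<integral>w. iexp (u * (s * w)) \<partial>std_normal_distribution) = char ?N u"
          unfolding char_def by (subst integral_distr) auto
        finally show "char (distr (uniform_measure M A) borel Z) u = char ?N u" using pA by simp
      qed
    qed
    with U(2)[OF D] pA show ?thesis by (simp add: field_simps)
  qed
  let ?P = "\<Union>l. sets (G l)"
  have spG: "space (G l) = space M" for l by (simp add: G_def)
  have Pow: "?P \<subseteq> Pow (space M)" using sets.sets_into_space[of _ "G _"] spG by blast
  have "Int_stable ?P"
  proof (rule Int_stableI)
    fix a b assume "a \<in> ?P" "b \<in> ?P"
    then obtain l l' where "a \<in> sets (G l)" "b \<in> sets (G l')" by auto
    then have "a \<in> sets (G (max l l'))" "b \<in> sets (G (max l l'))"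
      using Gmono[of l "max l l'"] Gmono[of l' "max l l'"] by auto
    then show "a \<inter> b \<in> ?P" by blast
  qed
  define S where "S = sigma (space M) ?P"
  have spS: "space S = space M" and setsS: "sets S = sigma_sets (space M) ?P"
    using Pow by (auto simp: S_def)
  \<comment> \<open>Path continuity recovers \<open>B u\<close> from grid times not after
    \<open>u\<close>. Hence the grid algebras, an intersection stable family, generate the whole
    past and the identity extends by Dynkin's argument.\<close>
  have "sets (gen_filtration M B {0..dyadic k i}) \<subseteq> sets S"
  proof (rule sets_gen_filtration_le[OF _ spS])
    fix u assume u: "u \<in> {0..dyadic k i}"
    define d where "d l = dyadic (k + l) (nat \<lfloor>u * 2 ^ (k + l)\<rfloor>)" for l
    show "B u \<in> borel_measurable S"
    proof (rule borel_measurable_LIMSEQ_metric)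
      fix l
      have "u * 2 ^ (k + l) \<le> real (i * 2 ^ l)"
        using u by (simp add: dyadic_def power_add field_simps)
      then have "nat \<lfloor>u * 2 ^ (k + l)\<rfloor> \<le> i * 2 ^ l"
        by (simp add: nat_le_iff floor_le_iff)
      then have "B (d l) \<in> borel_measurable (G l)"
        unfolding d_def G_def by (intro measurable_gen_filtration) auto
      then show "B (d l) \<in> borel_measurable S"
        unfolding G_def by (rule measurable_gen_filtration_cong) (auto simp: spS setsS G_def[symmetric])
    next
      fix \<omega> assume "\<omega> \<in> space S"
      then have "continuous_on {0..} (\<lambda>t. B t \<omega>)" using B_continuous spS by simp
      moreover have "d \<longlonglongrightarrow> u" unfolding d_def using u by (intro dyadic_floor_tendsto) auto
      ultimately show "(\<lambda>l. B (d l) \<omega>) \<longlonglongrightarrow> B u \<omega>"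
        by (rule continuous_on_tendsto_compose) (use u dy in \<open>auto simp: d_def\<close>)
    qed
  qed
  with A have "A \<in> sigma_sets (space M) ?P" by (auto simp: nat_filtration_eq_gen setsS)
  then show "prob (A \<inter> (Z -` D \<inter> space M)) = prob A * measure ?N D"
  proof (rule sigma_sets_induct_disjoint[OF \<open>Int_stable ?P\<close> Pow])
    fix A assume "A \<in> ?P" then show "prob (A \<inter> (Z -` D \<inter> space M)) = prob A * measure ?N D" using base by auto
  next
    have subE: "sigma_sets (space M) ?P \<subseteq> events" using GM by (intro sets.sigma_sets_subset) auto
    have ZD[measurable]: "Z -` D \<inter> space M \<in> events" using D by measurable
    fix A assume A: "A \<in> sigma_sets (space M) ?P" "prob (A \<inter> (Z -` D \<inter> space M)) = prob A * measure ?N D"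
    then have [measurable]: "A \<in> events" using subE by auto
    have "space M \<in> sets (G 0)" using spG by (metis sets.top)
    then have 1: "prob (Z -` D \<inter> space M) = measure ?N D" using base[of "space M" 0] by (simp add: prob_space Int_absorb1)
    have "(space M - A) \<inter> (Z -` D \<inter> space M) = (Z -` D \<inter> space M) - A \<inter> (Z -` D \<inter> space M)" by auto
    moreover have "prob ((Z -` D \<inter> space M) - A \<inter> (Z -` D \<inter> space M)) = prob (Z -` D \<inter> space M) - prob (A \<inter> (Z -` D \<inter> space M))"
      by (rule finite_measure_Diff) auto
    ultimately show "prob ((space M - A) \<inter> (Z -` D \<inter> space M)) = prob (space M - A) * measure ?N D"
      using A(2) 1 by (simp add: prob_compl left_diff_distrib)
  next
    have subE: "sigma_sets (space M) ?P \<subseteq> events" using GM by (intro sets.sigma_sets_subset) auto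
    have ZD[measurable]: "Z -` D \<inter> space M \<in> events" using D by measurable
    fix A :: "nat \<Rightarrow> 'a set" assume A: "disjoint_family A" "range A \<subseteq> sigma_sets (space M) ?P"
      "\<And>i. prob (A i \<inter> (Z -` D \<inter> space M)) = prob (A i) * measure ?N D"
    have Ae: "A i \<in> events" for i using A(2) subE by auto
    have "(\<lambda>i. prob (A i \<inter> (Z -` D \<inter> space M))) sums prob (\<Union>i. A i \<inter> (Z -` D \<inter> space M))"
      using A(1) Ae ZD by (intro finite_measure_UNION) (auto simp: disjoint_family_on_def)
    moreover have "(\<lambda>i. prob (A i) * measure ?N D) sums (prob (\<Union>i. A i) * measure ?N D)"
      using A(1) Ae by (intro sums_mult2 finite_measure_UNION) auto
    ultimately have "prob (\<Union>i. A i \<inter> (Z -` D \<inter> space M)) = prob (\<Union>i. A i) * measure ?N D"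
      unfolding A(3) by (rule sums_unique2)
    then show "prob (\<Union> (range A) \<inter> (Z -` D \<inter> space M)) = prob (\<Union> (range A)) * measure ?N D"
      by (simp only: UN_extend_simps(4) image_image Int_UN_distrib2)
  qed simp
qed

end

section \<open>The Gaussian transition kernel and the Markov property\<close>

definition ou_transition :: "real \<Rightarrow> real \<Rightarrow> real \<Rightarrow> real \<Rightarrow> (real \<Rightarrow> ennreal) \<Rightarrow> real \<Rightarrow> ennreal" where
  "ou_transition \<mu> \<sigma> \<theta> h f x = (\<integral>\<^sup>+w. f (\<theta> + exp (- (\<mu> * h)) * (x - \<theta>) + \<sigma> * sqrt ((1 - exp (- (2 * \<mu> * h))) / (2 * \<mu>)) * w) \<partial>std_normal_distribution)"

locale ou_process = brownian M B for M :: "'a measure" and B +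
  fixes X :: "real \<Rightarrow> 'a \<Rightarrow> real" and \<mu> \<sigma> \<theta> x :: real
  assumes \<mu>: "\<mu> > 0" and \<sigma>: "\<sigma> > 0"
    and X_continuous: "\<omega> \<in> space M \<Longrightarrow> continuous_on {0..} (\<lambda>t. X t \<omega>)"
    and X_eq: "\<omega> \<in> space M \<Longrightarrow> t \<ge> 0 \<Longrightarrow>
         X t \<omega> = x + integral {0..t} (\<lambda>s. \<mu> * (\<theta> - X s \<omega>)) + \<sigma> * B t \<omega>"
begin

lemma X_zero: "\<omega> \<in> space M \<Longrightarrow> X 0 \<omega> = x"
  using X_eq[of \<omega> 0] B_zero by simp

text \<open>The integral equation in the form that \<open>ou_riemann_sum\<close> takes as
  hypothesis, for the path centred at \<theta> and the driver \<sigma> B.\<close>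

lemma X_increment:
  assumes \<omega>: "\<omega> \<in> space M" and uv: "0 \<le> u" "u \<le> v"
  shows "\<sigma> * B v \<omega> - \<sigma> * B u \<omega> = (X v \<omega> - \<theta>) - (X u \<omega> - \<theta>) + \<mu> * integral {u..v} (\<lambda>s. X s \<omega> - \<theta>)"
proof -
  let ?f = "\<lambda>s. \<mu> * (\<theta> - X s \<omega>)"
  have int: "?f integrable_on {0..v}"
    by (intro integrable_continuous_real continuous_intros continuous_on_subset[OF X_continuous[OF \<omega>]]) auto
  have "integral {0..u} ?f + integral {u..v} ?f = integral {0..v} ?f"
    by (rule Henstock_Kurzweil_Integration.integral_combine[OF uv int])
  moreover have "integral {u..v} ?f = - (\<mu> * integral {u..v} (\<lambda>s. X s \<omega> - \<theta>))"
  proof -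
    have "?f = (\<lambda>s. - \<mu> * (X s \<omega> - \<theta>))" by (auto simp: algebra_simps)
    then show ?thesis by (simp only: integral_mult_right)
  qed
  ultimately show ?thesis using X_eq[OF \<omega>, of u] X_eq[OF \<omega>, of v] uv by simp
qed

lemma X_riemann_sum:
  assumes \<omega>: "\<omega> \<in> space M" and ab: "0 \<le> a" "a < b"
  shows "(\<lambda>n. \<Sum>j<n. exp (\<mu> * (a + real j * ((b - a) / real n))) *
             (\<sigma> * B (a + real (Suc j) * ((b - a) / real n)) \<omega> - \<sigma> * B (a + real j * ((b - a) / real n)) \<omega>))
         \<longlonglongrightarrow> exp (\<mu> * b) * (X b \<omega> - \<theta>) - exp (\<mu> * a) * (X a \<omega> - \<theta>)"
  using ab
  by (intro ou_riemann_sum[where y="\<lambda>t. X t \<omega> - \<theta>" and \<beta>="\<lambda>t. \<sigma> * B t \<omega>"] \<mu> X_increment[OF \<omega>]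
      continuous_intros continuous_on_subset[OF X_continuous[OF \<omega>]]) auto

text \<open>The Riemann sums use values of \<open>B\<close> up to \<open>t\<close> only and converge
  on every path, so the limit is measurable for the natural filtration itself, without
  completion.\<close>

lemma X_adapted:
  assumes t: "t \<ge> 0"
  shows "X t \<in> borel_measurable (nat_filtration M B t)"
proof (cases "t = 0")
  case True
  have "(\<lambda>_. x) \<in> borel_measurable (nat_filtration M B t)" by simp
  then show ?thesis
    by (rule measurable_cong[THEN iffD1, rotated]) (auto simp: True X_zero nat_filtration_eq_gen)
next
  case False
  then have t: "t > 0" using t by simp
  define S where "S n \<omega> = (\<Sum>j<n. exp (\<mu> * (0 + real j * ((t - 0) / real n))) *
             (\<sigma> * B (0 + real (Suc j) * ((t - 0) / real n)) \<omega> - \<sigma> * B (0 + real j * ((t - 0) / real n)) \<omega>))" for n \<omega>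
  let ?Y = "\<lambda>\<omega>. exp (\<mu> * t) * (X t \<omega> - \<theta>) - exp (\<mu> * 0) * (X 0 \<omega> - \<theta>)"
  have "?Y \<in> borel_measurable (nat_filtration M B t)"
  proof (rule borel_measurable_LIMSEQ_metric[where f=S])
    fix n
    have *: "B (0 + real j * ((t - 0) / real n)) \<in> borel_measurable (nat_filtration M B t)" if "j \<le> n" "n > 0" for j
    proof -
      have "real j * t \<le> real n * t" using that t by (intro mult_right_mono) auto
      then show ?thesis unfolding nat_filtration_eq_gen using that t
        by (intro measurable_gen_filtration) (auto simp: divide_le_eq mult_ac)
    qed
    show "S n \<in> borel_measurable (nat_filtration M B t)"
      unfolding S_def by (intro borel_measurable_sum borel_measurable_times borel_measurable_diff * borel_measurable_const) auto
  next
    fix \<omega> assume "\<omega> \<in> space (nat_filtration M B t)"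
    then show "(\<lambda>n. S n \<omega>) \<longlonglongrightarrow> ?Y \<omega>"
      unfolding S_def using t by (intro X_riemann_sum) (auto simp: nat_filtration_eq_gen)
  qed
  then have "(\<lambda>\<omega>. \<theta> + exp (- (\<mu> * t)) * (?Y \<omega> + (x - \<theta>))) \<in> borel_measurable (nat_filtration M B t)" by measurable
  moreover have "\<theta> + exp (- (\<mu> * t)) * (?Y \<omega> + (x - \<theta>)) = X t \<omega>" if "\<omega> \<in> space M" for \<omega>
    using X_zero[OF that] by (simp add: exp_minus field_simps)
  ultimately show ?thesis
    by (subst measurable_cong[of _ _ "\<lambda>\<omega>. \<theta> + exp (- (\<mu> * t)) * (?Y \<omega> + (x - \<theta>))"]) (auto simp: nat_filtration_eq_gen)
qed

lemma nat_filtration_subset: "sets (nat_filtration M B t) \<subseteq> sets M"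
  unfolding nat_filtration_eq_gen by (rule sets_filtration_subset) auto

lemma space_nat_filtration [simp]: "space (nat_filtration M B t) = space M"
  by (simp add: nat_filtration_eq_gen)

lemma nat_filtration_mono: "s \<le> t \<Longrightarrow> sets (nat_filtration M B s) \<subseteq> sets (nat_filtration M B t)"
  unfolding nat_filtration_eq_gen by (rule sets_gen_filtration_mono) auto

lemma measurable_nat_filtration_mono: "f \<in> measurable (nat_filtration M B s) N \<Longrightarrow> s \<le> t \<Longrightarrow> f \<in> measurable (nat_filtration M B t) N"
  using nat_filtration_mono[of s t] by (auto simp: measurable_def)

lemma measurable_nat_filtration_M: "f \<in> measurable (nat_filtration M B s) N \<Longrightarrow> f \<in> measurable M N"
  using nat_filtration_subset[of s] by (auto simp: measurable_def)

lemma X_measurable: "t \<ge> 0 \<Longrightarrow> X t \<in> borel_measurable M"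
  using X_adapted measurable_nat_filtration_M by blast

text \<open>\<open>Z\<close> is \<sigma> times the Wiener integral of exp(- \<mu> (t' - s)) over the
  grid step that ends at t'. The weights \<open>c\<close> discretise this integrand, and
  \<open>exp_riemann_sum\<close> with 2 \<mu> for \<mu> computes the variance.\<close>

lemma X_noise_independent:
  fixes k i :: nat
  defines "h \<equiv> 1 / 2 ^ k"
  defines "Z \<equiv> \<lambda>\<omega>. X (dyadic k (Suc i)) \<omega> - \<theta> - exp (- (\<mu> * h)) * (X (dyadic k i) \<omega> - \<theta>)"
  assumes A: "A \<in> sets (nat_filtration M B (dyadic k i))" and D: "D \<in> sets borel"
  shows "prob (A \<inter> (Z -` D \<inter> space M)) = prob A * measure (distr std_normal_distribution borel
           (\<lambda>w. \<sigma> * sqrt ((1 - exp (- (2 * \<mu> * h))) / (2 * \<mu>)) * w)) D"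
proof -
  define a b where "a = dyadic k i" and "b = dyadic k (Suc i)"
  have ab: "0 \<le> a" "a < b" "b - a = h" "b = a + h" by (auto simp: a_def b_def h_def dyadic_def field_simps)
  define c where "c t = \<sigma> * exp (\<mu> * (t - b))" for t
  have grid: "a + real j * ((b - a) / real (2 ^ l)) = dyadic (k + l) (i * 2 ^ l + j)" for j l
    unfolding ab(3) by (simp add: a_def h_def dyadic_def power_add field_simps)
  have sub: "strict_mono (\<lambda>l. 2 ^ l :: nat)" by (rule strict_monoI) simp
  show ?thesis
  proof (rule past_future_independent(2)[OF _ _ _ _ A D, where c=c])
    show "c t > 0" for t using \<sigma> by (simp add: c_def)
    show "0 \<le> \<sigma> * sqrt ((1 - exp (- (2 * \<mu> * h))) / (2 * \<mu>))"
      using \<sigma> \<mu> by (simp add: h_def)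
  next
    fix \<omega> assume \<omega>: "\<omega> \<in> space M"
    have "(\<lambda>l. exp (- (\<mu> * b)) * (\<Sum>j<2 ^ l. exp (\<mu> * (a + real j * ((b - a) / real (2 ^ l)))) *
             (\<sigma> * B (a + real (Suc j) * ((b - a) / real (2 ^ l))) \<omega> - \<sigma> * B (a + real j * ((b - a) / real (2 ^ l))) \<omega>)))
         \<longlonglongrightarrow> exp (- (\<mu> * b)) * (exp (\<mu> * b) * (X b \<omega> - \<theta>) - exp (\<mu> * a) * (X a \<omega> - \<theta>))"
      using LIMSEQ_subseq_LIMSEQ[OF X_riemann_sum[OF \<omega> ab(1,2)] sub]
      by (intro tendsto_mult tendsto_const) (simp add: comp_def)
    also have "exp (- (\<mu> * b)) * (exp (\<mu> * b) * (X b \<omega> - \<theta>) - exp (\<mu> * a) * (X a \<omega> - \<theta>)) = Z \<omega>"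
    proof -
      have "exp (- (\<mu> * b)) * exp (\<mu> * b) = 1" "exp (- (\<mu> * b)) * exp (\<mu> * a) = exp (- (\<mu> * h))"
        by (simp_all add: exp_add[symmetric] ab(4) distrib_left)
      then show ?thesis
        unfolding Z_def a_def[symmetric] b_def[symmetric] by (simp add: right_diff_distrib mult.assoc[symmetric])
    qed
    finally have *: "(\<lambda>l. exp (- (\<mu> * b)) * (\<Sum>j<2 ^ l. exp (\<mu> * (a + real j * ((b - a) / real (2 ^ l)))) *
             (\<sigma> * B (a + real (Suc j) * ((b - a) / real (2 ^ l))) \<omega> - \<sigma> * B (a + real j * ((b - a) / real (2 ^ l))) \<omega>)))
         \<longlonglongrightarrow> Z \<omega>" .
    have pt: "exp (- (\<mu> * b)) * (exp (\<mu> * t) * (\<sigma> * p - \<sigma> * q)) = c t * (p - q)" for t p q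
    proof -
      have "exp (\<mu> * (t - b)) = exp (- (\<mu> * b)) * exp (\<mu> * t)"
        by (simp add: exp_add[symmetric] right_diff_distrib)
      then show ?thesis by (simp add: c_def right_diff_distrib)
    qed
    show "(\<lambda>l. \<Sum>j<2 ^ l. c (dyadic (k + l) (i * 2 ^ l + j)) * (B (dyadic (k + l) (i * 2 ^ l + Suc j)) \<omega> - B (dyadic (k + l) (i * 2 ^ l + j)) \<omega>))
       \<longlonglongrightarrow> Z \<omega>"
      using * unfolding sum_distrib_left pt grid .
  next
    have "2 * \<mu> > 0" using \<mu> by simp
    from LIMSEQ_subseq_LIMSEQ[OF exp_riemann_sum[OF ab(2) this] sub]
    have "(\<lambda>l. \<sigma>\<^sup>2 * exp (- (2 * \<mu> * b)) * (\<Sum>j<2 ^ l. exp (2 * \<mu> * (a + real j * ((b - a) / real (2 ^ l)))) * ((b - a) / real (2 ^ l))))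
       \<longlonglongrightarrow> \<sigma>\<^sup>2 * exp (- (2 * \<mu> * b)) * ((exp (2 * \<mu> * b) - exp (2 * \<mu> * a)) / (2 * \<mu>))"
      by (intro tendsto_mult tendsto_const) (simp add: comp_def)
    also have "\<sigma>\<^sup>2 * exp (- (2 * \<mu> * b)) * ((exp (2 * \<mu> * b) - exp (2 * \<mu> * a)) / (2 * \<mu>)) = (\<sigma> * sqrt ((1 - exp (- (2 * \<mu> * h))) / (2 * \<mu>)))\<^sup>2"
    proof -
      have "exp (- (2 * \<mu> * b)) * (exp (2 * \<mu> * b) - exp (2 * \<mu> * a)) = 1 - exp (- (2 * \<mu> * h))"
        by (simp add: right_diff_distrib exp_add[symmetric] ab(4) distrib_left)
      moreover have "(1 - exp (- (2 * \<mu> * h))) / (2 * \<mu>) \<ge> 0" using \<mu> by (simp add: h_def)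
      ultimately show ?thesis by (simp add: power_mult_distrib)
    qed
    finally have *: "(\<lambda>l. \<sigma>\<^sup>2 * exp (- (2 * \<mu> * b)) * (\<Sum>j<2 ^ l. exp (2 * \<mu> * (a + real j * ((b - a) / real (2 ^ l)))) * ((b - a) / real (2 ^ l))))
       \<longlonglongrightarrow> (\<sigma> * sqrt ((1 - exp (- (2 * \<mu> * h))) / (2 * \<mu>)))\<^sup>2" .
    have pt: "\<sigma>\<^sup>2 * exp (- (2 * \<mu> * b)) * (exp (2 * \<mu> * t) * ((b - a) / real (2 ^ l))) = (c t)\<^sup>2 / 2 ^ (k + l)" for t l
    proof -
      have "(exp (\<mu> * (t - b)))\<^sup>2 = exp (- (2 * \<mu> * b)) * exp (2 * \<mu> * t)"
        by (simp add: exp_double[symmetric] exp_add[symmetric] algebra_simps)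
      then show ?thesis by (simp add: c_def power_mult_distrib ab(3) h_def power_add)
    qed
    show "(\<lambda>l. \<Sum>j<2 ^ l. (c (dyadic (k + l) (i * 2 ^ l + j)))\<^sup>2 / 2 ^ (k + l)) \<longlonglongrightarrow> (\<sigma> * sqrt ((1 - exp (- (2 * \<mu> * h))) / (2 * \<mu>)))\<^sup>2"
      using * unfolding sum_distrib_left pt grid .
  qed
qed

text \<open>If the sample point is observed through the past \<open>R\<close> only, the pair of
  sample point and noise has a product law. The next position is a function of this pair, and
  Fubini's theorem integrates out the noise.\<close>

lemma X_markov:
  fixes k i :: nat and f :: "real \<Rightarrow> ennreal"
  assumes A: "A \<in> sets (nat_filtration M B (dyadic k i))" and f[measurable]: "f \<in> borel_measurable borel"
  shows "(\<integral>\<^sup>+\<omega>. f (X (dyadic k (Suc i)) \<omega>) * indicator A \<omega> \<partial>M)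
       = (\<integral>\<^sup>+\<omega>. ou_transition \<mu> \<sigma> \<theta> (1 / 2 ^ k) f (X (dyadic k i) \<omega>) * indicator A \<omega> \<partial>M)"
proof -
  define h :: real where "h = 1 / 2 ^ k"
  let ?F = "nat_filtration M B (dyadic k i)"
  define R where "R = restr_to_subalg M ?F"
  define Z where "Z \<omega> = X (dyadic k (Suc i)) \<omega> - \<theta> - exp (- (\<mu> * h)) * (X (dyadic k i) \<omega> - \<theta>)" for \<omega>
  define s where "s = \<sigma> * sqrt ((1 - exp (- (2 * \<mu> * h))) / (2 * \<mu>))"
  define N where "N = distr std_normal_distribution borel (\<lambda>w. s * w)"
  have dy: "dyadic n j \<ge> 0" for n j by (simp add: dyadic_def)
  have Zm[measurable]: "Z \<in> borel_measurable M"
    unfolding Z_def using X_measurable[OF dy] by measurable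
  have sa: "subalgebra M ?F" unfolding subalgebra_def using nat_filtration_subset by simp
  have setsR: "sets R = sets ?F" and spR: "space R = space M"
    using sa by (simp_all add: R_def sets_restr_to_subalg space_restr_to_subalg)
  interpret R: prob_space R
    unfolding R_def by (rule prob_space_restr_to_subalg[OF sa]) unfold_locales
  interpret SN: prob_space std_normal_distribution by (rule prob_space_normal_density) simp
  interpret N: prob_space N unfolding N_def by (rule SN.prob_space_distr) simp
  have idm: "(\<lambda>\<omega>. \<omega>) \<in> measurable M R"
    using nat_filtration_subset by (auto simp: measurable_def spR setsR)
  have pm: "(\<lambda>\<omega>. (\<omega>, Z \<omega>)) \<in> measurable M (R \<Otimes>\<^sub>M borel)"
    by (rule measurable_Pair[OF idm Zm])
  have setsN: "sets N = sets borel" by (simp add: N_def)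
  have eq: "R \<Otimes>\<^sub>M N = distr M (R \<Otimes>\<^sub>M borel) (\<lambda>\<omega>. (\<omega>, Z \<omega>))"
  proof (rule pair_measure_eqI)
    show "sigma_finite_measure R" by unfold_locales
    show "sigma_finite_measure N" by unfold_locales
    show "sets (R \<Otimes>\<^sub>M N) = sets (distr M (R \<Otimes>\<^sub>M borel) (\<lambda>\<omega>. (\<omega>, Z \<omega>)))"
      by (simp add: setsN cong: sets_pair_measure_cong)
    fix A' D assume A': "A' \<in> sets R" and D: "D \<in> sets N"
    have D': "D \<in> sets borel" using D setsN by simp
    have AF: "A' \<in> sets ?F" using A' setsR by simp
    have "emeasure (distr M (R \<Otimes>\<^sub>M borel) (\<lambda>\<omega>. (\<omega>, Z \<omega>))) (A' \<times> D) = emeasure M ((\<lambda>\<omega>. (\<omega>, Z \<omega>)) -` (A' \<times> D) \<inter> space M)"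
      using A' D' by (intro emeasure_distr[OF pm]) auto
    also have "(\<lambda>\<omega>. (\<omega>, Z \<omega>)) -` (A' \<times> D) \<inter> space M = A' \<inter> (Z -` D \<inter> space M)" by auto
    also have "emeasure M \<dots> = ennreal (prob A' * measure N D)"
      using X_noise_independent[OF AF D'] by (simp add: emeasure_eq_measure Z_def[abs_def] h_def N_def s_def)
    also have "\<dots> = emeasure R A' * emeasure N D"
      using A' by (simp add: R_def emeasure_restr_to_subalg[OF sa AF] N.emeasure_eq_measure emeasure_eq_measure ennreal_mult'[symmetric])
    finally show "emeasure R A' * emeasure N D = emeasure (distr M (R \<Otimes>\<^sub>M borel) (\<lambda>\<omega>. (\<omega>, Z \<omega>))) (A' \<times> D)" ..
  qed
  have Xt: "X (dyadic k i) \<in> borel_measurable R"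
    using X_adapted[OF dy[of k i]] by (simp add: setsR cong: measurable_cong_sets)
  have AR: "A \<in> sets R" using A setsR by simp
  define g where "g = (\<lambda>(\<omega>, z). f (\<theta> + exp (- (\<mu> * h)) * (X (dyadic k i) \<omega> - \<theta>) + z) * indicator A \<omega>)"
  have g[measurable]: "g \<in> borel_measurable (R \<Otimes>\<^sub>M borel)"
    unfolding g_def using Xt AR by measurable
  have gN: "g \<in> borel_measurable (R \<Otimes>\<^sub>M N)"
    using g by (simp add: setsN cong: measurable_cong_sets sets_pair_measure_cong)
  have "(\<integral>\<^sup>+\<omega>. f (X (dyadic k (Suc i)) \<omega>) * indicator A \<omega> \<partial>M) = (\<integral>\<^sup>+\<omega>. g (\<omega>, Z \<omega>) \<partial>M)"
    by (intro nn_integral_cong) (simp add: g_def Z_def)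
  also have "\<dots> = (\<integral>\<^sup>+p. g p \<partial>(R \<Otimes>\<^sub>M N))"
    unfolding eq by (subst nn_integral_distr[OF pm]) (simp_all add: g)
  also have "\<dots> = (\<integral>\<^sup>+\<omega>. (\<integral>\<^sup>+z. g (\<omega>, z) \<partial>N) \<partial>R)"
    by (rule N.nn_integral_fst[symmetric, OF gN])
  also have "\<dots> = (\<integral>\<^sup>+\<omega>. ou_transition \<mu> \<sigma> \<theta> h f (X (dyadic k i) \<omega>) * indicator A \<omega> \<partial>R)"
  proof (rule nn_integral_cong)
    fix \<omega> assume "\<omega> \<in> space R"
    have "(\<integral>\<^sup>+z. g (\<omega>, z) \<partial>N) = (\<integral>\<^sup>+w. g (\<omega>, s * w) \<partial>std_normal_distribution)"
      unfolding N_def by (subst nn_integral_distr) (auto simp: g_def)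
    also have "\<dots> = ou_transition \<mu> \<sigma> \<theta> h f (X (dyadic k i) \<omega>) * indicator A \<omega>"
      unfolding g_def ou_transition_def s_def prod.case
      by (subst nn_integral_multc) auto
    finally show "(\<integral>\<^sup>+z. g (\<omega>, z) \<partial>N) = ou_transition \<mu> \<sigma> \<theta> h f (X (dyadic k i) \<omega>) * indicator A \<omega>" .
  qed
  also have "\<dots> = (\<integral>\<^sup>+\<omega>. ou_transition \<mu> \<sigma> \<theta> h f (X (dyadic k i) \<omega>) * indicator A \<omega> \<partial>M)"
  proof -
    have "(\<lambda>y. ou_transition \<mu> \<sigma> \<theta> h f y) \<in> borel_measurable borel"
      unfolding ou_transition_def
      by (rule SN.borel_measurable_nn_integral) (auto simp: case_prod_beta)
    then have "(\<lambda>\<omega>. ou_transition \<mu> \<sigma> \<theta> h f (X (dyadic k i) \<omega>) * indicator A \<omega>) \<in> borel_measurable ?F"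
      using X_adapted[OF dy[of k i]] A by measurable
    then show ?thesis unfolding R_def by (rule nn_integral_subalgebra2[OF sa])
  qed
  finally show ?thesis by (simp add: h_def)
qed

end

section \<open>Optional sampling\<close>

text \<open>A discrete stopping time \<open>T\<close> is encoded by the events \<open>Q n = {T \<le> n}\<close>; the stopped value is
  \<open>0\<close> where \<open>T\<close> is infinite.\<close>

definition stopped_value :: "(nat \<Rightarrow> 'a \<Rightarrow> ennreal) \<Rightarrow> (nat \<Rightarrow> 'a set) \<Rightarrow> 'a \<Rightarrow> ennreal" where
  "stopped_value Y Q \<omega> = (\<Sum>n. Y n \<omega> * indicator (disjointed Q n) \<omega>)"

lemma stopped_value_eq: "\<omega> \<in> disjointed Q n \<Longrightarrow> stopped_value Y Q \<omega> = Y n \<omega>"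
proof -
  assume \<omega>: "\<omega> \<in> disjointed Q n"
  have "\<omega> \<notin> disjointed Q m" if "m \<noteq> n" for m
    using disjoint_family_disjointed[of Q] \<omega> that by (auto simp: disjoint_family_on_def)
  then have "stopped_value Y Q \<omega> = (\<Sum>m\<in>{n}. Y m \<omega> * indicator (disjointed Q m) \<omega>)"
    unfolding stopped_value_def by (intro suminf_finite) (auto simp: indicator_def)
  with \<omega> show ?thesis by simp
qed

lemma stopped_value_zero: "\<omega> \<notin> (\<Union>n. Q n) \<Longrightarrow> stopped_value Y Q \<omega> = 0"
proof -
  assume "\<omega> \<notin> (\<Union>n. Q n)"
  then have "\<omega> \<notin> disjointed Q n" for n using disjointed_subset[of Q n] by blast
  then show ?thesis by (simp add: stopped_value_def)
qed

lemma stopped_value_cases: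
  obtains n where "\<omega> \<in> disjointed Q n" "stopped_value Y Q \<omega> = Y n \<omega>"
  | "\<omega> \<notin> (\<Union>n. Q n)" "stopped_value Y Q \<omega> = 0"
  using stopped_value_eq stopped_value_zero UN_disjointed_eq[of Q] by (metis UN_E)

text \<open>Conditional expectations are replaced by integrals over events of the past, and values
  in \<open>ennreal\<close> make all these integrals meaningful.\<close>

locale discrete_supermartingale =
  fixes M :: "'a measure" and G :: "nat \<Rightarrow> 'a measure" and Y :: "nat \<Rightarrow> 'a \<Rightarrow> ennreal"
  assumes G_space: "space (G n) = space M" and G_sub: "sets (G n) \<subseteq> sets M"
    and G_mono: "m \<le> n \<Longrightarrow> sets (G m) \<subseteq> sets (G n)"
    and Y_measurable[measurable]: "Y n \<in> borel_measurable M"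
    and Y_step: "A \<in> sets (G n) \<Longrightarrow> (\<integral>\<^sup>+\<omega>. Y (Suc n) \<omega> * indicator A \<omega> \<partial>M) \<le> (\<integral>\<^sup>+\<omega>. Y n \<omega> * indicator A \<omega> \<partial>M)"
begin

lemma union_before: "(\<And>n. Q n \<in> sets (G n)) \<Longrightarrow> (\<Union>m<n. Q m) \<in> sets (G n)"
  using subsetD[OF G_mono[OF less_imp_le]] by (intro sets.finite_UN) auto

lemma disjointed_adapted: "(\<And>n. Q n \<in> sets (G n)) \<Longrightarrow> disjointed Q n \<in> sets (G n)"
  using union_before[of Q n] unfolding disjointed_def by (simp add: lessThan_atLeast0)

text \<open>The left side is the mass already stopped plus the mass still running at time
  \<open>N\<close>. One more step splits off the part stopped at \<open>N\<close> and moves the rest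
  forward, which can only decrease it.\<close>

lemma sampling_after_partial:
  assumes A: "A \<in> sets (G j)" and Q: "\<And>n. Q n \<in> sets (G n)" and before: "\<And>m. m < j \<Longrightarrow> A \<inter> Q m = {}"
    and N: "j \<le> N"
  shows "(\<Sum>n<N. \<integral>\<^sup>+\<omega>. Y n \<omega> * indicator (A \<inter> disjointed Q n) \<omega> \<partial>M)
       + (\<integral>\<^sup>+\<omega>. Y N \<omega> * indicator (A - (\<Union>m<N. Q m)) \<omega> \<partial>M) \<le> (\<integral>\<^sup>+\<omega>. Y j \<omega> * indicator A \<omega> \<partial>M)"
  using N
proof (induction N rule: dec_induct)
  case base
  have "A \<inter> disjointed Q n = {}" if "n < j" for n using before[OF that] disjointed_subset[of Q n] by blast
  moreover have "A - (\<Union>m<j. Q m) = A" using before by blast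
  ultimately show ?case by simp
next
  case (step N)
  let ?R = "\<lambda>n. A - (\<Union>m<n. Q m)"
  have AG: "A \<in> sets (G N)" using A G_mono[OF step.hyps(1)] by blast
  have RG: "?R N \<in> sets (G N)" "A \<inter> disjointed Q N \<in> sets (G N)" "?R (Suc N) \<in> sets (G N)"
    using AG union_before[of Q N] disjointed_adapted[of Q N] Q by (auto simp: lessThan_Suc)
  then have [measurable]: "?R N \<in> sets M" "A \<inter> disjointed Q N \<in> sets M" "?R (Suc N) \<in> sets M"
    using G_sub by auto
  have split: "indicator (?R N) \<omega> = (indicator (A \<inter> disjointed Q N) \<omega> + indicator (?R (Suc N)) \<omega> :: ennreal)" for \<omega>
    by (auto simp: indicator_def disjointed_def less_Suc_eq split: if_splits)
  have "(\<integral>\<^sup>+\<omega>. Y N \<omega> * indicator (?R N) \<omega> \<partial>M)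
     = (\<integral>\<^sup>+\<omega>. Y N \<omega> * indicator (A \<inter> disjointed Q N) \<omega> \<partial>M) + (\<integral>\<^sup>+\<omega>. Y N \<omega> * indicator (?R (Suc N)) \<omega> \<partial>M)"
    unfolding split distrib_left by (rule nn_integral_add) measurable
  moreover have "(\<integral>\<^sup>+\<omega>. Y (Suc N) \<omega> * indicator (?R (Suc N)) \<omega> \<partial>M) \<le> (\<integral>\<^sup>+\<omega>. Y N \<omega> * indicator (?R (Suc N)) \<omega> \<partial>M)"
    by (rule Y_step[OF RG(3)])
  ultimately have "(\<integral>\<^sup>+\<omega>. Y N \<omega> * indicator (A \<inter> disjointed Q N) \<omega> \<partial>M) + (\<integral>\<^sup>+\<omega>. Y (Suc N) \<omega> * indicator (?R (Suc N)) \<omega> \<partial>M)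
      \<le> (\<integral>\<^sup>+\<omega>. Y N \<omega> * indicator (?R N) \<omega> \<partial>M)"
    by (simp add: add_left_mono)
  then show ?case
    using step.IH unfolding sum.lessThan_Suc add.assoc by (elim order.trans[OF add_left_mono])
qed

text \<open>The integral is decomposed along the value \<open>j\<close> of the earlier time, before
  which the later one cannot have occurred. The mass still running is nonnegative and is dropped, so
  both times may be infinite.\<close>

lemma optional_sampling:
  assumes P: "\<And>n. P n \<in> sets (G n)" and Q: "\<And>n. Q n \<in> sets (G n)" and le: "\<And>n. Q n \<subseteq> P n"
  shows "(\<integral>\<^sup>+\<omega>. stopped_value Y Q \<omega> \<partial>M) \<le> (\<integral>\<^sup>+\<omega>. stopped_value Y P \<omega> \<partial>M)"
proof -
  have [measurable]: "disjointed P j \<in> sets M" "disjointed Q j \<in> sets M" for j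
    using disjointed_adapted[of P j] disjointed_adapted[of Q j] P Q G_sub by auto
  have sQ[measurable]: "stopped_value Y Q \<in> borel_measurable M"
    unfolding stopped_value_def[abs_def] by measurable
  have split: "stopped_value Y Q \<omega> = (\<Sum>j. stopped_value Y Q \<omega> * indicator (disjointed P j) \<omega>)" for \<omega>
  proof (cases "\<omega> \<in> (\<Union>n. P n)")
    case True
    then obtain j where j: "\<omega> \<in> disjointed P j" using UN_disjointed_eq[of P] by blast
    show ?thesis using stopped_value_eq[OF j, of "\<lambda>_. stopped_value Y Q"] by (simp add: stopped_value_def)
  next
    case False
    then have "\<omega> \<notin> (\<Union>n. Q n)" using le by auto
    then have "stopped_value Y Q \<omega> = 0" by (rule stopped_value_zero)
    then show ?thesis by simp
  qed
  have one: "(\<integral>\<^sup>+\<omega>. stopped_value Y Q \<omega> * indicator (disjointed P j) \<omega> \<partial>M) \<le> (\<integral>\<^sup>+\<omega>. Y j \<omega> * indicator (disjointed P j) \<omega> \<partial>M)" for j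
  proof -
    let ?A = "disjointed P j"
    have before: "?A \<inter> Q m = {}" if "m < j" for m
      using le[of m] that by (auto simp: disjointed_def)
    have "(\<integral>\<^sup>+\<omega>. stopped_value Y Q \<omega> * indicator ?A \<omega> \<partial>M) = (\<integral>\<^sup>+\<omega>. (\<Sum>n. Y n \<omega> * indicator (?A \<inter> disjointed Q n) \<omega>) \<partial>M)"
      unfolding stopped_value_def ennreal_suminf_multc[symmetric]
      by (intro nn_integral_cong suminf_cong) (simp add: indicator_inter_arith mult_ac)
    also have "\<dots> = (\<Sum>n. \<integral>\<^sup>+\<omega>. Y n \<omega> * indicator (?A \<inter> disjointed Q n) \<omega> \<partial>M)"
      by (rule nn_integral_suminf) measurable
    also have "\<dots> \<le> (\<integral>\<^sup>+\<omega>. Y j \<omega> * indicator ?A \<omega> \<partial>M)"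
    proof (rule suminf_le_const)
      fix N
      have "(\<Sum>n<N. \<integral>\<^sup>+\<omega>. Y n \<omega> * indicator (?A \<inter> disjointed Q n) \<omega> \<partial>M)
         \<le> (\<Sum>n<max N j. \<integral>\<^sup>+\<omega>. Y n \<omega> * indicator (?A \<inter> disjointed Q n) \<omega> \<partial>M)"
        by (intro sum_mono2) auto
      also have "\<dots> \<le> (\<integral>\<^sup>+\<omega>. Y j \<omega> * indicator ?A \<omega> \<partial>M)"
        by (rule order.trans[OF _ sampling_after_partial[OF disjointed_adapted[OF P] Q before, of "max N j"]]) auto
      finally show "(\<Sum>n<N. \<integral>\<^sup>+\<omega>. Y n \<omega> * indicator (?A \<inter> disjointed Q n) \<omega> \<partial>M) \<le> (\<integral>\<^sup>+\<omega>. Y j \<omega> * indicator ?A \<omega> \<partial>M)" .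
    qed simp
    finally show ?thesis .
  qed
  have "(\<integral>\<^sup>+\<omega>. stopped_value Y Q \<omega> \<partial>M) = (\<integral>\<^sup>+\<omega>. (\<Sum>j. stopped_value Y Q \<omega> * indicator (disjointed P j) \<omega>) \<partial>M)"
    by (intro nn_integral_cong split)
  also have "\<dots> = (\<Sum>j. \<integral>\<^sup>+\<omega>. stopped_value Y Q \<omega> * indicator (disjointed P j) \<omega> \<partial>M)"
    by (rule nn_integral_suminf) measurable
  also have "\<dots> \<le> (\<Sum>j. \<integral>\<^sup>+\<omega>. Y j \<omega> * indicator (disjointed P j) \<omega> \<partial>M)"
    by (intro suminf_le one) auto
  also have "\<dots> = (\<integral>\<^sup>+\<omega>. stopped_value Y P \<omega> \<partial>M)"
    unfolding stopped_value_def by (rule nn_integral_suminf[symmetric]) measurable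
  finally show ?thesis .
qed

text \<open>Sampling at the first entrance into [l, \<infinity>], compared with time 0; the latter
  is encoded by the whole space at every index.\<close>

lemma maximal_inequality:
  assumes Q: "\<And>n. {\<omega> \<in> space M. Y n \<omega> \<ge> l} \<in> sets (G n)"
  shows "l * emeasure M {\<omega> \<in> space M. \<exists>n. Y n \<omega> \<ge> l} \<le> (\<integral>\<^sup>+\<omega>. Y 0 \<omega> \<partial>M)"
proof -
  let ?Q = "\<lambda>n. {\<omega> \<in> space M. Y n \<omega> \<ge> l}" and ?P = "\<lambda>n::nat. space M"
  have [measurable]: "?Q n \<in> sets M" for n using Q G_sub by blast
  have eq: "{\<omega> \<in> space M. \<exists>n. Y n \<omega> \<ge> l} = (\<Union>n. ?Q n)" by auto
  have "l * emeasure M {\<omega> \<in> space M. \<exists>n. Y n \<omega> \<ge> l} = (\<integral>\<^sup>+\<omega>. l * indicator (\<Union>n. ?Q n) \<omega> \<partial>M)"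
    unfolding eq by (rule nn_integral_cmult_indicator[symmetric]) measurable
  also have "\<dots> \<le> (\<integral>\<^sup>+\<omega>. stopped_value Y ?Q \<omega> \<partial>M)"
  proof (rule nn_integral_mono)
    fix \<omega>
    show "l * indicator (\<Union>n. ?Q n) \<omega> \<le> stopped_value Y ?Q \<omega>"
    proof (rule stopped_value_cases[of \<omega> ?Q Y])
      fix n assume n: "\<omega> \<in> disjointed ?Q n" "stopped_value Y ?Q \<omega> = Y n \<omega>"
      then have "l \<le> Y n \<omega>" using disjointed_subset[of ?Q n] by auto
      with n show ?thesis by (auto simp: indicator_def)
    qed (auto simp: indicator_def)
  qed
  also have "\<dots> \<le> (\<integral>\<^sup>+\<omega>. stopped_value Y ?P \<omega> \<partial>M)"
    using Q G_space by (intro optional_sampling) (auto simp: sets.top[of "G _", unfolded G_space])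
  also have "\<dots> = (\<integral>\<^sup>+\<omega>. Y 0 \<omega> \<partial>M)"
    by (intro nn_integral_cong stopped_value_eq) (auto simp: disjointed_def)
  finally show ?thesis .
qed

end

text \<open>Only the supermedian inequality is recorded. The regularity that limits along dyadic
  times require enters separately, as continuity of the function.\<close>

definition ou_excessive :: "real \<Rightarrow> real \<Rightarrow> real \<Rightarrow> real \<Rightarrow> (real \<Rightarrow> real) \<Rightarrow> bool" where
  "ou_excessive \<mu> \<sigma> \<theta> r f \<longleftrightarrow>
     (\<forall>h>0. \<forall>y. ou_transition \<mu> \<sigma> \<theta> h (\<lambda>y. ennreal (f y)) y \<le> ennreal (exp (r * h) * f y))"

text \<open>Rounding up turns a stopping time into a stopping time of the grid: the rounded time is
  at most a grid point exactly when the time itself is.\<close>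

definition dyadic_ceil :: "nat \<Rightarrow> real \<Rightarrow> nat" where
  "dyadic_ceil k T = nat \<lceil>T * 2 ^ k\<rceil>"

lemma dyadic_nonneg [simp]: "0 \<le> dyadic k n"
  by (simp add: dyadic_def)

lemma dyadic_mono: "m \<le> n \<Longrightarrow> dyadic k m \<le> dyadic k n"
  by (simp add: dyadic_def divide_right_mono)

lemma le_dyadic_iff: "T \<le> dyadic k n \<longleftrightarrow> dyadic_ceil k T \<le> n"
  unfolding dyadic_def dyadic_ceil_def by (simp add: le_divide_eq nat_le_iff ceiling_le_iff)

lemma dyadic_ceil_ge: "T \<le> dyadic k (dyadic_ceil k T)"
  by (simp add: le_dyadic_iff)

lemma dyadic_ceil_tendsto:
  assumes "T \<ge> 0"
  shows "(\<lambda>k. dyadic k (dyadic_ceil k T)) \<longlonglongrightarrow> T"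
proof (rule tendsto_sandwich)
  show "\<forall>\<^sub>F k in sequentially. T \<le> dyadic k (dyadic_ceil k T)" by (simp add: dyadic_ceil_ge)
  show "\<forall>\<^sub>F k in sequentially. dyadic k (dyadic_ceil k T) \<le> T + (1 / 2) ^ k"
  proof (intro always_eventually allI)
    fix k
    have "real (dyadic_ceil k T) = of_int \<lceil>T * 2 ^ k\<rceil>" using assms by (simp add: dyadic_ceil_def)
    also have "\<dots> \<le> T * 2 ^ k + 1" by linarith
    finally show "dyadic k (dyadic_ceil k T) \<le> T + (1 / 2) ^ k"
      by (simp add: dyadic_def divide_le_eq power_one_over distrib_right)
  qed
  have "(\<lambda>k. T + (1 / 2) ^ k) \<longlonglongrightarrow> T + 0"
    by (intro tendsto_add tendsto_const LIMSEQ_power_zero) simp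
  then show "(\<lambda>k. T + (1 / 2) ^ k) \<longlonglongrightarrow> T" by simp
qed (rule tendsto_const)

lemma mem_disjointed_iff_Least:
  assumes "\<And>n. \<omega> \<in> Q n \<longleftrightarrow> c \<le> n"
  shows "\<omega> \<in> disjointed Q n \<longleftrightarrow> n = (c::nat)"
  unfolding disjointed_def using assms by (auto simp: not_le)

text \<open>A discrete layer cake bound: at least \<open>S - 1\<close> positive integers lie below
  \<open>S\<close>.\<close>

lemma ennreal_le_one_plus_suminf_levels:
  fixes S :: ennreal
  shows "S \<le> 1 + (\<Sum>n. if ennreal (real n + 1) < S then 1 else 0)"
proof (rule ccontr)
  let ?c = "\<Sum>n. if ennreal (real n + 1) < S then 1 else 0 :: ennreal"
  assume "\<not> S \<le> 1 + ?c"
  then have lt: "1 + ?c < S" by simp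
  then have "?c \<noteq> \<top>" by (auto simp: top_unique)
  then obtain c where c: "c \<ge> 0" "?c = ennreal c" by (cases ?c) auto
  define m where "m = nat \<lfloor>c\<rfloor> + 1"
  have m: "c < real m" "real m \<le> c + 1" using c by (auto simp: m_def) linarith+
  have "ennreal (real n + 1) < S" if "n < m" for n
  proof -
    have "ennreal (real n + 1) \<le> ennreal (1 + c)" using that m by (intro ennreal_leI) linarith
    also have "\<dots> < S" using lt c by simp
    finally show ?thesis .
  qed
  then have "(\<Sum>n<m. if ennreal (real n + 1) < S then 1 else 0 :: ennreal) = of_nat m" by simp
  moreover have "(\<Sum>n<m. if ennreal (real n + 1) < S then 1 else 0 :: ennreal) \<le> ?c" by (rule sum_le_suminf) auto
  ultimately have "ennreal (real m) \<le> ennreal c" using c by (simp add: ennreal_of_nat_eq_real_of_nat)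
  with m c show False by (simp add: ennreal_le_iff2)
qed

section \<open>Optional sampling for the process in continuous time\<close>

context ou_process
begin

lemma supermartingale_of_excessive:
  assumes f[measurable]: "f \<in> borel_measurable borel" and nn: "\<And>y. f y \<ge> 0" and ex: "ou_excessive \<mu> \<sigma> \<theta> r f"
  shows "discrete_supermartingale M (\<lambda>n. nat_filtration M B (dyadic k n))
     (\<lambda>n \<omega>. ennreal (exp (- r * dyadic k n) * f (X (dyadic k n) \<omega>)))"
proof
  fix n
  show "(\<lambda>\<omega>. ennreal (exp (- r * dyadic k n) * f (X (dyadic k n) \<omega>))) \<in> borel_measurable M"
    using X_measurable[of "dyadic k n"] by measurable
  fix A assume A: "A \<in> sets (nat_filtration M B (dyadic k n))"
  then have [measurable]: "A \<in> events" using nat_filtration_subset by auto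
  let ?s = "dyadic k n" and ?t = "dyadic k (Suc n)"
  have [measurable]: "X ?s \<in> borel_measurable M" "X ?t \<in> borel_measurable M" by (simp_all add: X_measurable)
  have t: "?t = ?s + 1 / 2 ^ k" by (simp add: dyadic_def add_divide_distrib)
  have "(\<integral>\<^sup>+\<omega>. ennreal (exp (- r * ?t) * f (X ?t \<omega>)) * indicator A \<omega> \<partial>M)
     = ennreal (exp (- r * ?t)) * (\<integral>\<^sup>+\<omega>. ennreal (f (X ?t \<omega>)) * indicator A \<omega> \<partial>M)"
    by (subst nn_integral_cmult[symmetric]) (auto simp: ennreal_mult nn mult.assoc)
  also have "(\<integral>\<^sup>+\<omega>. ennreal (f (X ?t \<omega>)) * indicator A \<omega> \<partial>M)
     = (\<integral>\<^sup>+\<omega>. ou_transition \<mu> \<sigma> \<theta> (1 / 2 ^ k) (\<lambda>y. ennreal (f y)) (X ?s \<omega>) * indicator A \<omega> \<partial>M)"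
    by (rule X_markov[OF A]) measurable
  also have "\<dots> \<le> (\<integral>\<^sup>+\<omega>. ennreal (exp (r * (1 / 2 ^ k)) * f (X ?s \<omega>)) * indicator A \<omega> \<partial>M)"
    using ex[unfolded ou_excessive_def, rule_format, of "1 / 2 ^ k"] by (intro nn_integral_mono mult_right_mono) auto
  also have "ennreal (exp (- r * ?t)) * \<dots> = (\<integral>\<^sup>+\<omega>. ennreal (exp (- r * ?s) * f (X ?s \<omega>)) * indicator A \<omega> \<partial>M)"
  proof -
    have e: "exp (- r * ?t) * exp (r * (1 / 2 ^ k)) = exp (- r * ?s)"
      unfolding t exp_add[symmetric] by (simp add: algebra_simps)
    have "ennreal (exp (- r * ?t)) * ennreal (exp (r * (1 / 2 ^ k)) * y) = ennreal (exp (- r * ?s) * y)" for y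
      unfolding ennreal_mult'[OF exp_ge_zero, symmetric] mult.assoc[symmetric] e ..
    then show ?thesis
      by (subst nn_integral_cmult[symmetric]) (auto simp: mult.assoc[symmetric])
  qed
  finally show "(\<integral>\<^sup>+\<omega>. ennreal (exp (- r * ?t) * f (X ?t \<omega>)) * indicator A \<omega> \<partial>M)
     \<le> (\<integral>\<^sup>+\<omega>. ennreal (exp (- r * ?s) * f (X ?s \<omega>)) * indicator A \<omega> \<partial>M)" by (simp add: mult_left_mono)
qed (use nat_filtration_subset nat_filtration_mono dyadic_mono in auto)

text \<open>Dyadic times keep the supremum measurable; by path continuity it nevertheless bounds the
  discounted price at every time.\<close>

definition disc_sup :: "real \<Rightarrow> 'a \<Rightarrow> ennreal" where
  "disc_sup r \<omega> = (SUP k. SUP n. ennreal (exp (- r * dyadic k n + X (dyadic k n) \<omega>)))"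

lemma disc_sup_measurable [measurable]: "disc_sup r \<in> borel_measurable M"
  unfolding disc_sup_def[abs_def] using X_measurable[OF dyadic_nonneg] by measurable

lemma disc_sup_upper:
  assumes \<omega>: "\<omega> \<in> space M" and t: "t \<ge> 0"
  shows "ennreal (exp (- r * t + X t \<omega>)) \<le> disc_sup r \<omega>"
proof (rule LIMSEQ_le_const2)
  let ?d = "\<lambda>k. dyadic k (dyadic_ceil k t)"
  have "(\<lambda>k. X (?d k) \<omega>) \<longlonglongrightarrow> X t \<omega>"
    by (rule continuous_on_tendsto_compose[OF X_continuous[OF \<omega>] dyadic_ceil_tendsto[OF t]]) (use t in auto)
  then show "(\<lambda>k. ennreal (exp (- r * ?d k + X (?d k) \<omega>))) \<longlonglongrightarrow> ennreal (exp (- r * t + X t \<omega>))"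
    by (intro tendsto_intros dyadic_ceil_tendsto[OF t])
  show "\<exists>N. \<forall>k\<ge>N. ennreal (exp (- r * ?d k + X (?d k) \<omega>)) \<le> disc_sup r \<omega>"
    unfolding disc_sup_def by (intro exI allI impI SUP_upper2[OF UNIV_I] SUP_upper) auto
qed

text \<open>The excessive function \<open>\<Phi>\<close> turns the maximal inequality into a weak \<open>L\<^sup>2\<close> bound for the
  running supremum.\<close>

lemma disc_sup_integrable:
  assumes \<Phi>: "continuous_on UNIV \<Phi>" "\<And>y. \<Phi> y \<ge> 0" "ou_excessive \<mu> \<sigma> \<theta> (2 * r) \<Phi>"
    and C: "C > 0" "\<And>y. exp (2 * y) \<le> C * \<Phi> y"
  shows "(\<integral>\<^sup>+\<omega>. disc_sup r \<omega> \<partial>M) < \<infinity>"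
proof -
  have \<Phi>m[measurable]: "\<Phi> \<in> borel_measurable borel" using \<Phi>(1) by (rule borel_measurable_continuous_onI)
  have dX[measurable]: "X (dyadic k n) \<in> borel_measurable M" for k n by (simp add: X_measurable)
  define E where "E k s = {\<omega> \<in> space M. \<exists>n. exp (- r * dyadic k n + X (dyadic k n) \<omega>) > s}" for k s
  have Em[measurable]: "E k s \<in> events" for k s unfolding E_def by measurable
  \<comment> \<open>The square of exp(- r t + X t) carries the discount rate 2 r and exp(2 X t),
    which explains the rate and the exponent in the hypotheses on \<open>\<Phi>\<close>. The decay 1
    / s^2 makes the sum over integer levels finite.\<close>
  have level: "emeasure M (E k s) \<le> ennreal (C * \<Phi> x / s\<^sup>2)" if s: "s > 0" for k s
  proof -
    let ?Y = "\<lambda>n \<omega>. ennreal (exp (- (2 * r) * dyadic k n) * \<Phi> (X (dyadic k n) \<omega>))"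
    interpret Y: discrete_supermartingale M "\<lambda>n. nat_filtration M B (dyadic k n)" ?Y
      by (rule supermartingale_of_excessive) (use \<Phi> in auto)
    let ?l = "ennreal (s\<^sup>2 / C)"
    have "?l * emeasure M {\<omega> \<in> space M. \<exists>n. ?Y n \<omega> \<ge> ?l} \<le> (\<integral>\<^sup>+\<omega>. ?Y 0 \<omega> \<partial>M)"
    proof (rule Y.maximal_inequality)
      fix n
      have "?Y n \<in> borel_measurable (nat_filtration M B (dyadic k n))"
        using X_adapted[OF dyadic_nonneg[of k n]] by measurable
      then have "{\<omega> \<in> space (nat_filtration M B (dyadic k n)). ?Y n \<omega> \<ge> ?l} \<in> sets (nat_filtration M B (dyadic k n))"
        by measurable
      then show "{\<omega> \<in> space M. ?Y n \<omega> \<ge> ?l} \<in> sets (nat_filtration M B (dyadic k n))" by simp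
    qed
    also have "(\<integral>\<^sup>+\<omega>. ?Y 0 \<omega> \<partial>M) = (\<integral>\<^sup>+\<omega>. ennreal (\<Phi> x) \<partial>M)"
      by (intro nn_integral_cong) (simp add: dyadic_def X_zero)
    also have "\<dots> = ennreal (\<Phi> x)" by (simp add: emeasure_space_1)
    finally have *: "?l * emeasure M {\<omega> \<in> space M. \<exists>n. ?Y n \<omega> \<ge> ?l} \<le> ennreal (\<Phi> x)" .
    have "E k s \<subseteq> {\<omega> \<in> space M. \<exists>n. ?Y n \<omega> \<ge> ?l}"
    proof
      fix \<omega> assume "\<omega> \<in> E k s"
      then obtain n where n: "\<omega> \<in> space M" "exp (- r * dyadic k n + X (dyadic k n) \<omega>) > s" by (auto simp: E_def)
      have "s\<^sup>2 \<le> (exp (- r * dyadic k n + X (dyadic k n) \<omega>))\<^sup>2"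
        using n s by (intro power_mono) auto
      also have "\<dots> = exp (- (2 * r) * dyadic k n) * exp (2 * X (dyadic k n) \<omega>)"
        by (simp add: exp_double[symmetric] exp_add[symmetric] algebra_simps)
      also have "\<dots> \<le> exp (- (2 * r) * dyadic k n) * (C * \<Phi> (X (dyadic k n) \<omega>))"
        by (intro mult_left_mono C) auto
      finally have "s\<^sup>2 / C \<le> exp (- (2 * r) * dyadic k n) * \<Phi> (X (dyadic k n) \<omega>)"
        using C by (simp add: divide_le_eq mult_ac)
      then show "\<omega> \<in> {\<omega> \<in> space M. \<exists>n. ?Y n \<omega> \<ge> ?l}" using n by (auto intro!: ennreal_leI exI[of _ n])
    qed
    then have "emeasure M (E k s) \<le> emeasure M {\<omega> \<in> space M. \<exists>n. ?Y n \<omega> \<ge> ?l}"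
      by (rule emeasure_mono) measurable
    then have "?l * emeasure M (E k s) \<le> ennreal (\<Phi> x)"
      using * by (meson mult_left_mono order.trans zero_le)
    then have "s\<^sup>2 / C * prob (E k s) \<le> \<Phi> x"
      using s C \<Phi>(2) by (simp add: emeasure_eq_measure ennreal_mult'[symmetric] ennreal_le_iff)
    then show ?thesis
      using s C by (auto simp: emeasure_eq_measure le_divide_eq divide_le_eq mult_ac intro!: ennreal_leI)
  qed
  have lim: "emeasure M {\<omega> \<in> space M. disc_sup r \<omega> > ennreal s} \<le> ennreal (C * \<Phi> x / s\<^sup>2)" if s: "s > 0" for s
  proof -
    have eq: "{\<omega> \<in> space M. disc_sup r \<omega> > ennreal s} = (\<Union>k. E k s)"
      using s by (auto simp: disc_sup_def less_SUP_iff E_def ennreal_less_iff)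
    \<comment> \<open>The dyadic grids are nested, so a bound that is uniform in \<open>k\<close>
      passes to the union.\<close>
    have "incseq (\<lambda>k. E k s)"
    proof (rule incseq_SucI, rule subsetI)
      fix k \<omega> assume "\<omega> \<in> E k s"
      then obtain n where "\<omega> \<in> space M" "exp (- r * dyadic k n + X (dyadic k n) \<omega>) > s" by (auto simp: E_def)
      then show "\<omega> \<in> E (Suc k) s" unfolding E_def using dyadic_refine[of k n 1] by (auto intro!: exI[of _ "n * 2 ^ 1"])
    qed
    then have "(SUP k. emeasure M (E k s)) = emeasure M (\<Union>k. E k s)" by (intro SUP_emeasure_incseq) auto
    then show ?thesis unfolding eq using level[OF s] by (metis SUP_least)
  qed
  have "(\<integral>\<^sup>+\<omega>. disc_sup r \<omega> \<partial>M) \<le> (\<integral>\<^sup>+\<omega>. 1 + (\<Sum>n. if ennreal (real n + 1) < disc_sup r \<omega> then 1 else 0) \<partial>M)"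
    by (intro nn_integral_mono ennreal_le_one_plus_suminf_levels)
  also have "\<dots> = 1 + (\<Sum>n. \<integral>\<^sup>+\<omega>. (if ennreal (real n + 1) < disc_sup r \<omega> then 1 else 0) \<partial>M)"
    by (subst nn_integral_add) (auto simp: nn_integral_suminf emeasure_space_1)
  also have "\<dots> = 1 + (\<Sum>n. emeasure M {\<omega> \<in> space M. disc_sup r \<omega> > ennreal (real n + 1)})"
  proof (intro arg_cong2[where f="(+)"] refl suminf_cong)
    fix n
    have "(\<integral>\<^sup>+\<omega>. (if ennreal (real n + 1) < disc_sup r \<omega> then 1 else 0) \<partial>M)
      = (\<integral>\<^sup>+\<omega>. indicator {\<omega> \<in> space M. disc_sup r \<omega> > ennreal (real n + 1)} \<omega> \<partial>M)"
      by (intro nn_integral_cong) (auto simp: indicator_def)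
    then show "(\<integral>\<^sup>+\<omega>. (if ennreal (real n + 1) < disc_sup r \<omega> then 1 else 0) \<partial>M)
      = emeasure M {\<omega> \<in> space M. disc_sup r \<omega> > ennreal (real n + 1)}" by simp
  qed
  also have "\<dots> \<le> 1 + (\<Sum>n. ennreal (C * \<Phi> x / (real n + 1)\<^sup>2))"
    by (intro add_left_mono suminf_le lim) auto
  also have "(\<Sum>n. ennreal (C * \<Phi> x / (real n + 1)\<^sup>2)) = ennreal (\<Sum>n. C * \<Phi> x / (real n + 1)\<^sup>2)"
  proof (rule suminf_ennreal2)
    have "summable (\<lambda>n. inverse (real n ^ 2))" by (rule inverse_power_summable) simp
    then have "summable (\<lambda>n. C * \<Phi> x * inverse (real (Suc n) ^ 2))"
      by (subst (asm) summable_Suc_iff[symmetric]) (rule summable_mult)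
    then show "summable (\<lambda>n. C * \<Phi> x / (real n + 1)\<^sup>2)" by (simp add: divide_inverse add.commute)
  qed (use C \<Phi> in auto)
  finally show ?thesis by (auto simp: ennreal_add_eq_top elim!: order.strict_trans1)
qed

text \<open>Grid times are capped at \<open>t\<close>, since a stopping time not after
  \<open>t\<close> may be rounded up beyond \<open>t\<close>.\<close>

lemma disc_pay_adapted:
  assumes \<tau>: "is_stopping_time M B \<tau>" and g: "continuous_on UNIV g" and t: "t \<ge> 0"
  shows "(\<lambda>\<omega>. disc_pay r g X \<tau> \<omega> * indicator {\<omega> \<in> space M. \<tau> \<omega> \<le> ennreal t} \<omega>) \<in> borel_measurable (nat_filtration M B t)"
proof (rule borel_measurable_LIMSEQ_metric)
  define \<rho> where "\<rho> k n = min (dyadic k n) t" for k n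
  have \<rho>: "0 \<le> \<rho> k n" "\<rho> k n \<le> t" for k n using t by (auto simp: \<rho>_def)
  define Q where "Q k n = {\<omega> \<in> space M. \<tau> \<omega> \<le> ennreal (\<rho> k n)}" for k n
  have QF: "Q k n \<in> sets (nat_filtration M B t)" for k n
    using \<tau> \<rho>[of k n] nat_filtration_mono unfolding Q_def is_stopping_time_def by blast
  have DF[measurable]: "disjointed (Q k) n \<in> sets (nat_filtration M B t)" for k n
    unfolding disjointed_def using QF by (intro sets.Diff sets.finite_UN) auto
  have gm[measurable]: "g \<in> borel_measurable borel" using g by (rule borel_measurable_continuous_onI)
  have XF[measurable]: "X (\<rho> k n) \<in> borel_measurable (nat_filtration M B t)" for k n
    using measurable_nat_filtration_mono[OF X_adapted[OF \<rho>(1)] \<rho>(2)] .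
  define V where "V k \<omega> = (\<Sum>n\<le>dyadic_ceil k t. exp (- r * \<rho> k n) * g (X (\<rho> k n) \<omega>) * indicator (disjointed (Q k) n) \<omega>)" for k \<omega>
  show "V k \<in> borel_measurable (nat_filtration M B t)" for k
    unfolding V_def[abs_def] by measurable
  fix \<omega> assume "\<omega> \<in> space (nat_filtration M B t)"
  then have \<omega>: "\<omega> \<in> space M" by simp
  show "(\<lambda>k. V k \<omega>) \<longlonglongrightarrow> disc_pay r g X \<tau> \<omega> * indicator {\<omega> \<in> space M. \<tau> \<omega> \<le> ennreal t} \<omega>"
  proof (cases "\<tau> \<omega> \<le> ennreal t")
    case False
    have "\<omega> \<notin> Q k n" for k n
      using False \<rho>[of k n] unfolding Q_def by (auto dest: order.trans[OF _ ennreal_leI])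
    then have "\<omega> \<notin> disjointed (Q k) n" for k n using disjointed_subset[of "Q k" n] by blast
    then show ?thesis using False by (simp add: V_def)
  next
    case True
    then obtain T where T: "T \<ge> 0" "\<tau> \<omega> = ennreal T" "T \<le> t"
      using t by (cases "\<tau> \<omega>") (auto simp: top_unique)
    have mem: "\<omega> \<in> Q k n \<longleftrightarrow> dyadic_ceil k T \<le> n" for k n
      using T \<rho>[of k n] \<omega> by (simp add: Q_def \<rho>_def le_dyadic_iff[symmetric])
    have "V k \<omega> = exp (- r * \<rho> k (dyadic_ceil k T)) * g (X (\<rho> k (dyadic_ceil k T)) \<omega>)" for k
    proof -
      have "dyadic_ceil k T \<le> dyadic_ceil k t"
        using T dyadic_ceil_ge[of t k] by (simp add: le_dyadic_iff[symmetric])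
      then show ?thesis
        unfolding V_def mem_disjointed_iff_Least[of \<omega> "Q k", OF mem] indicator_def by simp
    qed
    moreover have "(\<lambda>k. \<rho> k (dyadic_ceil k T)) \<longlonglongrightarrow> T"
    proof -
      have "(\<lambda>k. min (dyadic k (dyadic_ceil k T)) t) \<longlonglongrightarrow> min T t"
        by (intro tendsto_min dyadic_ceil_tendsto T tendsto_const)
      then show ?thesis using T by (simp add: \<rho>_def)
    qed
    moreover have "(\<lambda>k. X (\<rho> k (dyadic_ceil k T)) \<omega>) \<longlonglongrightarrow> X T \<omega>"
      by (rule continuous_on_tendsto_compose[OF X_continuous[OF \<omega>] calculation(2)]) (use T \<rho> in auto)
    moreover have "isCont g (X T \<omega>)" using g by (simp add: continuous_on_eq_continuous_at)
    ultimately have "(\<lambda>k. V k \<omega>) \<longlonglongrightarrow> exp (- r * T) * g (X T \<omega>)"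
      by (auto intro!: tendsto_intros isCont_tendsto_compose[of _ g])
    then show ?thesis using T \<omega> by (simp add: disc_pay_def)
  qed
qed

lemma disc_pay_measurable:
  assumes \<tau>: "is_stopping_time M B \<tau>" and g: "continuous_on UNIV g"
  shows "disc_pay r g X \<tau> \<in> borel_measurable M"
proof (rule borel_measurable_LIMSEQ_metric)
  fix n :: nat
  show "(\<lambda>\<omega>. disc_pay r g X \<tau> \<omega> * indicator {\<omega> \<in> space M. \<tau> \<omega> \<le> ennreal (real n)} \<omega>) \<in> borel_measurable M"
    by (rule measurable_nat_filtration_M[OF disc_pay_adapted[OF \<tau> g]]) simp
next
  fix \<omega> assume \<omega>: "\<omega> \<in> space M"
  have "\<forall>\<^sub>F n in sequentially. disc_pay r g X \<tau> \<omega> = disc_pay r g X \<tau> \<omega> * indicator {\<omega> \<in> space M. \<tau> \<omega> \<le> ennreal (real n)} \<omega>"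
  proof (cases "\<tau> \<omega>")
    case (real T)
    obtain N :: nat where N: "T \<le> real N" using real_arch_simple by blast
    show ?thesis using eventually_ge_at_top[of N]
      by eventually_elim (use N \<omega> real in \<open>auto simp: indicator_def ennreal_le_iff2\<close>)
  qed (simp add: disc_pay_def)
  then show "(\<lambda>n. disc_pay r g X \<tau> \<omega> * indicator {\<omega> \<in> space M. \<tau> \<omega> \<le> ennreal (real n)} \<omega>) \<longlonglongrightarrow> disc_pay r g X \<tau> \<omega>"
    by (rule Lim_transform_eventually[OF tendsto_const])
qed

lemma disc_pay_le_sup:
  assumes \<omega>: "\<omega> \<in> space M" and g: "\<And>y. \<bar>g y\<bar> \<le> exp y + c" and c: "c \<ge> 0" and r: "r \<ge> 0"
  shows "ennreal \<bar>disc_pay r g X \<tau> \<omega>\<bar> \<le> disc_sup r \<omega> + ennreal c"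
proof (cases "\<tau> \<omega>")
  case (real T)
  have "\<bar>exp (- r * T) * g (X T \<omega>)\<bar> \<le> exp (- r * T) * (exp (X T \<omega>) + c)"
    using g[of "X T \<omega>"] by (simp add: abs_mult)
  also have "\<dots> \<le> exp (- r * T + X T \<omega>) + c"
    using real r c by (simp add: distrib_left exp_add[symmetric] mult_left_le_one_le)
  finally have "ennreal \<bar>exp (- r * T) * g (X T \<omega>)\<bar> \<le> ennreal (exp (- r * T + X T \<omega>)) + ennreal c"
    using c by (simp add: ennreal_leI flip: ennreal_plus)
  also have "\<dots> \<le> disc_sup r \<omega> + ennreal c"
    by (intro add_right_mono disc_sup_upper \<omega> real)
  finally show ?thesis using real by (simp add: disc_pay_def)
qed (simp add: disc_pay_def)

lemma stopped_value_tendsto: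
  assumes \<omega>: "\<omega> \<in> space M" and f: "continuous_on UNIV f"
  shows "(\<lambda>k. stopped_value (\<lambda>n \<omega>. ennreal (exp (- r * dyadic k n) * f (X (dyadic k n) \<omega>)))
             (\<lambda>n. {\<omega> \<in> space M. \<tau> \<omega> \<le> ennreal (dyadic k n)}) \<omega>) \<longlonglongrightarrow> ennreal (disc_pay r f X \<tau> \<omega>)"
proof (cases "\<tau> \<omega>")
  case (real T)
  have "\<omega> \<in> {\<omega> \<in> space M. \<tau> \<omega> \<le> ennreal (dyadic k n)} \<longleftrightarrow> dyadic_ceil k T \<le> n" for k n
    using real \<omega> by (simp add: le_dyadic_iff[symmetric])
  from mem_disjointed_iff_Least[of \<omega> "\<lambda>n. {\<omega> \<in> space M. \<tau> \<omega> \<le> ennreal (dyadic _ n)}", OF this]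
  have "stopped_value (\<lambda>n \<omega>. ennreal (exp (- r * dyadic k n) * f (X (dyadic k n) \<omega>)))
             (\<lambda>n. {\<omega> \<in> space M. \<tau> \<omega> \<le> ennreal (dyadic k n)}) \<omega>
     = ennreal (exp (- r * dyadic k (dyadic_ceil k T)) * f (X (dyadic k (dyadic_ceil k T)) \<omega>))" for k
    by (rule stopped_value_eq[OF iffD2]) simp
  moreover have "(\<lambda>k. dyadic k (dyadic_ceil k T)) \<longlonglongrightarrow> T" by (intro dyadic_ceil_tendsto real)
  moreover have "(\<lambda>k. X (dyadic k (dyadic_ceil k T)) \<omega>) \<longlonglongrightarrow> X T \<omega>"
    by (rule continuous_on_tendsto_compose[OF X_continuous[OF \<omega>] calculation(2)]) (use real in auto)
  moreover have "isCont f (X T \<omega>)" using f by (simp add: continuous_on_eq_continuous_at)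
  ultimately have "(\<lambda>k. stopped_value (\<lambda>n \<omega>. ennreal (exp (- r * dyadic k n) * f (X (dyadic k n) \<omega>)))
             (\<lambda>n. {\<omega> \<in> space M. \<tau> \<omega> \<le> ennreal (dyadic k n)}) \<omega>) \<longlonglongrightarrow> ennreal (exp (- r * T) * f (X T \<omega>))"
    by (auto intro!: tendsto_intros isCont_tendsto_compose[of _ f])
  then show ?thesis using real by (simp add: disc_pay_def)
next
  case top
  have "stopped_value (\<lambda>n \<omega>. ennreal (exp (- r * dyadic k n) * f (X (dyadic k n) \<omega>)))
             (\<lambda>n. {\<omega> \<in> space M. \<tau> \<omega> \<le> ennreal (dyadic k n)}) \<omega> = 0" for k
    by (rule stopped_value_zero) (simp add: top top_unique)
  then show ?thesis using top by (simp add: disc_pay_def)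
qed

text \<open>Both times are rounded up on the same grid and stay ordered there. The stopped values
  are at most \<open>disc_sup\<close> plus a constant, so the discrete inequality passes to the
  limit by dominated convergence.\<close>

lemma optional_sampling:
  assumes r: "r \<ge> 0" and f: "continuous_on UNIV f" "\<And>y. f y \<ge> 0" "ou_excessive \<mu> \<sigma> \<theta> r f"
    and bound: "\<And>y. f y \<le> exp y + c" "c \<ge> 0"
    and S: "(\<integral>\<^sup>+\<omega>. disc_sup r \<omega> \<partial>M) < \<infinity>"
    and st: "is_stopping_time M B \<nu>" "is_stopping_time M B \<tau>" and le: "\<And>\<omega>. \<omega> \<in> space M \<Longrightarrow> \<nu> \<omega> \<le> \<tau> \<omega>"
  shows "(\<integral>\<^sup>+\<omega>. ennreal (disc_pay r f X \<tau> \<omega>) \<partial>M) \<le> (\<integral>\<^sup>+\<omega>. ennreal (disc_pay r f X \<nu> \<omega>) \<partial>M)"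
proof -
  have fm[measurable]: "f \<in> borel_measurable borel" using f(1) by (rule borel_measurable_continuous_onI)
  define Y where "Y k n \<omega> = ennreal (exp (- r * dyadic k n) * f (X (dyadic k n) \<omega>))" for k n \<omega>
  define Q where "Q \<tau> k n = {\<omega> \<in> space M. \<tau> \<omega> \<le> ennreal (dyadic k n)}" for \<tau> :: "'a \<Rightarrow> ennreal" and k n
  have Q: "Q \<tau> k n \<in> sets (nat_filtration M B (dyadic k n))" if "is_stopping_time M B \<tau>" for \<tau> k n
    using that unfolding Q_def is_stopping_time_def by simp
  have Qm: "disjointed (Q \<tau> k) n \<in> events" if "is_stopping_time M B \<tau>" for \<tau> k n
    unfolding disjointed_def using Q[OF that] nat_filtration_subset by (intro sets.Diff sets.finite_UN) blast+
  have Ym[measurable]: "Y k n \<in> borel_measurable M" for k n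
    unfolding Y_def[abs_def] using X_measurable[OF dyadic_nonneg[of k n]] by measurable
  have svm: "stopped_value (Y k) (Q \<tau> k) \<in> borel_measurable M" if "is_stopping_time M B \<tau>" for \<tau> k
    using Qm[OF that] unfolding stopped_value_def[abs_def] by measurable
  have lim: "(\<lambda>k. stopped_value (Y k) (Q \<tau> k) \<omega>) \<longlonglongrightarrow> ennreal (disc_pay r f X \<tau> \<omega>)" if "\<omega> \<in> space M" for \<tau> \<omega>
    using stopped_value_tendsto[OF that f(1), of r \<tau>] unfolding Y_def Q_def .
  have dom: "stopped_value (Y k) (Q \<tau> k) \<omega> \<le> disc_sup r \<omega> + ennreal c" if \<omega>: "\<omega> \<in> space M" for k \<tau> \<omega>
  proof (rule stopped_value_cases[of \<omega> "Q \<tau> k" "Y k"])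
    fix n assume "stopped_value (Y k) (Q \<tau> k) \<omega> = Y k n \<omega>"
    moreover have "Y k n \<omega> \<le> disc_sup r \<omega> + ennreal c"
      using disc_pay_le_sup[OF \<omega>, of f c r "\<lambda>_. ennreal (dyadic k n)"] bound f(2) r
      by (simp add: disc_pay_def Y_def)
    ultimately show ?thesis by simp
  qed simp
  have Sc: "(\<integral>\<^sup>+\<omega>. disc_sup r \<omega> + ennreal c \<partial>M) < \<infinity>"
    using S by (subst nn_integral_add) (auto simp: emeasure_space_1)
  have conv: "(\<lambda>k. \<integral>\<^sup>+\<omega>. stopped_value (Y k) (Q \<tau> k) \<omega> \<partial>M) \<longlonglongrightarrow> (\<integral>\<^sup>+\<omega>. ennreal (disc_pay r f X \<tau> \<omega>) \<partial>M)"
    if "is_stopping_time M B \<tau>" for \<tau>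
    using disc_pay_measurable[OF that f(1), of r] svm[OF that] lim dom Sc
    by (intro nn_integral_dominated_convergence[where w="\<lambda>\<omega>. disc_sup r \<omega> + ennreal c"]) auto
  show ?thesis
  proof (rule LIMSEQ_le[OF conv[OF st(2)] conv[OF st(1)]], intro exI allI impI)
    fix k
    interpret Y: discrete_supermartingale M "\<lambda>n. nat_filtration M B (dyadic k n)" "Y k"
      unfolding Y_def[abs_def] by (rule supermartingale_of_excessive) (use f in auto)
    show "(\<integral>\<^sup>+\<omega>. stopped_value (Y k) (Q \<tau> k) \<omega> \<partial>M) \<le> (\<integral>\<^sup>+\<omega>. stopped_value (Y k) (Q \<nu> k) \<omega> \<partial>M)"
      by (rule Y.optional_sampling[OF Q[OF st(1)] Q[OF st(2)]]) (use le in \<open>auto simp: Q_def intro: order.trans\<close>)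
  qed
qed

end

section \<open>The value function\<close>

lemma ratio_mono:
  fixes u v :: "real \<Rightarrow> real"
  assumes "p \<le> q" and u: "\<And>x. (u has_real_derivative u1 x) (at x)" and v: "\<And>x. (v has_real_derivative v1 x) (at x)"
    and pos: "\<And>x. v x > 0" and w: "\<And>x. p \<le> x \<Longrightarrow> x \<le> q \<Longrightarrow> u1 x * v x - u x * v1 x \<ge> 0"
  shows "u p / v p \<le> u q / v q"
proof (rule DERIV_nonneg_imp_nondecreasing[OF \<open>p \<le> q\<close>])
  fix x assume x: "p \<le> x" "x \<le> q"
  have "((\<lambda>x. u x / v x) has_real_derivative (u1 x * v x - u x * v1 x) / (v x * v x)) (at x)"
    using pos[of x] by (intro DERIV_divide u v) auto
  then show "\<exists>y. ((\<lambda>x. u x / v x) has_real_derivative y) (at x) \<and> 0 \<le> y"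
    using w[OF x] pos[of x] by (intro exI[of _ "(u1 x * v x - u x * v1 x) / (v x * v x)"]) auto
qed

lemma ratio_antimono:
  fixes u v :: "real \<Rightarrow> real"
  assumes "p \<le> q" and u: "\<And>x. (u has_real_derivative u1 x) (at x)" and v: "\<And>x. (v has_real_derivative v1 x) (at x)"
    and pos: "\<And>x. v x > 0" and w: "\<And>x. p \<le> x \<Longrightarrow> x \<le> q \<Longrightarrow> u1 x * v x - u x * v1 x \<le> 0"
  shows "u q / v q \<le> u p / v p"
proof -
  have "- u p / v p \<le> - u q / v q"
  proof (rule ratio_mono[OF \<open>p \<le> q\<close> _ v pos])
    show "((\<lambda>x. - u x) has_real_derivative - u1 x) (at x)" for x using u by (rule DERIV_minus)
  qed (use w in fastforce)
  then show ?thesis by simp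
qed

section \<open>Fundamental solutions and Wronskians\<close>

locale ou_parameters =
  fixes \<mu> \<sigma> \<theta> r :: real
  assumes \<mu>: "\<mu> > 0" and \<sigma>: "\<sigma> > 0" and r: "r > 0"
begin

text \<open>The stationary variance of the process is \<sigma>^2 / (2 \<mu>); multiplication by
  \<kappa> normalises it to 1.\<close>

definition "\<kappa> = sqrt (2 * \<mu> / \<sigma>\<^sup>2)"
definition "F x = hermite_int (r / \<mu> - 1) (\<kappa> * (x - \<theta>))"
definition "F1 x = \<kappa> * hermite_int (r / \<mu>) (\<kappa> * (x - \<theta>))"
definition "F2 x = \<kappa>\<^sup>2 * hermite_int (r / \<mu> + 1) (\<kappa> * (x - \<theta>))"
definition "\<phi> x = hermite_int (r / \<mu> - 1) (- (\<kappa> * (x - \<theta>)))"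
definition "\<phi>1 x = - \<kappa> * hermite_int (r / \<mu>) (- (\<kappa> * (x - \<theta>)))"

lemma F_OU_eq: "F_OU \<mu> \<theta> \<sigma> r = F"
  by (simp add: fun_eq_iff F_OU_def F_def hermite_int_def \<kappa>_def mult.assoc)

lemma \<kappa>: "\<kappa> > 0" "\<kappa>\<^sup>2 = 2 * \<mu> / \<sigma>\<^sup>2"
  using \<mu> \<sigma> by (auto simp: \<kappa>_def)

lemma exponents: "r / \<mu> - 1 > -1" "r / \<mu> > -1" "r / \<mu> + 1 > -1"
proof -
  have "r / \<mu> > 0" using \<mu> r by simp
  then show "r / \<mu> - 1 > -1" "r / \<mu> > -1" "r / \<mu> + 1 > -1" by linarith+
qed

lemma F_pos: "F x > 0" and F1_pos: "F1 x > 0" and \<phi>_pos: "\<phi> x > 0" and \<phi>1_neg: "\<phi>1 x < 0"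
  using \<kappa> hermite_int_pos[OF exponents(1)] hermite_int_pos[OF exponents(2)]
  by (auto simp: F_def F1_def \<phi>_def \<phi>1_def)

lemma F_deriv: "(F has_real_derivative F1 x) (at x)"
  unfolding F_def[abs_def] F1_def
  by (rule DERIV_cong[OF DERIV_chain2[OF hermite_int_deriv[OF exponents(1)]]]) (auto intro!: derivative_eq_intros)

lemma F1_deriv: "(F1 has_real_derivative F2 x) (at x)"
  unfolding F1_def[abs_def] F2_def
  by (rule DERIV_cong[OF DERIV_cmult[OF DERIV_chain2[OF hermite_int_deriv[OF exponents(2)]]]])
     (auto intro!: derivative_eq_intros simp: power2_eq_square)

lemma \<phi>_deriv: "(\<phi> has_real_derivative \<phi>1 x) (at x)"
  unfolding \<phi>_def[abs_def] \<phi>1_def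
  by (rule DERIV_cong[OF DERIV_chain2[OF hermite_int_deriv[OF exponents(1)]]]) (auto intro!: derivative_eq_intros)

lemma \<phi>1_deriv: "(\<phi>1 has_real_derivative \<kappa>\<^sup>2 * hermite_int (r / \<mu> + 1) (- (\<kappa> * (x - \<theta>)))) (at x)"
  unfolding \<phi>1_def[abs_def]
  by (rule DERIV_cong[OF DERIV_cmult[OF DERIV_chain2[OF hermite_int_deriv[OF exponents(2)]]]])
     (auto intro!: derivative_eq_intros simp: power2_eq_square)

text \<open>The recurrence at p = r / \<mu> - 1; the value of \<kappa> makes \<mu> appear as the
  common factor.\<close>

lemma ode_aux:
  "\<sigma>\<^sup>2 / 2 * (\<kappa>\<^sup>2 * hermite_int (r / \<mu> + 1) z) = \<mu> * z * hermite_int (r / \<mu>) z + r * hermite_int (r / \<mu> - 1) z"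
proof -
  have "hermite_int (r / \<mu> + 1) z = z * hermite_int (r / \<mu>) z + r / \<mu> * hermite_int (r / \<mu> - 1) z"
    using hermite_int_recurrence[OF exponents(1), of z] by (simp add: add.commute)
  moreover have "\<sigma>\<^sup>2 / 2 * (\<kappa>\<^sup>2 * H) = \<mu> * H" for H using \<kappa>(2) \<sigma> by simp
  ultimately have "\<sigma>\<^sup>2 / 2 * (\<kappa>\<^sup>2 * hermite_int (r / \<mu> + 1) z)
      = \<mu> * (z * hermite_int (r / \<mu>) z + r / \<mu> * hermite_int (r / \<mu> - 1) z)" by metis
  then show ?thesis using \<mu> by (simp add: distrib_left)
qed

lemma F_ode: "\<sigma>\<^sup>2 / 2 * F2 x + \<mu> * (\<theta> - x) * F1 x - r * F x = 0"
  unfolding F_def F1_def F2_def ode_aux by (simp add: algebra_simps)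

lemma \<phi>_ode: "\<sigma>\<^sup>2 / 2 * (\<kappa>\<^sup>2 * hermite_int (r / \<mu> + 1) (- (\<kappa> * (x - \<theta>)))) + \<mu> * (\<theta> - x) * \<phi>1 x - r * \<phi> x = 0"
  unfolding \<phi>_def \<phi>1_def ode_aux by (simp add: algebra_simps)

text \<open>\<open>speed\<close> is, up to a constant, the density of the speed measure; it turns the Wronskian with
  \<open>F\<close> into an antiderivative of the generator.\<close>

definition "speed x = exp (- (\<mu> / \<sigma>\<^sup>2) * (x - \<theta>)\<^sup>2)"

lemma speed_pos: "speed x > 0" by (simp add: speed_def)

text \<open>The equations for \<open>u\<close> and \<open>F\<close> eliminate both second
  derivatives. The drift terms then cancel against the derivative of \<open>speed\<close>, and the
  terms in \<open>r\<close> cancel each other.\<close>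

lemma wronskian_deriv:
  assumes u: "(u has_real_derivative u1 x) (at x)" "(u1 has_real_derivative u2) (at x)"
    and g: "\<sigma>\<^sup>2 / 2 * u2 + \<mu> * (\<theta> - x) * u1 x - r * u x = g"
  shows "((\<lambda>x. speed x * (u1 x * F x - u x * F1 x)) has_real_derivative speed x * (2 / \<sigma>\<^sup>2) * g * F x) (at x)"
proof -
  have s: "(speed has_real_derivative speed x * (2 * (\<mu> / \<sigma>\<^sup>2) * (\<theta> - x))) (at x)"
  proof -
    have "((\<lambda>x. exp (- k * (x - \<theta>)\<^sup>2)) has_real_derivative exp (- k * (x - \<theta>)\<^sup>2) * (2 * k * (\<theta> - x))) (at x)" for k
      by (auto intro!: derivative_eq_intros simp: algebra_simps)
    then show ?thesis unfolding speed_def[abs_def] .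
  qed
  have u2: "u2 = 2 / \<sigma>\<^sup>2 * (g - \<mu> * (\<theta> - x) * u1 x + r * u x)" using g \<sigma> by (simp add: field_simps)
  have F2: "F2 x = 2 / \<sigma>\<^sup>2 * (r * F x - \<mu> * (\<theta> - x) * F1 x)" using F_ode[of x] \<sigma> by (simp add: field_simps)
  have e: "S * (2 * (\<mu> / \<sigma>\<^sup>2) * T) * (a * f - b * f1) + (c * f + f1 * a - (a * f1 + d * b)) * S = S * (2 / \<sigma>\<^sup>2) * g * f"
    if "c = 2 / \<sigma>\<^sup>2 * (g - \<mu> * T * a + r * b)" "d = 2 / \<sigma>\<^sup>2 * (r * f - \<mu> * T * f1)" for S T a b c d f f1
    unfolding that using \<sigma> by (simp add: field_simps)
  show ?thesis
    by (rule DERIV_cong[OF DERIV_mult[OF s DERIV_diff[OF DERIV_mult[OF u(2) F_deriv] DERIV_mult[OF u(1) F1_deriv]]]])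
       (rule e[OF u2 F2])
qed

text \<open>\<open>f cb\<close> is the function \<open>f\<^sub>b\<close> of the paper and \<open>f (- cs)\<close> its analogue for the selling payoff:
  \<open>exp x * f d x\<close> is the generator minus \<open>r\<close> applied to \<open>exp x + d\<close>.\<close>

definition "f d x = (\<mu> * \<theta> + \<sigma>\<^sup>2 / 2 - r) - \<mu> * x - r * d * exp (- x)"
text \<open>The weighted Wronskian of exp + d and \<open>F\<close>, which has the sign of the
  derivative of (exp + d) / F.\<close>

definition "W d x = speed x * (exp x * F x - (exp x + d) * F1 x)"

definition "gain x = speed x * (2 / \<sigma>\<^sup>2) * exp x * F x"

lemma gain_pos: "gain x > 0"
  using speed_pos[of x] F_pos[of x] \<sigma> by (simp add: gain_def)

lemma W_deriv: "(W d has_real_derivative gain x * f d x) (at x)"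
proof -
  have g: "\<sigma>\<^sup>2 / 2 * exp x + \<mu> * (\<theta> - x) * exp x - r * (exp x + d) = exp x * f d x"
    by (simp add: f_def algebra_simps exp_minus)
  have "((\<lambda>x. speed x * (exp x * F x - (exp x + d) * F1 x)) has_real_derivative speed x * (2 / \<sigma>\<^sup>2) * (exp x * f d x) * F x) (at x)"
    by (rule wronskian_deriv[where u="\<lambda>x. exp x + d" and ?u1.0=exp, OF _ _ g]) (auto intro!: derivative_eq_intros)
  then show ?thesis unfolding W_def[abs_def] gain_def by (simp add: mult_ac)
qed

lemma W_mono:
  assumes pq: "p \<le> q" and f: "\<And>x. p \<le> x \<Longrightarrow> x \<le> q \<Longrightarrow> f d x \<ge> 0"
  shows "W d p \<le> W d q"
proof (rule DERIV_nonneg_imp_nondecreasing[OF pq])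
  fix x assume "p \<le> x" "x \<le> q"
  then have "gain x * f d x \<ge> 0" using f gain_pos[of x] by (simp add: zero_le_mult_iff)
  then show "\<exists>y. (W d has_real_derivative y) (at x) \<and> 0 \<le> y" using W_deriv by blast
qed

lemma W_antimono:
  assumes pq: "p \<le> q" and f: "\<And>x. p \<le> x \<Longrightarrow> x \<le> q \<Longrightarrow> f d x \<le> 0"
  shows "W d q \<le> W d p"
proof (rule DERIV_nonpos_imp_nonincreasing[OF pq])
  fix x assume "p \<le> x" "x \<le> q"
  then have "gain x * f d x \<le> 0" using f gain_pos[of x] by (simp add: mult_le_0_iff)
  then show "\<exists>y. (W d has_real_derivative y) (at x) \<and> y \<le> 0" using W_deriv by blast
qed

lemma W_strict_mono:
  assumes pq: "p < q" and f: "\<And>x. p \<le> x \<Longrightarrow> x \<le> q \<Longrightarrow> f d x > 0"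
  shows "W d p < W d q"
proof (rule DERIV_pos_imp_increasing[OF pq])
  fix x assume "p \<le> x" "x \<le> q"
  then have "gain x * f d x > 0" using f gain_pos[of x] by (simp add: zero_less_mult_iff)
  then show "\<exists>y. (W d has_real_derivative y) (at x) \<and> 0 < y" using W_deriv by blast
qed

lemma W_strict_antimono:
  assumes pq: "p < q" and f: "\<And>x. p \<le> x \<Longrightarrow> x \<le> q \<Longrightarrow> f d x < 0"
  shows "W d q < W d p"
proof (rule DERIV_neg_imp_decreasing[OF pq])
  fix x assume "p \<le> x" "x \<le> q"
  then have "gain x * f d x < 0" using f gain_pos[of x] by (simp add: mult_less_0_iff)
  then show "\<exists>y. (W d has_real_derivative y) (at x) \<and> y < 0" using W_deriv by blast
qed

lemma F_mono: "x \<le> y \<Longrightarrow> F x \<le> F y"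
  by (rule DERIV_nonneg_imp_nondecreasing, assumption) (meson F_deriv F1_pos less_imp_le)

lemma F2_nonneg: "F2 x \<ge> 0"
  unfolding F2_def using hermite_int_pos[OF exponents(3), of "\<kappa> * (x - \<theta>)"] by simp

lemma F1_mono: "x \<le> y \<Longrightarrow> F1 x \<le> F1 y"
  by (rule DERIV_nonneg_imp_nondecreasing, assumption) (meson F1_deriv F2_nonneg)

lemma \<phi>_antimono: "x \<le> y \<Longrightarrow> \<phi> y \<le> \<phi> x"
  by (rule DERIV_nonpos_imp_nonincreasing, assumption) (meson \<phi>_deriv \<phi>1_neg less_imp_le)

lemma speed_at_bot: "(speed \<longlongrightarrow> 0) at_bot"
proof -
  have c: "\<mu> / \<sigma>\<^sup>2 > 0" using \<mu> \<sigma> by simp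
  have "filterlim (\<lambda>x::real. x - \<theta>) at_bot at_bot"
    unfolding filterlim_at_bot
  proof
    fix Z show "\<forall>\<^sub>F x in at_bot. x - \<theta> \<le> Z"
      using eventually_le_at_bot[of "Z + \<theta>"] by eventually_elim simp
  qed
  then have "filterlim (\<lambda>x. (x - \<theta>)\<^sup>2) at_top at_bot"
    by (intro filterlim_pow_at_bot_even) auto
  then have "filterlim (\<lambda>x. (\<mu> / \<sigma>\<^sup>2) * (x - \<theta>)\<^sup>2) at_top at_bot"
    by (intro filterlim_tendsto_pos_mult_at_top[OF tendsto_const c])
  then have "filterlim (\<lambda>x. - ((\<mu> / \<sigma>\<^sup>2) * (x - \<theta>)\<^sup>2)) at_bot at_bot"
    by (simp add: filterlim_uminus_at_bot)
  then have "((\<lambda>x. exp (- ((\<mu> / \<sigma>\<^sup>2) * (x - \<theta>)\<^sup>2))) \<longlongrightarrow> 0) at_bot"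
    by (rule filterlim_compose[OF exp_at_bot])
  then show ?thesis unfolding speed_def[abs_def] by simp
qed

text \<open>The factors other than \<open>speed\<close> stay bounded near minus infinity. This fixes
  the constant of integration: the sign of \<open>f d\<close> on a left half line decides the sign
  of \<open>W d\<close> there.\<close>

lemma W_at_bot: "(W d \<longlongrightarrow> 0) at_bot"
proof (rule tendsto_0_le[OF speed_at_bot])
  show "\<forall>\<^sub>F x in at_bot. norm (W d x) \<le> norm (speed x) * (F \<theta> + (1 + \<bar>d\<bar>) * F1 \<theta>)"
    using eventually_le_at_bot[of "min 0 \<theta>"]
  proof eventually_elim
    case (elim x)
    have "\<bar>exp x * F x\<bar> \<le> 1 * F \<theta>"
      using elim F_pos[of x] F_mono[of x \<theta>] unfolding abs_mult by (intro mult_mono) auto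
    moreover have "\<bar>(exp x + d) * F1 x\<bar> \<le> (1 + \<bar>d\<bar>) * F1 \<theta>"
    proof -
      have "0 < exp x" "exp x \<le> 1" using elim by auto
      then have "\<bar>exp x + d\<bar> \<le> 1 + \<bar>d\<bar>" by linarith
      then show ?thesis using F1_pos[of x] F1_mono[of x \<theta>] elim unfolding abs_mult by (intro mult_mono) auto
    qed
    ultimately have "\<bar>exp x * F x - (exp x + d) * F1 x\<bar> \<le> F \<theta> + (1 + \<bar>d\<bar>) * F1 \<theta>" by linarith
    then show ?case using speed_pos[of x] by (simp add: W_def abs_mult)
  qed
qed

lemma W_nonneg_left:
  assumes "\<And>x. x \<le> y \<Longrightarrow> f d x \<ge> 0"
  shows "W d y \<ge> 0"
proof (rule tendsto_upperbound[OF W_at_bot])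
  show "\<forall>\<^sub>F x in at_bot. W d x \<le> W d y"
    using eventually_le_at_bot[of y] by eventually_elim (rule W_mono, use assms in auto)
qed simp

lemma W_nonpos_left:
  assumes "\<And>x. x \<le> y \<Longrightarrow> f d x \<le> 0"
  shows "W d y \<le> 0"
proof (rule tendsto_lowerbound[OF W_at_bot])
  show "\<forall>\<^sub>F x in at_bot. W d y \<le> W d x"
    using eventually_le_at_bot[of y] by eventually_elim (rule W_antimono, use assms in auto)
qed simp

lemma W_pos_left:
  assumes f: "\<And>x. x \<le> y \<Longrightarrow> f d x > 0"
  shows "W d y > 0"
proof -
  have "W d (y - 1) \<ge> 0" by (rule W_nonneg_left, rule less_imp_le, rule f) simp
  moreover have "W d (y - 1) < W d y" by (rule W_strict_mono) (use f in auto)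
  ultimately show ?thesis by simp
qed

lemma W_neg_left:
  assumes f: "\<And>x. x \<le> y \<Longrightarrow> f d x < 0"
  shows "W d y < 0"
proof -
  have "W d (y - 1) \<le> 0" by (rule W_nonpos_left, rule less_imp_le, rule f) simp
  moreover have "W d y < W d (y - 1)" by (rule W_strict_antimono) (use f in auto)
  ultimately show ?thesis by simp
qed

lemma payoff_ratio_mono:
  assumes "p \<le> q" "\<And>x. p \<le> x \<Longrightarrow> x \<le> q \<Longrightarrow> W d x \<ge> 0"
  shows "(exp p + d) / F p \<le> (exp q + d) / F q"
proof (rule ratio_mono[OF assms(1) _ F_deriv F_pos])
  show "((\<lambda>x. exp x + d) has_real_derivative exp x) (at x)" for x by (auto intro!: derivative_eq_intros)
  show "exp x * F x - (exp x + d) * F1 x \<ge> 0" if "p \<le> x" "x \<le> q" for x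
    using assms(2)[OF that] speed_pos[of x] by (simp add: W_def zero_le_mult_iff)
qed

lemma payoff_ratio_antimono:
  assumes "p \<le> q" "\<And>x. p \<le> x \<Longrightarrow> x \<le> q \<Longrightarrow> W d x \<le> 0"
  shows "(exp q + d) / F q \<le> (exp p + d) / F p"
proof (rule ratio_antimono[OF assms(1) _ F_deriv F_pos])
  show "((\<lambda>x. exp x + d) has_real_derivative exp x) (at x)" for x by (auto intro!: derivative_eq_intros)
  show "exp x * F x - (exp x + d) * F1 x \<le> 0" if "p \<le> x" "x \<le> q" for x
    using assms(2)[OF that] speed_pos[of x] by (simp add: W_def mult_le_0_iff)
qed

lemma W_continuous: "continuous_on A (W d)"
  using W_deriv by (meson DERIV_isCont continuous_at_imp_continuous_on)

lemma f_antimono: "d \<le> 0 \<Longrightarrow> x \<le> y \<Longrightarrow> f d y \<le> f d x"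
proof -
  assume "d \<le> 0" "x \<le> y"
  then have "\<mu> * x \<le> \<mu> * y" "r * d * exp (- x) \<le> r * d * exp (- y)"
    using \<mu> r by (auto intro!: mult_left_mono_neg simp: mult_nonneg_nonpos)
  then show ?thesis by (simp add: f_def)
qed

end

section \<open>Harmonicity for the kernel and a criterion for excessivity\<close>

context ou_parameters
begin

text \<open>In the coordinate \<kappa> (y - \<theta>) the kernel takes the Mehler form with c =
  exp(- \<mu> h) that \<open>hermite_int_gaussian\<close> treats.\<close>

lemma scaled_shift:
  assumes h: "h > 0"
  shows "\<kappa> * (\<theta> + exp (- (\<mu> * h)) * (y - \<theta>) + \<sigma> * sqrt ((1 - exp (- (2 * \<mu> * h))) / (2 * \<mu>)) * w - \<theta>)
     = exp (- (\<mu> * h)) * (\<kappa> * (y - \<theta>)) + sqrt (1 - (exp (- (\<mu> * h)))\<^sup>2) * w"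
proof -
  have e: "(exp (- (\<mu> * h)))\<^sup>2 = exp (- (2 * \<mu> * h))" by (simp add: exp_double[symmetric] mult.assoc)
  have "\<kappa> * \<sigma> = sqrt (2 * \<mu>)"
    using \<sigma> by (simp add: \<kappa>_def real_sqrt_divide)
  then have "\<kappa> * (\<sigma> * sqrt ((1 - exp (- (2 * \<mu> * h))) / (2 * \<mu>))) = sqrt (1 - exp (- (2 * \<mu> * h)))"
    using \<mu> by (simp add: mult.assoc[symmetric] real_sqrt_divide)
  then have "\<kappa> * (\<sigma> * sqrt ((1 - exp (- (2 * \<mu> * h))) / (2 * \<mu>)) * w) = sqrt (1 - exp (- (2 * \<mu> * h))) * w"
    by (simp add: mult.assoc[symmetric])
  then show ?thesis unfolding e by (simp add: algebra_simps)
qed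

lemma exp_powr_ratio: "exp (- (\<mu> * h)) powr (- (r / \<mu> - 1 + 1)) = exp (r * h)"
  using \<mu> by (simp add: powr_def)

lemma noise_scale:
  assumes "h > 0"
  shows "(sqrt (1 - (exp (- (\<mu> * h)))\<^sup>2))\<^sup>2 = 1 - (exp (- (\<mu> * h)))\<^sup>2"
  using assms \<mu> by (simp add: power_le_one)

lemma F_transition:
  assumes h: "h > 0"
  shows "ou_transition \<mu> \<sigma> \<theta> h (\<lambda>y. ennreal (F y)) y = ennreal (exp (r * h) * F y)"
  unfolding ou_transition_def F_def scaled_shift[OF h]
  using hermite_int_gaussian[OF exponents(1) exp_gt_zero noise_scale[OF h]]
  unfolding exp_powr_ratio by simp

text \<open>Reflection reverses the sign of the noise coefficient, and the Gaussian computation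
  depends on its square only.\<close>

lemma \<phi>_transition:
  assumes h: "h > 0"
  shows "ou_transition \<mu> \<sigma> \<theta> h (\<lambda>y. ennreal (\<phi> y)) y = ennreal (exp (r * h) * \<phi> y)"
proof -
  let ?c = "exp (- (\<mu> * h))"
  have m: "- (?c * a + sqrt (1 - ?c\<^sup>2) * w) = ?c * (- a) + (- sqrt (1 - ?c\<^sup>2)) * w" for a w by simp
  have s: "(- sqrt (1 - ?c\<^sup>2))\<^sup>2 = 1 - ?c\<^sup>2" using noise_scale[OF h] by simp
  show ?thesis
    unfolding ou_transition_def \<phi>_def scaled_shift[OF h] m
    using hermite_int_gaussian[OF exponents(1) exp_gt_zero s, of "- (\<kappa> * (y - \<theta>))"]
    unfolding exp_powr_ratio .
qed

lemma F_continuous: "continuous_on A F"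
  using F_deriv by (meson DERIV_isCont continuous_at_imp_continuous_on)

lemma \<phi>_continuous: "continuous_on A \<phi>"
  using \<phi>_deriv by (meson DERIV_isCont continuous_at_imp_continuous_on)

text \<open>This replaces Ito's formula for the value function, whose second derivative jumps at \<open>b\<close>.\<close>

lemma excessive_of_tangents:
  assumes v: "v \<in> borel_measurable borel" "\<And>y. v y \<ge> 0"
    and tangent: "\<And>y. \<exists>\<alpha> \<beta>. v y = \<alpha> * F y + \<beta> * \<phi> y \<and> (\<forall>x. v x \<le> \<alpha> * F x + \<beta> * \<phi> x)"
  shows "ou_excessive \<mu> \<sigma> \<theta> r v"
  unfolding ou_excessive_def
proof (intro allI impI)
  fix h y :: real assume h: "h > 0"
  obtain \<alpha> \<beta> where ab: "v y = \<alpha> * F y + \<beta> * \<phi> y" "\<And>x. v x \<le> \<alpha> * F x + \<beta> * \<phi> x" using tangent[of y] by auto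
  define X where "X w = \<theta> + exp (- (\<mu> * h)) * (y - \<theta>) + \<sigma> * sqrt ((1 - exp (- (2 * \<mu> * h))) / (2 * \<mu>)) * w" for w
  have [measurable]: "F \<in> borel_measurable borel" "\<phi> \<in> borel_measurable borel"
    by (intro borel_measurable_continuous_onI F_continuous \<phi>_continuous)+
  have Xm[measurable]: "X \<in> borel_measurable borel" unfolding X_def[abs_def] by measurable
  have harm: "has_bochner_integral std_normal_distribution (\<lambda>w. u (X w)) (exp (r * h) * u y)"
    if "u = F \<or> u = \<phi>" for u
  proof (rule has_bochner_integral_nn_integral)
    show "(\<integral>\<^sup>+w. ennreal (u (X w)) \<partial>std_normal_distribution) = ennreal (exp (r * h) * u y)"
      using that F_transition[OF h, of y] \<phi>_transition[OF h, of y] unfolding ou_transition_def X_def by auto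
    show "AE w in std_normal_distribution. 0 \<le> u (X w)"
      using that less_imp_le[OF F_pos] less_imp_le[OF \<phi>_pos] by auto
    show "0 \<le> exp (r * h) * u y" using that less_imp_le[OF F_pos[of y]] less_imp_le[OF \<phi>_pos[of y]] by auto
    show "(\<lambda>w. u (X w)) \<in> borel_measurable std_normal_distribution" using that by auto
  qed
  \<comment> \<open>The coefficients may be negative, so the combination is integrated as a real
    function; it is nonnegative since it lies above \<open>v\<close>.\<close>
  have comb: "has_bochner_integral std_normal_distribution (\<lambda>w. \<alpha> * F (X w) + \<beta> * \<phi> (X w))
     (\<alpha> * (exp (r * h) * F y) + \<beta> * (exp (r * h) * \<phi> y))"
    by (intro has_bochner_integral_add has_bochner_integral_mult_right harm) auto
  have "ou_transition \<mu> \<sigma> \<theta> h (\<lambda>y. ennreal (v y)) y = (\<integral>\<^sup>+w. ennreal (v (X w)) \<partial>std_normal_distribution)"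
    unfolding ou_transition_def X_def ..
  also have "\<dots> \<le> (\<integral>\<^sup>+w. ennreal (\<alpha> * F (X w) + \<beta> * \<phi> (X w)) \<partial>std_normal_distribution)"
    using ab(2) by (intro nn_integral_mono ennreal_leI)
  also have "\<dots> = ennreal (\<alpha> * (exp (r * h) * F y) + \<beta> * (exp (r * h) * \<phi> y))"
    using comb order.trans[OF v(2) ab(2)]
    by (subst nn_integral_eq_integral) (auto simp: has_bochner_integral_iff)
  also have "\<alpha> * (exp (r * h) * F y) + \<beta> * (exp (r * h) * \<phi> y) = exp (r * h) * v y"
    unfolding ab(1) by (simp add: algebra_simps)
  finally show "ou_transition \<mu> \<sigma> \<theta> h (\<lambda>y. ennreal (v y)) y \<le> ennreal (exp (r * h) * v y)" .
qed

end

section \<open>The candidate value of the long position\<close>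

locale switching = ou_parameters +
  fixes cs b :: real
  assumes cs: "cs > 0" and b: "exp b * F b = (exp b - cs) * F1 b"
begin

text \<open>The equation for \<open>b\<close> is the first order condition for (exp - cs) / F, and
  \<open>K\<close> is the critical value.\<close>

definition "K = (exp b - cs) / F b"
definition "V x = (if x < b then K * F x else exp x - cs)"

lemma exp_b_gt: "exp b - cs > 0"
proof -
  have "(exp b - cs) * F1 b > 0" using F_pos[of b] by (simp add: b[symmetric])
  then show ?thesis using F1_pos[of b] by (simp add: zero_less_mult_iff)
qed

lemma K_pos: "K > 0" using exp_b_gt F_pos by (simp add: K_def)

lemma W_b: "W (- cs) b = 0" using b by (simp add: W_def)

text \<open>Since \<open>f (- cs)\<close> is nonincreasing, a positive value at \<open>b\<close>
  would make it positive on the whole half line up to \<open>b\<close>. Then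
  \<open>W (- cs) b\<close> would be positive, against the equation for \<open>b\<close>.\<close>

lemma f_nonpos_right: "b \<le> x \<Longrightarrow> f (- cs) x \<le> 0"
proof -
  assume x: "b \<le> x"
  have "f (- cs) b \<le> 0"
  proof (rule ccontr)
    assume "\<not> f (- cs) b \<le> 0"
    then have "f (- cs) y > 0" if "y \<le> b" for y using f_antimono[of "- cs" y b] that cs by simp
    then have "W (- cs) b > 0" by (rule W_pos_left)
    then show False using W_b by simp
  qed
  then show ?thesis using f_antimono[of "- cs" b x] x cs by simp
qed

lemma W_nonpos_right: "b \<le> x \<Longrightarrow> W (- cs) x \<le> 0"
  using W_antimono[of b x "- cs"] f_nonpos_right W_b by simp

text \<open>Either \<open>f (- cs)\<close> is nonnegative up to \<open>x\<close> and
  \<open>W (- cs)\<close> rises from its limit 0 at minus infinity, or it is nonpositive from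
  \<open>x\<close> on and \<open>W (- cs)\<close> falls towards its zero at
  \<open>b\<close>.\<close>

lemma W_nonneg_before: "x \<le> b \<Longrightarrow> W (- cs) x \<ge> 0"
proof -
  assume x: "x \<le> b"
  show ?thesis
  proof (cases "f (- cs) x \<ge> 0")
    case True
    then have "f (- cs) y \<ge> 0" if "y \<le> x" for y using f_antimono[of "- cs" y x] that cs by simp
    then show ?thesis by (rule W_nonneg_left)
  next
    case False
    then have "f (- cs) y \<le> 0" if "x \<le> y" for y using f_antimono[of "- cs" x y] that cs by simp
    then have "W (- cs) b \<le> W (- cs) x" by (intro W_antimono x) auto
    then show ?thesis using W_b by simp
  qed
qed

lemma sell_payoff_le: "exp x - cs \<le> K * F x"
proof -
  have "(exp x - cs) / F x \<le> K"
  proof (cases "x \<le> b")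
    case True
    then show ?thesis using payoff_ratio_mono[of x b "- cs"] W_nonneg_before by (simp add: K_def)
  next
    case False
    then show ?thesis using payoff_ratio_antimono[of b x "- cs"] W_nonpos_right by (simp add: K_def)
  qed
  then show ?thesis using F_pos[of x] by (simp add: divide_le_eq)
qed

lemma V_ge_payoff: "exp x - cs \<le> V x"
  using sell_payoff_le by (simp add: V_def)

lemma V_le_KF: "V x \<le> K * F x"
  using sell_payoff_le by (simp add: V_def)

lemma V_pos: "V x > 0"
proof (cases "x < b")
  case True then show ?thesis using K_pos F_pos by (simp add: V_def)
next
  case False
  then have "exp b \<le> exp x" by simp
  then have "cs < exp x" using exp_b_gt by linarith
  then show ?thesis using False by (simp add: V_def)
qed

lemma KF_b: "K * F b = exp b - cs" using F_pos[of b] by (simp add: K_def)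

lemma V_le_exp: "V x \<le> exp x + exp b"
proof (cases "x < b")
  case True
  then have "K * F x \<le> K * F b" using K_pos F_mono by simp
  then show ?thesis using True cs KF_b by (simp add: V_def add_increasing)
next
  case False
  moreover have "- cs \<le> exp b" using cs exp_gt_zero[of b] by linarith
  ultimately show ?thesis by (simp add: V_def)
qed

lemma V_continuous: "continuous_on UNIV V"
proof -
  have "continuous_on ({..b} \<union> {b..}) (\<lambda>x. if x \<le> b then K * F x else exp x - cs)"
    by (rule continuous_on_cases)
       (auto intro!: continuous_intros F_continuous simp: KF_b dest: order_antisym)
  moreover have "{..b} \<union> {b..} = UNIV" by auto
  moreover have "(\<lambda>x. if x \<le> b then K * F x else exp x - cs) = V"
    using KF_b by (auto simp: V_def fun_eq_iff)
  ultimately show ?thesis by (simp only:)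
qed

text \<open>For \<open>y \<ge> b\<close> the combination with the value and slope of the payoff at \<open>y\<close> is used. Its excess
  \<open>D\<close> over the payoff is subharmonic to the right of \<open>b\<close>, which makes the Wronskian \<open>w\<close> of \<open>D\<close> and \<open>F\<close>
  change sign at \<open>y\<close>.\<close>

lemma V_tangent: "\<exists>\<alpha> \<beta>. V y = \<alpha> * F y + \<beta> * \<phi> y \<and> (\<forall>x. V x \<le> \<alpha> * F x + \<beta> * \<phi> x)"
proof (cases "y < b")
  case True
  then show ?thesis using V_le_KF by (intro exI[of _ K] exI[of _ 0]) (simp add: V_def)
next
  case False
  then have y: "b \<le> y" by simp
  define \<Delta> where "\<Delta> = F1 y * \<phi> y - F y * \<phi>1 y"
  have \<Delta>: "\<Delta> > 0"
    using mult_pos_pos[OF F1_pos \<phi>_pos] mult_pos_neg[OF F_pos \<phi>1_neg, of y y] unfolding \<Delta>_def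
    by (metis diff_gt_0_iff_gt less_trans)
  \<comment> \<open>Cramer's rule for the system prescribing the value exp y - cs and the slope exp
    y at \<open>y\<close>; \<Delta> is the Wronskian of \<open>F\<close> and \<phi>.\<close>
  define \<alpha> where "\<alpha> = (exp y * \<phi> y - (exp y - cs) * \<phi>1 y) / \<Delta>"
  define \<beta> where "\<beta> = (F1 y * (exp y - cs) - F y * exp y) / \<Delta>"
  \<comment> \<open>The sign of \<beta> is opposite to that of \<open>W (- cs) y\<close>. It is
    needed for the majorant to the left of \<open>b\<close>.\<close>
  have "exp y * F y - (exp y - cs) * F1 y \<le> 0"
    using W_nonpos_right[OF y] speed_pos[of y] by (simp add: W_def mult_le_0_iff)
  then have \<beta>: "\<beta> \<ge> 0" using \<Delta> by (simp add: \<beta>_def mult_ac)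
  have val: "\<alpha> * F y + \<beta> * \<phi> y = exp y - cs"
  proof -
    have "(\<alpha> * F y + \<beta> * \<phi> y) * \<Delta> = (exp y * \<phi> y - (exp y - cs) * \<phi>1 y) * F y + (F1 y * (exp y - cs) - F y * exp y) * \<phi> y"
      using \<Delta> by (simp add: \<alpha>_def \<beta>_def distrib_right)
    also have "\<dots> = (exp y - cs) * \<Delta>" unfolding \<Delta>_def by (simp add: algebra_simps)
    finally show ?thesis using \<Delta> by simp
  qed
  have der: "\<alpha> * F1 y + \<beta> * \<phi>1 y = exp y"
  proof -
    have "(\<alpha> * F1 y + \<beta> * \<phi>1 y) * \<Delta> = (exp y * \<phi> y - (exp y - cs) * \<phi>1 y) * F1 y + (F1 y * (exp y - cs) - F y * exp y) * \<phi>1 y"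
      using \<Delta> by (simp add: \<alpha>_def \<beta>_def distrib_right)
    also have "\<dots> = exp y * \<Delta>" unfolding \<Delta>_def by (simp add: algebra_simps)
    finally show ?thesis using \<Delta> by simp
  qed
  define D where "D x = \<alpha> * F x + \<beta> * \<phi> x - (exp x - cs)" for x
  define D1 where "D1 x = \<alpha> * F1 x + \<beta> * \<phi>1 x - exp x" for x
  define \<phi>2 where "\<phi>2 x = \<kappa>\<^sup>2 * hermite_int (r / \<mu> + 1) (- (\<kappa> * (x - \<theta>)))" for x
  have D_deriv: "(D has_real_derivative D1 x) (at x)" for x
    unfolding D_def[abs_def] D1_def by (auto intro!: derivative_eq_intros F_deriv \<phi>_deriv)
  have D1_deriv: "(D1 has_real_derivative (\<alpha> * F2 x + \<beta> * \<phi>2 x - exp x)) (at x)" for x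
    unfolding D1_def[abs_def] \<phi>2_def by (auto intro!: derivative_eq_intros F1_deriv \<phi>1_deriv)
  define w where "w x = speed x * (D1 x * F x - D x * F1 x)" for x
  have w_deriv: "(w has_real_derivative speed x * (2 / \<sigma>\<^sup>2) * (- (exp x * f (- cs) x)) * F x) (at x)" for x
    unfolding w_def[abs_def]
  proof (rule wronskian_deriv[OF D_deriv D1_deriv])
    have eF: "\<sigma>\<^sup>2 / 2 * F2 x + \<mu> * (\<theta> - x) * F1 x = r * F x" using F_ode[of x] by simp
    have e\<phi>: "\<sigma>\<^sup>2 / 2 * \<phi>2 x + \<mu> * (\<theta> - x) * \<phi>1 x = r * \<phi> x" using \<phi>_ode[of x] by (simp add: \<phi>2_def)
    have "\<sigma>\<^sup>2 / 2 * (\<alpha> * F2 x + \<beta> * \<phi>2 x - exp x) + \<mu> * (\<theta> - x) * D1 x - r * D x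
       = \<alpha> * (\<sigma>\<^sup>2 / 2 * F2 x + \<mu> * (\<theta> - x) * F1 x) + \<beta> * (\<sigma>\<^sup>2 / 2 * \<phi>2 x + \<mu> * (\<theta> - x) * \<phi>1 x)
         - r * (\<alpha> * F x + \<beta> * \<phi> x) - (\<sigma>\<^sup>2 / 2 * exp x + \<mu> * (\<theta> - x) * exp x - r * (exp x - cs))"
      unfolding D_def D1_def by (simp add: algebra_simps)
    also have "\<dots> = - (\<sigma>\<^sup>2 / 2 * exp x + \<mu> * (\<theta> - x) * exp x - r * (exp x - cs))"
      unfolding eF e\<phi> by (simp add: algebra_simps)
    also have "\<dots> = - (exp x * f (- cs) x)" by (simp add: f_def algebra_simps exp_minus)
    finally show "\<sigma>\<^sup>2 / 2 * (\<alpha> * F2 x + \<beta> * \<phi>2 x - exp x) + \<mu> * (\<theta> - x) * D1 x - r * D x = - (exp x * f (- cs) x)" .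
  qed
  have w_mono: "w p \<le> w q" if "b \<le> p" "p \<le> q" for p q
  proof (rule DERIV_nonneg_imp_nondecreasing[OF that(2)])
    fix x assume "p \<le> x" "x \<le> q"
    then have "f (- cs) x \<le> 0" using that f_nonpos_right by simp
    then have "0 \<le> speed x * (2 / \<sigma>\<^sup>2) * (- (exp x * f (- cs) x)) * F x"
      using speed_pos[of x] F_pos[of x] by (intro mult_nonneg_nonneg) (auto simp: mult_nonneg_nonpos less_imp_le)
    then show "\<exists>z. (w has_real_derivative z) (at x) \<and> 0 \<le> z" using w_deriv by blast
  qed
  have wy: "w y = 0" using val der by (simp add: w_def D_def D1_def)
  have Dy: "D y = 0" using val by (simp add: D_def)
  have right: "D x \<ge> 0" if x: "b \<le> x" for x
  proof (cases "x \<le> y")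
    case True
    have "D y / F y \<le> D x / F x"
    proof (rule ratio_antimono[OF True D_deriv F_deriv F_pos])
      fix t assume "x \<le> t" "t \<le> y"
      then have "w t \<le> 0" using w_mono[of t y] x wy by simp
      then show "D1 t * F t - D t * F1 t \<le> 0" using speed_pos[of t] by (simp add: w_def mult_le_0_iff)
    qed
    then show ?thesis using Dy F_pos[of x] by (simp add: zero_le_divide_iff)
  next
    case False
    then have yx: "y \<le> x" by simp
    have "D y / F y \<le> D x / F x"
    proof (rule ratio_mono[OF yx D_deriv F_deriv F_pos])
      fix t assume "y \<le> t" "t \<le> x"
      then have "w t \<ge> 0" using w_mono[of y t] y wy by simp
      then show "D1 t * F t - D t * F1 t \<ge> 0" using speed_pos[of t] by (simp add: w_def zero_le_mult_iff)
    qed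
    then show ?thesis using Dy F_pos[of x] by (simp add: zero_le_divide_iff)
  qed
  have "V x \<le> \<alpha> * F x + \<beta> * \<phi> x" for x
  proof (cases "x < b")
    case False
    then show ?thesis using right[of x] by (simp add: V_def D_def)
  next
    case True
    \<comment> \<open>To the left of \<open>b\<close> there is no information on the sign of
      \<open>f (- cs)\<close>. The inequality at \<open>b\<close> is carried there instead: \<phi> /
      F decreases and \<open>V\<close> is a multiple of \<open>F\<close>.\<close>
    have "D b \<ge> 0" using right by simp
    then have "K \<le> \<alpha> + \<beta> * (\<phi> b / F b)"
      using F_pos[of b] by (simp add: D_def K_def divide_le_eq distrib_right)
    also have "\<phi> b / F b \<le> \<phi> x / F x"
      using True F_mono[of x b] \<phi>_antimono[of x b] less_imp_le[OF \<phi>_pos] F_pos by (intro frac_le) auto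
    finally have "K \<le> \<alpha> + \<beta> * (\<phi> x / F x)" using \<beta> by (simp add: mult_left_mono)
    then have "K * F x \<le> (\<alpha> + \<beta> * (\<phi> x / F x)) * F x" using F_pos[of x] by simp
    also have "\<dots> = \<alpha> * F x + \<beta> * \<phi> x" using F_pos[of x] by (simp add: distrib_right)
    finally show ?thesis using True by (simp add: V_def)
  qed
  then show ?thesis using val False by (intro exI[of _ \<alpha>] exI[of _ \<beta>]) (simp add: V_def)
qed

lemma V_excessive: "ou_excessive \<mu> \<sigma> \<theta> r V"
  by (intro excessive_of_tangents borel_measurable_continuous_onI V_continuous V_tangent less_imp_le V_pos)

end

section \<open>Sign of the buying drift and comparison with the buying price\<close>

context ou_parameters
begin

lemma f_continuous: "continuous_on A (f d)"
  unfolding f_def[abs_def] by (intro continuous_intros)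

lemma f_deriv: "(f d has_real_derivative - \<mu> + r * d * exp (- x)) (at x)"
  unfolding f_def[abs_def] by (auto intro!: derivative_eq_intros)

lemma f_neg_right:
  assumes "d > 0" shows "\<exists>z>x. f d z < 0"
proof (intro exI conjI)
  define A where "A = \<mu> * \<theta> + \<sigma>\<^sup>2 / 2 - r"
  let ?z = "max x (A / \<mu>) + 1"
  show "?z > x" by simp
  have "A / \<mu> < ?z" by simp
  then have "A < \<mu> * ?z" using \<mu> by (simp add: divide_less_eq mult.commute)
  moreover have "r * d * exp (- ?z) > 0" using r assms by simp
  ultimately show "f d ?z < 0" unfolding f_def A_def[symmetric] by linarith
qed

lemma f_neg_left:
  assumes d: "d > 0" shows "\<exists>z<x. f d z < 0"
proof -
  define A where "A = \<mu> * \<theta> + \<sigma>\<^sup>2 / 2 - r"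
  \<comment> \<open>At - t the exponential term is at least r d t^2 / 2; \<open>t\<close> is taken
    so large that this exceeds the linear bound (|A| + \<mu>) t.\<close>
  define t where "t = max (max 1 (- x + 1)) (2 * (\<bar>A\<bar> + \<mu>) / (r * d) + 1)"
  have t: "t \<ge> 1" "t > - x" "2 * (\<bar>A\<bar> + \<mu>) / (r * d) < t" by (auto simp: t_def)
  have rd: "r * d > 0" using r d by simp
  have "A + \<mu> * t \<le> (\<bar>A\<bar> + \<mu>) * t"
    using mult_left_mono[OF t(1), of "\<bar>A\<bar>"] by (simp add: distrib_right)
  also have "\<dots> < (r * d * t / 2) * t"
    using t rd by (intro mult_strict_right_mono) (auto simp: divide_less_eq mult_ac)
  also have "\<dots> = r * d * (t\<^sup>2 / 2)" by (simp add: power2_eq_square)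
  also have "\<dots> \<le> r * d * exp t"
  proof (rule mult_left_mono)
    show "t\<^sup>2 / 2 \<le> exp t" using exp_lower_Taylor_quadratic[of t] t(1) by simp
  qed (use rd in simp)
  finally have "f d (- t) < 0" unfolding f_def A_def[symmetric] by simp
  then show ?thesis using t by (intro exI[of _ "- t"]) auto
qed

lemma f_root_between:
  assumes "f d x * f d y < 0" "x < y"
  shows "\<exists>z. x < z \<and> z < y \<and> f d z = 0"
proof -
  have "\<exists>z\<ge>x. z \<le> y \<and> f d z = 0"
    using assms IVT'[of "f d" x 0 y] IVT2'[of "f d" y 0 x] f_continuous
    by (auto simp: mult_less_0_iff)
  then show ?thesis using assms by (metis less_eq_real_def mult_zero_left mult_zero_right less_irrefl)
qed

text \<open>Outside the roots, a positive value would force a third root between it and the negative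
  values far out. Between them concavity decides: a negative value would need a negative slope
  before it and a positive slope after it.\<close>

lemma f_sign_two_roots:
  assumes d: "d > 0" and roots: "x1 < x2" "{x. f d x = 0} = {x1, x2}"
  shows "x < x1 \<Longrightarrow> f d x < 0" "x2 < x \<Longrightarrow> f d x < 0" "x1 \<le> x \<Longrightarrow> x \<le> x2 \<Longrightarrow> 0 \<le> f d x"
proof -
  have root: "f d z = 0 \<longleftrightarrow> z = x1 \<or> z = x2" for z using roots(2) by blast
  show "f d x < 0" if x: "x < x1"
  proof (rule ccontr)
    assume "\<not> f d x < 0"
    then have pos: "f d x > 0" using root[of x] x roots(1) by (simp add: not_less less_eq_real_def)
    obtain z where z: "z < x" "f d z < 0" using f_neg_left[OF d] by blast
    then obtain y where "z < y" "y < x" "f d y = 0" using f_root_between[of d z x] pos by (auto simp: mult_neg_pos)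
    then show False using root[of y] x roots(1) by auto
  qed
  show "f d x < 0" if x: "x2 < x"
  proof (rule ccontr)
    assume "\<not> f d x < 0"
    then have pos: "f d x > 0" using root[of x] x roots(1) by (simp add: not_less less_eq_real_def)
    obtain z where z: "x < z" "f d z < 0" using f_neg_right[OF d] by blast
    then obtain y where "x < y" "y < z" "f d y = 0" using f_root_between[of d x z] pos by (auto simp: mult_pos_neg)
    then show False using root[of y] x roots(1) by auto
  qed
  show "0 \<le> f d x" if x: "x1 \<le> x" "x \<le> x2"
  proof (rule ccontr)
    assume n: "\<not> 0 \<le> f d x"
    have f0: "f d x1 = 0" "f d x2 = 0" using root by auto
    then have x': "x1 < x" "x < x2" using n x by (auto simp: less_eq_real_def)
    obtain s where s: "x1 < s" "s < x" "f d x - f d x1 = (x - x1) * (- \<mu> + r * d * exp (- s))"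
      using MVT2[OF x'(1), of "f d" "\<lambda>x. - \<mu> + r * d * exp (- x)"] f_deriv by blast
    obtain t where t: "x < t" "t < x2" "f d x2 - f d x = (x2 - x) * (- \<mu> + r * d * exp (- t))"
      using MVT2[OF x'(2), of "f d" "\<lambda>x. - \<mu> + r * d * exp (- x)"] f_deriv by blast
    have "(x - x1) * (- \<mu> + r * d * exp (- s)) < 0" using s f0 n by simp
    then have 1: "- \<mu> + r * d * exp (- s) < 0" using x' by (simp add: mult_less_0_iff)
    have "(x2 - x) * (- \<mu> + r * d * exp (- t)) > 0" using t f0 n by simp
    then have 2: "- \<mu> + r * d * exp (- t) > 0" using x' by (simp add: zero_less_mult_iff)
    have "r * d * exp (- t) \<le> r * d * exp (- s)" using s t r d by (intro mult_left_mono) auto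
    with 1 2 show False by simp
  qed
qed

text \<open>A positive value would be flanked by two distinct roots. The hypothesis includes the
  case without roots.\<close>

lemma f_nonpos_single_root:
  assumes d: "d > 0" and single: "\<And>x y. f d x = 0 \<Longrightarrow> f d y = 0 \<Longrightarrow> x = y"
  shows "f d x \<le> 0"
proof (rule ccontr)
  assume "\<not> f d x \<le> 0"
  then have pos: "f d x > 0" by simp
  obtain u where u: "u < x" "f d u < 0" using f_neg_left[OF d] by blast
  obtain v where v: "x < v" "f d v < 0" using f_neg_right[OF d] by blast
  obtain y where "u < y" "y < x" "f d y = 0" using f_root_between[of d u x] u pos by (auto simp: mult_neg_pos)
  moreover obtain z where "x < z" "z < v" "f d z = 0" using f_root_between[of d x v] v pos by (auto simp: mult_pos_neg)
  ultimately show False using single[of y z] by simp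
qed

lemma W_eq_0_iff: "W d x = 0 \<longleftrightarrow> F x * exp x = F1 x * (exp x + d)"
  using speed_pos[of x] by (auto simp: W_def mult_ac)

end

text \<open>To the left of \<open>b\<close> the claim is that (exp + cb) / F is at least
  \<open>K\<close>, which holds at \<open>b\<close> itself because the costs are positive. The
  quotient decreases wherever \<open>W cb\<close> is nonpositive, so it can only drop below
  \<open>K\<close> at a dip created by positive values of \<open>W cb\<close>. The first and third
  conditions exclude such values; the second bounds the bottom of the dip, which is at
  \<open>a\<close>.\<close>

lemma (in switching) V_le_buy:
  assumes cb: "cb > 0"
    and cond: "(\<forall>x y. f cb x = 0 \<longrightarrow> f cb y = 0 \<longrightarrow> x = y)
      \<or> (\<exists>x1 x2. x1 < x2 \<and> {x. f cb x = 0} = {x1, x2} \<and>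
           (\<exists>a \<in> {x1<..<x2}. F a * exp a = F1 a * (exp a + cb) \<and> (exp a + cb) / F a \<ge> K))
      \<or> (\<exists>x1 x2. x1 < x2 \<and> {x. f cb x = 0} = {x1, x2} \<and>
           \<not> (\<exists>a \<in> {x1<..<x2}. F a * exp a = F1 a * (exp a + cb)))"
  shows "V x \<le> exp x + cb"
proof (cases "x < b")
  case False
  then show ?thesis using cs cb by (simp add: V_def)
next
  case True
  let ?q = "\<lambda>x. (exp x + cb) / F x"
  have qb: "?q b \<ge> K" unfolding K_def using cs cb F_pos[of b] by (intro divide_right_mono) auto
  have dec: "?q x \<ge> K" if "\<And>y. W cb y \<le> 0"
    using payoff_ratio_antimono[of x b cb] True that qb by simp
  have "?q x \<ge> K"
    using cond
  proof (elim disjE)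
    assume "\<forall>x y. f cb x = 0 \<longrightarrow> f cb y = 0 \<longrightarrow> x = y"
    then have "f cb y \<le> 0" for y using f_nonpos_single_root[OF cb] by blast
    then show ?thesis by (intro dec W_nonpos_left)
  next
    assume "\<exists>x1 x2. x1 < x2 \<and> {x. f cb x = 0} = {x1, x2} \<and>
           (\<exists>a \<in> {x1<..<x2}. F a * exp a = F1 a * (exp a + cb) \<and> (exp a + cb) / F a \<ge> K)"
    then obtain x1 x2 a where x12: "x1 < x2" "{x. f cb x = 0} = {x1, x2}" and a: "x1 < a" "a < x2" "W cb a = 0" "?q a \<ge> K"
      by (auto simp: W_eq_0_iff)
    note sgn = f_sign_two_roots[OF cb x12]
    have root: "f cb x1 = 0" "f cb x2 = 0" using x12(2) by blast+
    have left: "W cb y \<le> 0" if y: "y \<le> a" for y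
    proof (cases "y \<le> x1")
      case True
      have "f cb z \<le> 0" if "z \<le> y" for z
        using sgn(1)[of z] that True root by (cases "z = x1") auto
      then show ?thesis by (rule W_nonpos_left)
    next
      case False
      then show ?thesis using W_mono[of y a cb] y a sgn(3) by simp
    qed
    show ?thesis
    proof (cases "x \<le> a")
      case True
      then show ?thesis using payoff_ratio_antimono[OF True left] a(4) by simp
    next
      case ax: False
      have mid: "W cb y \<ge> 0" if "a \<le> y" "y \<le> x2" for y
        using W_mono[of a y cb] that a sgn(3) by simp
      have f_right: "f cb y \<le> 0" if "x2 \<le> y" for y
        using sgn(2)[of y] that root by (cases "y = x2") auto
      \<comment> \<open>Beyond \<open>x2\<close> the Wronskian is nonincreasing. Its sign at
        \<open>x\<close> therefore tells whether the quotient rises from \<open>a\<close> to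
        \<open>x\<close> or falls from \<open>x\<close> to \<open>b\<close>, and the bound is taken
        at \<open>a\<close> or at \<open>b\<close> accordingly.\<close>
      show ?thesis
      proof (cases "W cb x \<ge> 0")
        case True
        have "W cb y \<ge> 0" if y: "a \<le> y" "y \<le> x" for y
        proof (cases "y \<le> x2")
          case False
          then have "W cb x \<le> W cb y" using y f_right by (intro W_antimono) auto
          with True show ?thesis by simp
        qed (use mid y in auto)
        then show ?thesis using payoff_ratio_mono[of a x cb] ax a(4) by simp
      next
        case False
        then have x2: "x2 < x" using mid[of x] ax by (cases "x \<le> x2") auto
        have "W cb y \<le> 0" if y: "x \<le> y" for y
        proof -
          have "W cb y \<le> W cb x" using y x2 f_right by (intro W_antimono) auto
          with False show ?thesis by simp
        qed
        then show ?thesis using payoff_ratio_antimono[of x b cb] True qb by simp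
      qed
    qed
  next
    assume "\<exists>x1 x2. x1 < x2 \<and> {x. f cb x = 0} = {x1, x2} \<and>
           \<not> (\<exists>a \<in> {x1<..<x2}. F a * exp a = F1 a * (exp a + cb))"
    then obtain x1 x2 where x12: "x1 < x2" "{x. f cb x = 0} = {x1, x2}" and na: "\<And>a. x1 < a \<Longrightarrow> a < x2 \<Longrightarrow> W cb a \<noteq> 0"
      by (auto simp: W_eq_0_iff)
    note sgn = f_sign_two_roots[OF cb x12]
    have root: "f cb x1 = 0" "f cb x2 = 0" using x12(2) by blast+
    have neg1: "W cb x1 < 0"
    proof -
      have "W cb (x1 - 1) < 0" using sgn(1) by (intro W_neg_left) auto
      moreover have "W cb x1 \<le> W cb (x1 - 1)"
      proof (rule W_antimono)
        fix z assume "z \<le> x1"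
        then show "f cb z \<le> 0" using sgn(1)[of z] root by (cases "z = x1") auto
      qed simp
      ultimately show ?thesis by simp
    qed
    \<comment> \<open>\<open>W cb\<close> is negative at \<open>x1\<close> and has no zero inside,
      so it cannot change sign.\<close>
    have inside: "W cb y < 0" if y: "x1 < y" "y < x2" for y
    proof (rule ccontr)
      assume "\<not> W cb y < 0"
      then obtain z where z: "x1 \<le> z" "z \<le> y" "W cb z = 0"
        using IVT'[of "W cb" x1 0 y] neg1 y W_continuous by force
      then show False using na[of z] y neg1 by (cases "z = x1") auto
    qed
    have at2: "W cb x2 \<le> 0"
    proof (rule tendsto_upperbound[where F="at_left x2"])
      show "(W cb \<longlongrightarrow> W cb x2) (at_left x2)"
        using DERIV_isCont[OF W_deriv[of cb x2]] unfolding isCont_def by (rule tendsto_mono[OF at_le[OF subset_UNIV]])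
      show "\<forall>\<^sub>F y in at_left x2. W cb y \<le> 0"
        using eventually_at_left_real[OF x12(1)] by eventually_elim (rule less_imp_le, rule inside, auto)
    qed simp
    show ?thesis
    proof (rule dec)
      fix y
      consider "y \<le> x1" | "x1 < y" "y < x2" | "x2 \<le> y" by linarith
      then show "W cb y \<le> 0"
      proof cases
        case 1
        have "f cb z \<le> 0" if "z \<le> y" for z
          using sgn(1)[of z] that 1 root by (cases "z = x1") auto
        then show ?thesis by (rule W_nonpos_left)
      next
        case 2 then show ?thesis using inside by (simp add: less_imp_le)
      next
        case 3
        have "W cb y \<le> W cb x2"
        proof (rule W_antimono[OF 3])
          fix z assume "x2 \<le> z"
          then show "f cb z \<le> 0" using sgn(2)[of z] root by (cases "z = x2") auto
        qed
        with at2 show ?thesis by simp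
      qed
    qed
  qed
  then show ?thesis using True F_pos[of x] by (simp add: V_def le_divide_eq)
qed

section \<open>Further excessive functions and growth bounds\<close>

context ou_parameters
begin

lemma F_excessive: "ou_excessive \<mu> \<sigma> \<theta> r F"
  by (simp add: ou_excessive_def F_transition)

lemma \<phi>_excessive: "ou_excessive \<mu> \<sigma> \<theta> r \<phi>"
  by (simp add: ou_excessive_def \<phi>_transition)

lemma const_excessive:
  assumes "c \<ge> 0"
  shows "ou_excessive \<mu> \<sigma> \<theta> r (\<lambda>_. c)"
proof -
  interpret prob_space std_normal_distribution by (rule prob_space_normal_density) simp
  show ?thesis
    unfolding ou_excessive_def ou_transition_def
  proof (intro allI impI)
    fix h y :: real assume "h > 0"
    then have "1 * c \<le> exp (r * h) * c" using assms r by (intro mult_right_mono) auto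
    then show "(\<integral>\<^sup>+w. ennreal c \<partial>std_normal_distribution) \<le> ennreal (exp (r * h) * c)"
      using emeasure_space_1 by (simp add: ennreal_leI)
  qed
qed

lemma min_excessive:
  assumes "ou_excessive \<mu> \<sigma> \<theta> r u" "ou_excessive \<mu> \<sigma> \<theta> r v"
  shows "ou_excessive \<mu> \<sigma> \<theta> r (\<lambda>y. min (u y) (v y))"
  unfolding ou_excessive_def
proof (intro allI impI)
  fix h y :: real assume h: "h > 0"
  have "ou_transition \<mu> \<sigma> \<theta> h (\<lambda>y. ennreal (min (u y) (v y))) y \<le> ou_transition \<mu> \<sigma> \<theta> h (\<lambda>y. ennreal (u y)) y"
    "ou_transition \<mu> \<sigma> \<theta> h (\<lambda>y. ennreal (min (u y) (v y))) y \<le> ou_transition \<mu> \<sigma> \<theta> h (\<lambda>y. ennreal (v y)) y"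
    unfolding ou_transition_def by (auto intro!: nn_integral_mono ennreal_leI)
  then show "ou_transition \<mu> \<sigma> \<theta> h (\<lambda>y. ennreal (min (u y) (v y))) y \<le> ennreal (exp (r * h) * min (u y) (v y))"
    using assms h unfolding ou_excessive_def by (cases "u y \<le> v y") (auto simp: min_def intro: order.trans)
qed

lemma scaled_excessive:
  assumes "ou_excessive \<mu> \<sigma> \<theta> r u" "c \<ge> 0" and [measurable]: "u \<in> borel_measurable borel"
  shows "ou_excessive \<mu> \<sigma> \<theta> r (\<lambda>y. u y / c)"
proof (cases "c = 0")
  case True
  then show ?thesis using const_excessive[of 0] by simp
next
  case False
  then have c: "1 / c \<ge> 0" using assms by simp
  show ?thesis
    unfolding ou_excessive_def
  proof (intro allI impI)
    fix h y :: real assume h: "h > 0"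
    have "ou_transition \<mu> \<sigma> \<theta> h (\<lambda>y. ennreal (u y / c)) y = ennreal (1 / c) * ou_transition \<mu> \<sigma> \<theta> h (\<lambda>y. ennreal (u y)) y"
      unfolding ou_transition_def
      by (subst nn_integral_cmult[symmetric]) (auto simp: ennreal_mult'[OF c, symmetric])
    also have "\<dots> \<le> ennreal (1 / c) * ennreal (exp (r * h) * u y)"
      using assms(1) h unfolding ou_excessive_def by (intro mult_left_mono) auto
    also have "\<dots> = ennreal (exp (r * h) * (u y / c))"
      by (simp add: ennreal_mult'[OF c, symmetric])
    finally show "ou_transition \<mu> \<sigma> \<theta> h (\<lambda>y. ennreal (u y / c)) y \<le> ennreal (exp (r * h) * (u y / c))" .
  qed
qed

lemma exp_le_F:
  assumes "l > 0"
  shows "\<exists>C>0. \<forall>y. exp (l * y) \<le> C * F y"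
proof -
  have "l / \<kappa> > 0" using assms \<kappa> by simp
  from exp_le_hermite_int[OF exponents(1) this] obtain C where C: "C > 0" "\<And>z. exp (l / \<kappa> * z) \<le> C * hermite_int (r / \<mu> - 1) z"
    by blast
  have "exp (l * y) \<le> exp (l * \<theta>) * C * F y" for y
  proof -
    have "exp (l * y) = exp (l * \<theta>) * exp (l / \<kappa> * (\<kappa> * (y - \<theta>)))"
      using \<kappa>(1) by (simp add: exp_add[symmetric] right_diff_distrib)
    also have "\<dots> \<le> exp (l * \<theta>) * (C * F y)" unfolding F_def by (intro mult_left_mono C) auto
    finally show ?thesis by simp
  qed
  then show ?thesis using C(1) by (intro exI[of _ "exp (l * \<theta>) * C"]) auto
qed

text \<open>Growth of the derivative, for lower bounds on the increments of \<open>F\<close> between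
  neighbouring price levels.\<close>

lemma exp_le_F1:
  assumes "l > 0"
  shows "\<exists>C>0. \<forall>y. exp (l * y) \<le> C * F1 y"
proof -
  have "l / \<kappa> > 0" using assms \<kappa> by simp
  from exp_le_hermite_int[OF exponents(2) this] obtain C where C: "C > 0" "\<And>z. exp (l / \<kappa> * z) \<le> C * hermite_int (r / \<mu>) z"
    by blast
  have "exp (l * y) \<le> exp (l * \<theta>) * C / \<kappa> * F1 y" for y
  proof -
    have "exp (l * y) = exp (l * \<theta>) * exp (l / \<kappa> * (\<kappa> * (y - \<theta>)))"
      using \<kappa>(1) by (simp add: exp_add[symmetric] right_diff_distrib)
    also have "\<dots> \<le> exp (l * \<theta>) * (C * hermite_int (r / \<mu>) (\<kappa> * (y - \<theta>)))" by (intro mult_left_mono C) auto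
    also have "\<dots> = exp (l * \<theta>) * C / \<kappa> * F1 y" using \<kappa>(1) by (simp add: F1_def)
    finally show ?thesis .
  qed
  then show ?thesis using C(1) \<kappa>(1) by (intro exI[of _ "exp (l * \<theta>) * C / \<kappa>"]) auto
qed

end

section \<open>Trading strategies\<close>

text \<open>The partial sums exceed the full sum minus the integrable sum of the positive parts, so Fatou's
  lemma applies.\<close>

lemma (in prob_space) integral_suminf_nonpos:
  fixes g :: "nat \<Rightarrow> 'a \<Rightarrow> real"
  assumes int: "\<And>n. integrable M (g n)" and neg: "\<And>n. (\<integral>\<omega>. g n \<omega> \<partial>M) \<le> 0"
    and fin: "(\<integral>\<^sup>+\<omega>. (\<Sum>n. ennreal (g n \<omega>)) \<partial>M) < \<infinity>"
    and summ: "AE \<omega> in M. summable (\<lambda>n. g n \<omega>)" and intS: "integrable M (\<lambda>\<omega>. \<Sum>n. g n \<omega>)"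
  shows "(\<integral>\<omega>. (\<Sum>n. g n \<omega>) \<partial>M) \<le> 0"
proof -
  have [measurable]: "g n \<in> borel_measurable M" for n using int by blast
  \<comment> \<open>\<open>ennreal\<close> sends negative numbers to 0, so each summand is the
    positive part of \<open>g n \<omega>\<close>.\<close>
  define D where "D \<omega> = enn2real (\<Sum>n. ennreal (g n \<omega>))" for \<omega>
  have Dfin: "AE \<omega> in M. ennreal (D \<omega>) = (\<Sum>n. ennreal (g n \<omega>))"
  proof -
    have "AE \<omega> in M. (\<Sum>n. ennreal (g n \<omega>)) \<noteq> \<infinity>"
      by (rule nn_integral_PInf_AE) (use fin in auto)
    then show ?thesis by eventually_elim (simp add: D_def less_top)
  qed
  have Dint: "integrable M D"
  proof (rule integrableI_nonneg)
    show "D \<in> borel_measurable M" unfolding D_def[abs_def] by measurable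
    show "AE \<omega> in M. 0 \<le> D \<omega>" by (simp add: D_def)
    show "(\<integral>\<^sup>+\<omega>. ennreal (D \<omega>) \<partial>M) < \<infinity>" using fin Dfin by (subst nn_integral_cong_AE[OF Dfin]) simp
  qed
  define S where "S N \<omega> = (\<Sum>n<N. g n \<omega>)" for N \<omega>
  let ?T = "\<lambda>\<omega>. \<Sum>n. g n \<omega>"
  have Sint: "integrable M (S N)" for N unfolding S_def[abs_def] using int by auto
  have Sneg: "(\<integral>\<omega>. S N \<omega> \<partial>M) \<le> 0" for N
    unfolding S_def using int neg by (simp add: sum_nonpos)
  \<comment> \<open>The remaining terms after \<open>N\<close> add up to at most the sum of the
    positive parts. This is the lower bound under which Fatou's lemma is applied to the partial
    sums.\<close>
  have low: "AE \<omega> in M. \<forall>N. 0 \<le> S N \<omega> - ?T \<omega> + D \<omega>"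
    using summ Dfin
  proof eventually_elim
    case (elim \<omega>)
    show ?case
    proof
      fix N
      have "(\<lambda>N'. S N' \<omega> - S N \<omega>) \<longlonglongrightarrow> ?T \<omega> - S N \<omega>"
        unfolding S_def using summable_LIMSEQ[OF elim(1)] by (intro tendsto_intros)
      moreover have "S N' \<omega> - S N \<omega> \<le> D \<omega>" if "N' \<ge> N" for N'
      proof -
        have "S N' \<omega> - S N \<omega> = (\<Sum>n\<in>{N..<N'}. g n \<omega>)"
          using sum.atLeastLessThan_concat[of 0 N N' "\<lambda>n. g n \<omega>"] that by (simp add: S_def lessThan_atLeast0)
        also have "\<dots> \<le> (\<Sum>n\<in>{N..<N'}. max 0 (g n \<omega>))" by (intro sum_mono) auto
        finally have "ennreal (S N' \<omega> - S N \<omega>) \<le> ennreal (\<Sum>n\<in>{N..<N'}. max 0 (g n \<omega>))" by (rule ennreal_leI)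
        also have "\<dots> = (\<Sum>n\<in>{N..<N'}. ennreal (max 0 (g n \<omega>)))"
          by (rule sum_ennreal[symmetric]) simp
        also have "\<dots> = (\<Sum>n\<in>{N..<N'}. ennreal (g n \<omega>))"
          by (intro sum.cong) (auto simp: max_def ennreal_neg)
        also have "\<dots> \<le> (\<Sum>n. ennreal (g n \<omega>))" by (rule sum_le_suminf) auto
        also have "\<dots> = ennreal (D \<omega>)" using elim(2) by simp
        finally show ?thesis by (simp add: D_def ennreal_le_iff)
      qed
      ultimately have "?T \<omega> - S N \<omega> \<le> D \<omega>" by (intro LIMSEQ_le_const2[of _ "?T \<omega> - S N \<omega>"]) auto
      then show "0 \<le> S N \<omega> - ?T \<omega> + D \<omega>" by simp
    qed
  qed
  have "(\<integral>\<^sup>+\<omega>. ennreal (D \<omega>) \<partial>M) = (\<integral>\<^sup>+\<omega>. liminf (\<lambda>N. ennreal (S N \<omega> - ?T \<omega> + D \<omega>)) \<partial>M)"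
  proof (rule nn_integral_cong_AE)
    show "AE \<omega> in M. ennreal (D \<omega>) = liminf (\<lambda>N. ennreal (S N \<omega> - ?T \<omega> + D \<omega>))"
      using summ
    proof eventually_elim
      case (elim \<omega>)
      have "(\<lambda>N. S N \<omega> - ?T \<omega> + D \<omega>) \<longlonglongrightarrow> ?T \<omega> - ?T \<omega> + D \<omega>"
        unfolding S_def using summable_LIMSEQ[OF elim] by (intro tendsto_intros)
      then have "(\<lambda>N. ennreal (S N \<omega> - ?T \<omega> + D \<omega>)) \<longlonglongrightarrow> ennreal (D \<omega>)" by (simp add: tendsto_ennrealI)
      then show ?case by (simp add: lim_imp_Liminf)
    qed
  qed
  also have "\<dots> \<le> liminf (\<lambda>N. \<integral>\<^sup>+\<omega>. ennreal (S N \<omega> - ?T \<omega> + D \<omega>) \<partial>M)"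
    using Sint intS Dint by (intro nn_integral_liminf) auto
  also have "\<dots> \<le> ennreal ((\<integral>\<omega>. D \<omega> \<partial>M) - (\<integral>\<omega>. ?T \<omega> \<partial>M))"
  proof (rule Liminf_le)
    show "\<forall>\<^sub>F N in sequentially. (\<integral>\<^sup>+\<omega>. ennreal (S N \<omega> - ?T \<omega> + D \<omega>) \<partial>M) \<le> ennreal ((\<integral>\<omega>. D \<omega> \<partial>M) - (\<integral>\<omega>. ?T \<omega> \<partial>M))"
    proof (intro always_eventually allI)
      fix N
      have "AE \<omega> in M. 0 \<le> S N \<omega> - ?T \<omega> + D \<omega>" using low by eventually_elim simp
      then have "(\<integral>\<^sup>+\<omega>. ennreal (S N \<omega> - ?T \<omega> + D \<omega>) \<partial>M) = ennreal (\<integral>\<omega>. S N \<omega> - ?T \<omega> + D \<omega> \<partial>M)"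
        using Sint intS Dint by (intro nn_integral_eq_integral) auto
      also have "(\<integral>\<omega>. S N \<omega> - ?T \<omega> + D \<omega> \<partial>M) = (\<integral>\<omega>. S N \<omega> \<partial>M) - (\<integral>\<omega>. ?T \<omega> \<partial>M) + (\<integral>\<omega>. D \<omega> \<partial>M)"
        using Sint intS Dint by simp
      finally show "(\<integral>\<^sup>+\<omega>. ennreal (S N \<omega> - ?T \<omega> + D \<omega>) \<partial>M) \<le> ennreal ((\<integral>\<omega>. D \<omega> \<partial>M) - (\<integral>\<omega>. ?T \<omega> \<partial>M))"
        using Sneg[of N] by (simp add: ennreal_leI)
    qed
  qed simp
  also have "(\<integral>\<^sup>+\<omega>. ennreal (D \<omega>) \<partial>M) = ennreal (\<integral>\<omega>. D \<omega> \<partial>M)"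
    by (rule nn_integral_eq_integral[OF Dint]) (simp add: D_def)
  finally have le: "ennreal (\<integral>\<omega>. D \<omega> \<partial>M) \<le> ennreal ((\<integral>\<omega>. D \<omega> \<partial>M) - (\<integral>\<omega>. ?T \<omega> \<partial>M))" .
  have D0: "(\<integral>\<omega>. D \<omega> \<partial>M) \<ge> 0" by (simp add: D_def)
  show ?thesis
  proof (rule ccontr)
    assume "\<not> ?thesis"
    then have "(\<integral>\<omega>. D \<omega> \<partial>M) - (\<integral>\<omega>. ?T \<omega> \<partial>M) < (\<integral>\<omega>. D \<omega> \<partial>M)" by simp
    moreover have "(\<integral>\<omega>. D \<omega> \<partial>M) - (\<integral>\<omega>. ?T \<omega> \<partial>M) \<ge> 0"
    proof -
      have "0 \<le> (\<integral>\<omega>. S 0 \<omega> - ?T \<omega> + D \<omega> \<partial>M)" by (rule integral_nonneg_AE, rule AE_mp[OF low]) simp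
      then show ?thesis using intS Dint by (simp add: S_def)
    qed
    ultimately have "ennreal ((\<integral>\<omega>. D \<omega> \<partial>M) - (\<integral>\<omega>. ?T \<omega> \<partial>M)) < ennreal (\<integral>\<omega>. D \<omega> \<partial>M)"
      by (simp add: ennreal_less_iff)
    with le show False by simp
  qed
qed

text \<open>With u = (b - a) / \<eta>, floor and ceiling lose at most two of the u spacings, and u -
  2 \<ge> u / 3 because u > 3; hence the constant 3. Index 0 stands for the level \<eta>, so that
  all levels are positive.\<close>

lemma count_levels:
  fixes a b \<eta> :: real
  assumes \<eta>: "\<eta> > 0" and a: "a > 0" and ab: "b - a > 3 * \<eta>"
  shows "ennreal (b - a) \<le> ennreal (3 * \<eta>) * (\<Sum>j. if a \<le> real (Suc j) * \<eta> \<and> real (Suc (Suc j)) * \<eta> \<le> b then 1 else 0)"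
proof -
  define p where "p = nat (\<lceil>a / \<eta>\<rceil> - 1)"
  define q where "q = nat (\<lfloor>b / \<eta>\<rfloor> - 1)"
  have a': "a / \<eta> > 0" using a \<eta> by simp
  have p: "real p = of_int \<lceil>a / \<eta>\<rceil> - 1" using a' by (simp add: p_def)
  have ba: "b / \<eta> - a / \<eta> > 3" using ab \<eta> by (simp add: diff_divide_distrib[symmetric] less_divide_eq)
  have "\<lfloor>b / \<eta>\<rfloor> \<ge> 1" using ba a' by (simp add: le_floor_iff)
  then have q: "real q = of_int \<lfloor>b / \<eta>\<rfloor> - 1" by (simp add: q_def)
  have "a \<le> real (Suc j) * \<eta> \<and> real (Suc (Suc j)) * \<eta> \<le> b" if j: "j \<in> {p..<q}" for j
  proof
    have "a / \<eta> \<le> real p + 1" unfolding p by simp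
    also have "\<dots> \<le> real (Suc j)" using j by simp
    finally show "a \<le> real (Suc j) * \<eta>" using \<eta> by (simp add: divide_le_eq)
    have "real (Suc (Suc j)) \<le> real q + 1" using j by simp
    also have "\<dots> \<le> b / \<eta>" unfolding q by simp
    finally show "real (Suc (Suc j)) * \<eta> \<le> b" using \<eta> by (simp add: le_divide_eq)
  qed
  then have "(\<Sum>j\<in>{p..<q}. if a \<le> real (Suc j) * \<eta> \<and> real (Suc (Suc j)) * \<eta> \<le> b then 1 else 0 :: ennreal) = of_nat (q - p)"
    by simp
  moreover have "(\<Sum>j\<in>{p..<q}. if a \<le> real (Suc j) * \<eta> \<and> real (Suc (Suc j)) * \<eta> \<le> b then 1 else 0 :: ennreal)
     \<le> (\<Sum>j. if a \<le> real (Suc j) * \<eta> \<and> real (Suc (Suc j)) * \<eta> \<le> b then 1 else 0)"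
    by (rule sum_le_suminf) auto
  ultimately have cnt: "ennreal (real (q - p)) \<le> (\<Sum>j. if a \<le> real (Suc j) * \<eta> \<and> real (Suc (Suc j)) * \<eta> \<le> b then 1 else 0)"
    by (simp add: ennreal_of_nat_eq_real_of_nat)
  have "real (q - p) \<ge> real q - real p" by linarith
  also have "real q - real p \<ge> b / \<eta> - a / \<eta> - 2" unfolding p q by linarith
  finally have cnt3: "real (q - p) \<ge> (b / \<eta> - a / \<eta>) - 2" .
  have "u / 3 \<le> v" if "u > 3" "v \<ge> u - 2" for u v :: real using that by linarith
  from this[OF ba cnt3] have "real (q - p) \<ge> (b / \<eta> - a / \<eta>) / 3" .
  then have "b - a \<le> 3 * \<eta> * real (q - p)" using \<eta> by (simp add: field_simps)
  then have "ennreal (b - a) \<le> ennreal (3 * \<eta>) * ennreal (real (q - p))"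
    using \<eta> by (simp add: ennreal_mult'[symmetric] ennreal_leI)
  also have "\<dots> \<le> ennreal (3 * \<eta>) * (\<Sum>j. if a \<le> real (Suc j) * \<eta> \<and> real (Suc (Suc j)) * \<eta> \<le> b then 1 else 0)"
    using cnt by (intro mult_left_mono) auto
  finally show ?thesis .
qed

section \<open>Modified stopping times\<close>

context ou_process
begin

definition restrict_time :: "('a \<Rightarrow> ennreal) \<Rightarrow> real set \<Rightarrow> 'a \<Rightarrow> ennreal" where
  "restrict_time \<nu> P \<omega> = (if \<nu> \<omega> \<noteq> \<infinity> \<and> X (enn2real (\<nu> \<omega>)) \<omega> \<in> P then \<nu> \<omega> else \<infinity>)"

text \<open>With rate 0 and the identity as payoff, \<open>disc_pay\<close> is the position at time
  \<nu>, so its adaptedness decides the event.\<close>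

lemma restrict_time_stopping:
  assumes \<nu>: "is_stopping_time M B \<nu>" and P: "P \<in> sets borel"
  shows "is_stopping_time M B (restrict_time \<nu> P)"
  unfolding is_stopping_time_def
proof (intro allI impI)
  fix t :: real assume t: "t \<ge> 0"
  let ?F = "nat_filtration M B t" and ?D = "\<lambda>\<omega>. disc_pay 0 (\<lambda>y. y) X \<nu> \<omega> * indicator {\<omega> \<in> space M. \<nu> \<omega> \<le> ennreal t} \<omega>"
  have "?D \<in> borel_measurable ?F" by (rule disc_pay_adapted[OF \<nu> _ t]) (intro continuous_intros)
  then have "?D -` P \<inter> space ?F \<in> sets ?F" using P by (rule measurable_sets)
  moreover have "{\<omega> \<in> space M. \<nu> \<omega> \<le> ennreal t} \<in> sets ?F" using \<nu> t by (simp add: is_stopping_time_def)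
  ultimately have "(?D -` P \<inter> space ?F) \<inter> {\<omega> \<in> space M. \<nu> \<omega> \<le> ennreal t} \<in> sets ?F" by (rule sets.Int)
  also have "(?D -` P \<inter> space ?F) \<inter> {\<omega> \<in> space M. \<nu> \<omega> \<le> ennreal t} = {\<omega> \<in> space M. restrict_time \<nu> P \<omega> \<le> ennreal t}"
    by (auto simp: restrict_time_def disc_pay_def top_unique split: if_splits)
  finally show "{\<omega> \<in> space M. restrict_time \<nu> P \<omega> \<le> ennreal t} \<in> sets ?F" .
qed

text \<open>The modified time is at most \<open>t\<close> exactly when both \<nu>' and \<tau> are,
  because a finite \<nu>' does not exceed \<tau>.\<close>

lemma later_time_stopping:
  assumes "is_stopping_time M B \<nu>'" "is_stopping_time M B \<tau>" "\<And>\<omega>. \<omega> \<in> space M \<Longrightarrow> \<nu>' \<omega> \<noteq> \<infinity> \<Longrightarrow> \<nu>' \<omega> \<le> \<tau> \<omega>"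
  shows "is_stopping_time M B (\<lambda>\<omega>. if \<nu>' \<omega> = \<infinity> then \<infinity> else \<tau> \<omega>)"
  unfolding is_stopping_time_def
proof (intro allI impI)
  fix t :: real assume t: "t \<ge> 0"
  have "{\<omega> \<in> space M. \<nu>' \<omega> \<le> ennreal t} \<inter> {\<omega> \<in> space M. \<tau> \<omega> \<le> ennreal t} \<in> sets (nat_filtration M B t)"
    using assms t by (intro sets.Int) (auto simp: is_stopping_time_def)
  also have "{\<omega> \<in> space M. \<nu>' \<omega> \<le> ennreal t} \<inter> {\<omega> \<in> space M. \<tau> \<omega> \<le> ennreal t}
     = {\<omega> \<in> space M. (if \<nu>' \<omega> = \<infinity> then \<infinity> else \<tau> \<omega>) \<le> ennreal t}"
    using assms(3) by (auto simp: top_unique intro: order.trans)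
  finally show "{\<omega> \<in> space M. (if \<nu>' \<omega> = \<infinity> then \<infinity> else \<tau> \<omega>) \<le> ennreal t} \<in> sets (nat_filtration M B t)" .
qed

lemma const_stopping: "is_stopping_time M B (\<lambda>_. c)"
  unfolding is_stopping_time_def
proof (intro allI impI)
  fix t :: real
  have "space M \<in> sets (nat_filtration M B t)" using sets.top[of "nat_filtration M B t"] by simp
  then show "{\<omega> \<in> space M. c \<le> ennreal t} \<in> sets (nat_filtration M B t)" by (cases "c \<le> ennreal t") auto
qed

end

section \<open>Single trades and discounted upcrossings\<close>

locale switching_process = ou_process M B X \<mu> \<sigma> \<theta> x + switching \<mu> \<sigma> \<theta> r cs b
  for M :: "'a measure" and B X \<mu> \<sigma> \<theta> x r cs b
begin

text \<open>The weak second moment bound asks for an excessive function at twice the rate; the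
  function \<open>F\<close> belonging to 2 r serves.\<close>

lemma disc_sup_finite: "(\<integral>\<^sup>+\<omega>. disc_sup r \<omega> \<partial>M) < \<infinity>"
proof -
  interpret two: ou_parameters \<mu> \<sigma> \<theta> "2 * r"
    using \<mu> \<sigma> r by unfold_locales auto
  obtain C where "C > 0" "\<And>y. exp (2 * y) \<le> C * two.F y" using two.exp_le_F[of 2] by auto
  then show ?thesis
    by (intro disc_sup_integrable[of two.F] two.F_continuous two.F_excessive less_imp_le[OF two.F_pos]) auto
qed

lemma disc_pay_integrable:
  assumes "is_stopping_time M B \<tau>" "continuous_on UNIV g" "\<And>y. \<bar>g y\<bar> \<le> exp y + c" "c \<ge> 0"
  shows "integrable M (disc_pay r g X \<tau>)"
proof (rule integrableI_bounded)
  show "disc_pay r g X \<tau> \<in> borel_measurable M" using assms by (intro disc_pay_measurable)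
  have "(\<integral>\<^sup>+\<omega>. ennreal (norm (disc_pay r g X \<tau> \<omega>)) \<partial>M) \<le> (\<integral>\<^sup>+\<omega>. disc_sup r \<omega> + ennreal c \<partial>M)"
    using assms r by (intro nn_integral_mono) (auto intro!: disc_pay_le_sup)
  also have "\<dots> < \<infinity>" using disc_sup_finite by (subst nn_integral_add) (auto simp: emeasure_space_1)
  finally show "(\<integral>\<^sup>+\<omega>. ennreal (norm (disc_pay r g X \<tau> \<omega>)) \<partial>M) < \<infinity>" .
qed

lemma disc_pay_nonneg: "(\<And>y. g y \<ge> 0) \<Longrightarrow> disc_pay r g X \<tau> \<omega> \<ge> 0"
  by (simp add: disc_pay_def)

lemma disc_pay_mono: "(\<And>y. g y \<le> g' y) \<Longrightarrow> disc_pay r g X \<tau> \<omega> \<le> disc_pay r g' X \<tau> \<omega>"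
  unfolding disc_pay_def by (auto intro: mult_left_mono)

lemma sampling:
  assumes u: "continuous_on UNIV u" "\<And>y. u y \<ge> 0" "ou_excessive \<mu> \<sigma> \<theta> r u"
    and bound: "\<And>y. u y \<le> exp y + c" "c \<ge> 0"
    and st: "is_stopping_time M B \<nu>" "is_stopping_time M B \<tau>" and le: "\<And>\<omega>. \<omega> \<in> space M \<Longrightarrow> \<nu> \<omega> \<le> \<tau> \<omega>"
  shows "(\<integral>\<omega>. disc_pay r u X \<tau> \<omega> \<partial>M) \<le> (\<integral>\<omega>. disc_pay r u X \<nu> \<omega> \<partial>M)"
proof -
  have int: "integrable M (disc_pay r u X \<rho>)" if "is_stopping_time M B \<rho>" for \<rho>
    using that u bound by (intro disc_pay_integrable[where c=c]) auto
  have nn: "disc_pay r u X \<rho> \<omega> \<ge> 0" for \<rho> \<omega> by (rule disc_pay_nonneg[OF u(2)])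
  have "(\<integral>\<^sup>+\<omega>. ennreal (disc_pay r u X \<tau> \<omega>) \<partial>M) \<le> (\<integral>\<^sup>+\<omega>. ennreal (disc_pay r u X \<nu> \<omega>) \<partial>M)"
    by (rule optional_sampling[OF less_imp_le[OF r] u bound disc_sup_finite st le])
  then have "ennreal (\<integral>\<omega>. disc_pay r u X \<tau> \<omega> \<partial>M) \<le> ennreal (\<integral>\<omega>. disc_pay r u X \<nu> \<omega> \<partial>M)"
    using nn by (simp add: nn_integral_eq_integral[OF int[OF st(1)]] nn_integral_eq_integral[OF int[OF st(2)]])
  then show ?thesis by (simp add: ennreal_le_iff integral_nonneg_AE nn)
qed

lemma disc_pay_start:
  "(\<integral>\<omega>. disc_pay r u X (\<lambda>_. 0) \<omega> \<partial>M) = u x"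
proof -
  have "(\<integral>\<omega>. disc_pay r u X (\<lambda>_. 0) \<omega> \<partial>M) = (\<integral>\<omega>. u x \<partial>M)"
    by (intro Bochner_Integration.integral_cong refl) (simp add: disc_pay_def X_zero)
  then show ?thesis by (simp add: prob_space)
qed

lemma sampling_start:
  assumes u: "continuous_on UNIV u" "\<And>y. u y \<ge> 0" "ou_excessive \<mu> \<sigma> \<theta> r u"
    and bound: "\<And>y. u y \<le> exp y + c" "c \<ge> 0" and st: "is_stopping_time M B \<tau>"
  shows "(\<integral>\<omega>. disc_pay r u X \<tau> \<omega> \<partial>M) \<le> u x"
  using sampling[OF u bound const_stopping[of 0] st] by (simp add: disc_pay_start)

lemma sell_integrable: "is_stopping_time M B \<tau> \<Longrightarrow> integrable M (disc_pay r (\<lambda>y. exp y - cs) X \<tau>)"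
  by (rule disc_pay_integrable[where c=cs]) (use cs in \<open>auto intro!: continuous_intros simp: abs_if\<close>)

lemma buy_integrable: "cb > 0 \<Longrightarrow> is_stopping_time M B \<tau> \<Longrightarrow> integrable M (disc_pay r (\<lambda>y. exp y + cb) X \<tau>)"
  by (rule disc_pay_integrable[where c=cb]) (auto intro!: continuous_intros)

lemma V_integrable: "is_stopping_time M B \<tau> \<Longrightarrow> integrable M (disc_pay r V X \<tau>)"
  by (rule disc_pay_integrable[where c="exp b"]) (auto intro!: V_continuous V_le_exp simp: abs_of_pos[OF V_pos])

lemma sell_le_V:
  assumes "is_stopping_time M B \<tau>"
  shows "(\<integral>\<omega>. disc_pay r (\<lambda>y. exp y - cs) X \<tau> \<omega> \<partial>M) \<le> (\<integral>\<omega>. disc_pay r V X \<tau> \<omega> \<partial>M)"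
  using assms by (intro integral_mono sell_integrable V_integrable disc_pay_mono V_ge_payoff)

lemma first_sale:
  assumes "is_stopping_time M B \<tau>"
  shows "(\<integral>\<omega>. disc_pay r (\<lambda>y. exp y - cs) X \<tau> \<omega> \<partial>M) \<le> V x"
  using sell_le_V[OF assms] sampling_start[OF V_continuous less_imp_le[OF V_pos] V_excessive V_le_exp _ assms] by simp

text \<open>A sale yields at most \<open>V\<close>, the discounted \<open>V\<close> does not gain in
  mean from \<nu> to \<tau>, and at \<nu> it is at most the buying price.\<close>

lemma round_trip:
  assumes cb: "cb > 0" and buy: "\<And>y. V y \<le> exp y + cb"
    and st: "is_stopping_time M B \<nu>" "is_stopping_time M B \<tau>" and le: "\<And>\<omega>. \<omega> \<in> space M \<Longrightarrow> \<nu> \<omega> \<le> \<tau> \<omega>"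
  shows "(\<integral>\<omega>. disc_pay r (\<lambda>y. exp y - cs) X \<tau> \<omega> - disc_pay r (\<lambda>y. exp y + cb) X \<nu> \<omega> \<partial>M) \<le> 0"
proof -
  have "(\<integral>\<omega>. disc_pay r V X \<tau> \<omega> \<partial>M) \<le> (\<integral>\<omega>. disc_pay r V X \<nu> \<omega> \<partial>M)"
    by (rule sampling[OF V_continuous less_imp_le[OF V_pos] V_excessive V_le_exp _ st le]) auto
  moreover have "(\<integral>\<omega>. disc_pay r V X \<nu> \<omega> \<partial>M) \<le> (\<integral>\<omega>. disc_pay r (\<lambda>y. exp y + cb) X \<nu> \<omega> \<partial>M)"
    using st cb by (intro integral_mono V_integrable buy_integrable disc_pay_mono buy)
  ultimately show ?thesis using sell_le_V[OF st(2)] sell_integrable[OF st(2)] buy_integrable[OF cb st(1)] by simp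
qed

text \<open>The data for Doob's upcrossing argument at one level pair \<open>l < l'\<close>: the excessive functions
  \<open>low \<le> high\<close> agree on \<open>{..l}\<close> and differ by at least \<open>gap\<close> on \<open>{l'..}\<close>.\<close>

definition "low l y = min (F y / F l) (\<phi> y / \<phi> l)"
definition "high l l' y = min (F y / F l) (F l' / F l)"
definition "gap l l' = F l' / F l - \<phi> l' / \<phi> l"

text \<open>Both quotients equal 1 at \<open>l\<close>, one increasing and the other decreasing, so
  their minimum peaks there. It is the mean discount at the hitting time of
  \<open>l\<close>.\<close>

lemma low_props:
  "continuous_on UNIV (low l)" "low l y \<ge> 0" "ou_excessive \<mu> \<sigma> \<theta> r (low l)" "low l y \<le> 1"
proof -
  have m: "F \<in> borel_measurable borel" "\<phi> \<in> borel_measurable borel"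
    by (intro borel_measurable_continuous_onI F_continuous \<phi>_continuous)+
  show "continuous_on UNIV (low l)"
    unfolding low_def[abs_def] using F_pos[of l] \<phi>_pos[of l]
    by (intro continuous_intros F_continuous \<phi>_continuous) (auto simp: less_imp_neq[symmetric])
  show "low l y \<ge> 0" using F_pos[of l] \<phi>_pos[of l] F_pos[of y] \<phi>_pos[of y] by (simp add: low_def)
  show "ou_excessive \<mu> \<sigma> \<theta> r (low l)"
    unfolding low_def[abs_def] using F_pos[of l] \<phi>_pos[of l] m
    by (intro min_excessive scaled_excessive F_excessive \<phi>_excessive) auto
  show "low l y \<le> 1"
  proof (cases "y \<le> l")
    case True
    then have "F y / F l \<le> 1" using F_mono[of y l] F_pos[of l] by simp
    then show ?thesis by (simp add: low_def min.coboundedI1)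
  next
    case False
    then have "\<phi> y / \<phi> l \<le> 1" using \<phi>_antimono[of l y] \<phi>_pos[of l] by simp
    then show ?thesis by (simp add: low_def min.coboundedI2)
  qed
qed

lemma high_props:
  "continuous_on UNIV (high l l')" "high l l' y \<ge> 0" "ou_excessive \<mu> \<sigma> \<theta> r (high l l')" "high l l' y \<le> F l' / F l"
proof -
  have m: "F \<in> borel_measurable borel"
    by (intro borel_measurable_continuous_onI F_continuous)
  show "continuous_on UNIV (high l l')"
    unfolding high_def[abs_def] using F_pos[of l]
    by (intro continuous_intros F_continuous) (auto simp: less_imp_neq[symmetric])
  show "high l l' y \<ge> 0" using F_pos[of l] F_pos[of l'] F_pos[of y] by (simp add: high_def)
  show "ou_excessive \<mu> \<sigma> \<theta> r (high l l')"
    unfolding high_def[abs_def] using F_pos[of l] F_pos[of l'] m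
    by (intro min_excessive scaled_excessive F_excessive const_excessive) auto
  show "high l l' y \<le> F l' / F l" by (simp add: high_def)
qed

lemma gap_ge:
  assumes "l < l'"
  shows "gap l l' \<ge> (F l' - F l) / F l" "gap l l' > 0"
proof -
  have "\<phi> l' / \<phi> l \<le> 1" using \<phi>_antimono[of l l'] \<phi>_pos[of l] assms by simp
  then show 1: "gap l l' \<ge> (F l' - F l) / F l" using F_pos[of l] by (simp add: gap_def diff_divide_distrib)
  have "F l < F l'" by (rule DERIV_pos_imp_increasing[OF assms]) (use F_deriv F1_pos in blast)
  then have "(F l' - F l) / F l > 0" using F_pos[of l] by simp
  with 1 show "gap l l' > 0" by simp
qed

lemma low_le_high:
  assumes "l < l'"
  shows "low l y \<le> high l l' y" "y \<le> l \<Longrightarrow> high l l' y \<le> low l y" "l' \<le> y \<Longrightarrow> gap l l' \<le> high l l' y - low l y"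
proof -
  have 1: "1 \<le> F l' / F l" using F_mono[of l l'] F_pos[of l] assms by simp
  show "low l y \<le> high l l' y" using 1 low_props(4)[of l y] by (auto simp: low_def high_def)
  show "high l l' y \<le> low l y" if "y \<le> l"
  proof -
    have "F y / F l \<le> 1" "1 \<le> \<phi> y / \<phi> l"
      using F_mono[OF that] F_pos[of l] \<phi>_antimono[OF that] \<phi>_pos[of l] by auto
    then show ?thesis by (simp add: low_def high_def min_def)
  qed
  show "gap l l' \<le> high l l' y - low l y" if "l' \<le> y"
  proof -
    have "F l' / F l \<le> F y / F l" using F_mono[OF that] F_pos[of l] by (simp add: divide_right_mono)
    moreover have "\<phi> y / \<phi> l \<le> \<phi> l' / \<phi> l" using \<phi>_antimono[OF that] \<phi>_pos[of l] by (simp add: divide_right_mono)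
    ultimately show ?thesis by (simp add: gap_def high_def low_def min_def)
  qed
qed

text \<open>It vanishes unless the purchase happens at or below \<open>l\<close>, and for such a
  purchase it dominates the discount of a sale at or above \<open>l'\<close>. Unlike the indicator
  of such a trade, its mean is accessible to optional sampling.\<close>

definition crossing :: "real \<Rightarrow> real \<Rightarrow> ('a \<Rightarrow> ennreal) \<Rightarrow> ('a \<Rightarrow> ennreal) \<Rightarrow> 'a \<Rightarrow> real" where
  "crossing l l' \<nu> \<tau> \<omega> = (let \<tau>' = (\<lambda>\<omega>. if restrict_time \<nu> {..l} \<omega> = \<infinity> then \<infinity> else \<tau> \<omega>)
     in (disc_pay r (high l l') X \<tau>' \<omega> - disc_pay r (low l) X \<tau>' \<omega>) / gap l l')"

lemma crossing_nonneg: "l < l' \<Longrightarrow> crossing l l' \<nu> \<tau> \<omega> \<ge> 0"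
  using gap_ge[of l l'] low_le_high[of l l'] by (auto simp: crossing_def Let_def intro!: divide_nonneg_pos disc_pay_mono)

lemma crossing_ge:
  assumes "l < l'" "\<nu> \<omega> \<noteq> \<infinity>" "\<tau> \<omega> \<noteq> \<infinity>" "X (enn2real (\<nu> \<omega>)) \<omega> \<le> l" "l' \<le> X (enn2real (\<tau> \<omega>)) \<omega>"
  shows "exp (- r * enn2real (\<tau> \<omega>)) \<le> crossing l l' \<nu> \<tau> \<omega>"
proof -
  have "exp (- r * enn2real (\<tau> \<omega>)) * gap l l'
     \<le> exp (- r * enn2real (\<tau> \<omega>)) * (high l l' (X (enn2real (\<tau> \<omega>)) \<omega>) - low l (X (enn2real (\<tau> \<omega>)) \<omega>))"
    using low_le_high(3)[OF assms(1,5)] by (intro mult_left_mono) auto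
  then show ?thesis
    using gap_ge[OF assms(1)] assms
    by (simp add: crossing_def restrict_time_def disc_pay_def le_divide_eq right_diff_distrib)
qed

text \<open>Trades are split by the position at purchase. From a start at or below \<open>l\<close>,
  where \<open>high\<close> and \<open>low\<close> agree, \<open>high\<close> does not gain in mean;
  from a start above \<open>l\<close>, \<open>low\<close> does not. Adding the two leaves a bound in
  \<open>low\<close> alone, which telescopes over successive trades.\<close>

lemma crossing_integral:
  assumes l: "l < l'" and st: "is_stopping_time M B \<nu>" "is_stopping_time M B \<tau>" and le: "\<And>\<omega>. \<omega> \<in> space M \<Longrightarrow> \<nu> \<omega> \<le> \<tau> \<omega>"
  shows "integrable M (crossing l l' \<nu> \<tau>)"
    and "(\<integral>\<omega>. crossing l l' \<nu> \<tau> \<omega> \<partial>M) \<le> ((\<integral>\<omega>. disc_pay r (low l) X \<nu> \<omega> \<partial>M) - (\<integral>\<omega>. disc_pay r (low l) X \<tau> \<omega> \<partial>M)) / gap l l'"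
proof -
  define \<nu>1 where "\<nu>1 = restrict_time \<nu> {..l}"
  define \<nu>2 where "\<nu>2 = restrict_time \<nu> {l<..}"
  define \<tau>1 where "\<tau>1 \<omega> = (if \<nu>1 \<omega> = \<infinity> then \<infinity> else \<tau> \<omega>)" for \<omega>
  define \<tau>2 where "\<tau>2 \<omega> = (if \<nu>2 \<omega> = \<infinity> then \<infinity> else \<tau> \<omega>)" for \<omega>
  have sn: "is_stopping_time M B \<nu>1" "is_stopping_time M B \<nu>2"
    unfolding \<nu>1_def \<nu>2_def by (intro restrict_time_stopping st; simp)+
  have nle: "\<nu>1 \<omega> \<le> \<tau>1 \<omega>" "\<nu>2 \<omega> \<le> \<tau>2 \<omega>" if "\<omega> \<in> space M" for \<omega>
    using le[OF that] by (auto simp: \<nu>1_def \<nu>2_def \<tau>1_def \<tau>2_def restrict_time_def split: if_splits)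
  have stt: "is_stopping_time M B \<tau>1" "is_stopping_time M B \<tau>2"
    unfolding \<tau>1_def[abs_def] \<tau>2_def[abs_def]
    by (intro later_time_stopping sn st; use le in \<open>auto simp: \<nu>1_def \<nu>2_def restrict_time_def split: if_splits\<close>)+
  have bl: "low l y \<le> exp y + 1" for y using low_props(4)[of l y] exp_gt_zero[of y] by linarith
  have bh: "high l l' y \<le> exp y + F l' / F l" for y using high_props(4)[of l l' y] exp_gt_zero[of y] by linarith
  have Fl: "F l' / F l \<ge> 0" using F_pos[of l] F_pos[of l'] by simp
  have il: "integrable M (disc_pay r (low l) X \<rho>)" if "is_stopping_time M B \<rho>" for \<rho>
    using low_props[of l] bl by (intro disc_pay_integrable[OF that, where c=1]) auto
  have ih: "integrable M (disc_pay r (high l l') X \<rho>)" if "is_stopping_time M B \<rho>" for \<rho>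
    using high_props[of l l'] bh Fl by (intro disc_pay_integrable[OF that, where c="F l' / F l"]) auto
  have cr: "crossing l l' \<nu> \<tau> \<omega> = (disc_pay r (high l l') X \<tau>1 \<omega> - disc_pay r (low l) X \<tau>1 \<omega>) / gap l l'" for \<omega>
    by (simp add: crossing_def \<tau>1_def[abs_def] \<nu>1_def Let_def)
  show "integrable M (crossing l l' \<nu> \<tau>)"
    unfolding cr[abs_def] by (intro integrable_divide Bochner_Integration.integrable_diff il ih stt)
  have split: "disc_pay r u X \<nu> \<omega> = disc_pay r u X \<nu>1 \<omega> + disc_pay r u X \<nu>2 \<omega>"
    "disc_pay r u X \<tau> \<omega> = disc_pay r u X \<tau>1 \<omega> + disc_pay r u X \<tau>2 \<omega>" if "\<omega> \<in> space M" for u \<omega>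
    using le[OF that] by (auto simp: disc_pay_def \<nu>1_def \<nu>2_def \<tau>1_def \<tau>2_def restrict_time_def top_unique)
  have "(\<integral>\<omega>. disc_pay r (high l l') X \<tau>1 \<omega> \<partial>M) \<le> (\<integral>\<omega>. disc_pay r (high l l') X \<nu>1 \<omega> \<partial>M)"
    by (rule sampling[OF high_props(1-3) bh Fl sn(1) stt(1) nle(1)])
  also have "\<dots> \<le> (\<integral>\<omega>. disc_pay r (low l) X \<nu>1 \<omega> \<partial>M)"
    using low_le_high(2)[OF l]
    by (intro integral_mono ih il sn) (auto simp: disc_pay_def \<nu>1_def restrict_time_def)
  finally have 1: "(\<integral>\<omega>. disc_pay r (high l l') X \<tau>1 \<omega> \<partial>M) \<le> (\<integral>\<omega>. disc_pay r (low l) X \<nu>1 \<omega> \<partial>M)" .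
  have 2: "(\<integral>\<omega>. disc_pay r (low l) X \<tau>2 \<omega> \<partial>M) \<le> (\<integral>\<omega>. disc_pay r (low l) X \<nu>2 \<omega> \<partial>M)"
    by (rule sampling[OF low_props(1-3) bl _ sn(2) stt(2) nle(2)]) auto
  have "(\<integral>\<omega>. disc_pay r (low l) X \<nu> \<omega> \<partial>M) = (\<integral>\<omega>. disc_pay r (low l) X \<nu>1 \<omega> + disc_pay r (low l) X \<nu>2 \<omega> \<partial>M)"
    by (intro Bochner_Integration.integral_cong refl split)
  then have 3: "(\<integral>\<omega>. disc_pay r (low l) X \<nu> \<omega> \<partial>M) = (\<integral>\<omega>. disc_pay r (low l) X \<nu>1 \<omega> \<partial>M) + (\<integral>\<omega>. disc_pay r (low l) X \<nu>2 \<omega> \<partial>M)"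
    using il[OF sn(1)] il[OF sn(2)] by simp
  have "(\<integral>\<omega>. disc_pay r (low l) X \<tau> \<omega> \<partial>M) = (\<integral>\<omega>. disc_pay r (low l) X \<tau>1 \<omega> + disc_pay r (low l) X \<tau>2 \<omega> \<partial>M)"
    by (intro Bochner_Integration.integral_cong refl split)
  then have 4: "(\<integral>\<omega>. disc_pay r (low l) X \<tau> \<omega> \<partial>M) = (\<integral>\<omega>. disc_pay r (low l) X \<tau>1 \<omega> \<partial>M) + (\<integral>\<omega>. disc_pay r (low l) X \<tau>2 \<omega> \<partial>M)"
    using il[OF stt(1)] il[OF stt(2)] by simp
  have "(\<integral>\<omega>. crossing l l' \<nu> \<tau> \<omega> \<partial>M) = ((\<integral>\<omega>. disc_pay r (high l l') X \<tau>1 \<omega> \<partial>M) - (\<integral>\<omega>. disc_pay r (low l) X \<tau>1 \<omega> \<partial>M)) / gap l l'"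
    unfolding cr using ih[OF stt(1)] il[OF stt(1)] by simp
  also have "\<dots> \<le> ((\<integral>\<omega>. disc_pay r (low l) X \<nu> \<omega> \<partial>M) - (\<integral>\<omega>. disc_pay r (low l) X \<tau> \<omega> \<partial>M)) / gap l l'"
    using 1 2 3 4 gap_ge(2)[OF l] by (intro divide_right_mono) auto
  finally show "(\<integral>\<omega>. crossing l l' \<nu> \<tau> \<omega> \<partial>M) \<le> ((\<integral>\<omega>. disc_pay r (low l) X \<nu> \<omega> \<partial>M) - (\<integral>\<omega>. disc_pay r (low l) X \<tau> \<omega> \<partial>M)) / gap l l'" .
qed

text \<open>The means of \<open>low\<close> at \<nu> 0, \<tau> 0, \<nu> 1, \<tau> 1 and so on are
  nonincreasing, so the bounds telescope to at most \<open>low l x\<close>, hence to F x / F l.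
  Division by the gap cancels \<open>F l\<close>.\<close>

lemma crossing_series:
  assumes l: "l < l'" and st: "\<And>n. is_stopping_time M B (\<nu> n)" "\<And>n. is_stopping_time M B (\<tau> n)"
    and le: "\<And>n \<omega>. \<omega> \<in> space M \<Longrightarrow> \<nu> n \<omega> \<le> \<tau> n \<omega>" "\<And>n \<omega>. \<omega> \<in> space M \<Longrightarrow> \<tau> n \<omega> \<le> \<nu> (Suc n) \<omega>"
  shows "(\<Sum>n. \<integral>\<^sup>+\<omega>. ennreal (crossing l l' (\<nu> n) (\<tau> n) \<omega>) \<partial>M) \<le> ennreal (F x / (F l' - F l))"
proof (rule suminf_le_const)
  fix N
  let ?Z = "\<lambda>\<rho>. \<integral>\<omega>. disc_pay r (low l) X \<rho> \<omega> \<partial>M"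
  note ci = crossing_integral[OF l st le(1)]
  have bl: "low l y \<le> exp y + 1" for y using low_props(4)[of l y] exp_gt_zero[of y] by linarith
  have tel: "(\<Sum>n<N. ?Z (\<nu> n) - ?Z (\<tau> n)) + ?Z (\<nu> N) \<le> ?Z (\<nu> 0)" for N
  proof (induction N)
    case (Suc N)
    have "?Z (\<nu> (Suc N)) \<le> ?Z (\<tau> N)"
      by (rule sampling[OF low_props(1-3) bl _ st(2) st(1) le(2)]) auto
    with Suc show ?case by simp
  qed simp
  have "?Z (\<nu> 0) \<le> low l x" by (rule sampling_start[OF low_props(1-3) bl _ st(1)]) simp
  moreover have "0 \<le> ?Z (\<nu> N)" by (intro integral_nonneg_AE AE_I2 disc_pay_nonneg low_props)
  ultimately have S: "(\<Sum>n<N. ?Z (\<nu> n) - ?Z (\<tau> n)) \<le> F x / F l" using tel[of N] by (simp add: low_def)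
  have "(\<Sum>n<N. \<integral>\<^sup>+\<omega>. ennreal (crossing l l' (\<nu> n) (\<tau> n) \<omega>) \<partial>M) = (\<Sum>n<N. ennreal (\<integral>\<omega>. crossing l l' (\<nu> n) (\<tau> n) \<omega> \<partial>M))"
    by (intro sum.cong refl nn_integral_eq_integral ci AE_I2 crossing_nonneg[OF l])
  also have "\<dots> = ennreal (\<Sum>n<N. \<integral>\<omega>. crossing l l' (\<nu> n) (\<tau> n) \<omega> \<partial>M)"
    by (intro sum_ennreal integral_nonneg_AE AE_I2 crossing_nonneg[OF l])
  also have "\<dots> \<le> ennreal (F x / (F l' - F l))"
  proof (rule ennreal_leI)
    have "(\<Sum>n<N. \<integral>\<omega>. crossing l l' (\<nu> n) (\<tau> n) \<omega> \<partial>M) \<le> (\<Sum>n<N. (?Z (\<nu> n) - ?Z (\<tau> n)) / gap l l')"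
      by (intro sum_mono ci)
    also have "\<dots> = (\<Sum>n<N. ?Z (\<nu> n) - ?Z (\<tau> n)) / gap l l'" by (simp add: sum_divide_distrib)
    also have "\<dots> \<le> (F x / F l) / gap l l'" using S gap_ge(2)[OF l] by (intro divide_right_mono) auto
    also have "\<dots> \<le> (F x / F l) / ((F l' - F l) / F l)"
    proof (rule divide_left_mono[OF gap_ge(1)[OF l]])
      have "F l < F l'" by (rule DERIV_pos_imp_increasing[OF l]) (use F_deriv F1_pos in blast)
      then show "0 < gap l l' * ((F l' - F l) / F l)" using gap_ge(2)[OF l] F_pos[of l] by simp
    qed (use F_pos[of x] F_pos[of l] in simp)
    also have "\<dots> = F x / (F l' - F l)" using F_pos[of l] by simp
    finally show "(\<Sum>n<N. \<integral>\<omega>. crossing l l' (\<nu> n) (\<tau> n) \<omega> \<partial>M) \<le> F x / (F l' - F l)" .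
  qed
  finally show "(\<Sum>n<N. \<integral>\<^sup>+\<omega>. ennreal (crossing l l' (\<nu> n) (\<tau> n) \<omega>) \<partial>M) \<le> ennreal (F x / (F l' - F l))" .
qed simp

text \<open>Prices equally spaced by \<eta>, in logarithmic coordinates; the first is \<eta> itself,
  since 0 has no logarithm.\<close>

definition "level \<eta> j = ln (real (Suc j) * \<eta>)"

text \<open>The derivative of \<open>F\<close> grows at least like the cube of the price. One power
  is lost to the logarithmic spacing 1 / (n + 1), so the increments of \<open>F\<close> are at least
  of order n^2, which is summable in the denominator; hence the exponent 3.\<close>

lemma level_sum_finite:
  assumes \<eta>: "\<eta> > 0"
  shows "(\<Sum>j. ennreal (F x / (F (level \<eta> (Suc j)) - F (level \<eta> j)))) < \<infinity>"
proof -
  obtain C where C: "C > 0" "\<And>y. exp (3 * y) \<le> C * F1 y" using exp_le_F1[of 3] by auto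
  define D where "D = 2 * F x * C / \<eta> ^ 3"
  have term_le: "F x / (F (level \<eta> (Suc j)) - F (level \<eta> j)) \<le> D * inverse (real (Suc j) ^ 2)" for j
  proof -
    define n where "n = real (Suc j)"
    have n: "n \<ge> 1" by (simp add: n_def)
    have lv: "level \<eta> j = ln (n * \<eta>)" "level \<eta> (Suc j) = ln ((n + 1) * \<eta>)" by (simp_all add: level_def n_def add.commute)
    have lt: "level \<eta> j < level \<eta> (Suc j)" unfolding lv using n \<eta> by simp
    obtain z where z: "level \<eta> j < z" "F (level \<eta> (Suc j)) - F (level \<eta> j) = (level \<eta> (Suc j) - level \<eta> j) * F1 z"
      using MVT2[OF lt, of F F1] F_deriv by blast
    have "level \<eta> (Suc j) - level \<eta> j = - ln (n / (n + 1))"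
      unfolding lv using n \<eta> by (simp add: ln_mult ln_div)
    also have "\<dots> \<ge> 1 - n / (n + 1)" using ln_le_minus_one[of "n / (n + 1)"] n by simp
    also have "1 - n / (n + 1) = 1 / (n + 1)" using n by (simp add: field_simps)
    finally have w: "level \<eta> (Suc j) - level \<eta> j \<ge> 1 / (n + 1)" .
    have "(n * \<eta>) ^ 3 = exp (3 * level \<eta> j)"
      unfolding lv using n \<eta> by (simp add: exp_of_nat_mult[of 3, simplified])
    also have "\<dots> \<le> C * F1 z" using C(2)[of "level \<eta> j"] F1_mono[of "level \<eta> j" z] z(1) C(1) by (meson less_imp_le mult_left_mono order.trans)
    finally have F1z: "(n * \<eta>) ^ 3 / C \<le> F1 z" using C(1) by (simp add: divide_le_eq mult.commute)
    have "(1 / (n + 1)) * ((n * \<eta>) ^ 3 / C) \<le> F (level \<eta> (Suc j)) - F (level \<eta> j)"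
      unfolding z(2) using w F1z n \<eta> C(1) less_imp_le[OF lt] by (intro mult_mono) auto
    moreover have "1 / (2 * n) \<le> 1 / (n + 1)" using n by (intro divide_left_mono) auto
    then have "(1 / (2 * n)) * ((n * \<eta>) ^ 3 / C) \<le> (1 / (n + 1)) * ((n * \<eta>) ^ 3 / C)"
      using n \<eta> C(1) by (intro mult_right_mono) auto
    moreover have "(1 / (2 * n)) * ((n * \<eta>) ^ 3 / C) = n\<^sup>2 * \<eta> ^ 3 / (2 * C)"
      using n by (simp add: power_mult_distrib power2_eq_square power3_eq_cube)
    ultimately have low: "n\<^sup>2 * \<eta> ^ 3 / (2 * C) \<le> F (level \<eta> (Suc j)) - F (level \<eta> j)" by linarith
    have p: "n\<^sup>2 * \<eta> ^ 3 / (2 * C) > 0" using n \<eta> C(1) by simp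
    have "F x / (F (level \<eta> (Suc j)) - F (level \<eta> j)) \<le> F x / (n\<^sup>2 * \<eta> ^ 3 / (2 * C))"
      using low p F_pos[of x] by (intro divide_left_mono mult_pos_pos) auto
    also have "\<dots> = D * inverse (n\<^sup>2)" using n \<eta> C(1) by (simp add: D_def field_simps)
    finally show ?thesis by (simp add: n_def)
  qed
  have "D \<ge> 0" using F_pos[of x] C(1) \<eta> by (simp add: D_def)
  have summ: "summable (\<lambda>j. D * inverse (real (Suc j) ^ 2))"
  proof (rule summable_mult)
    have "summable (\<lambda>n. inverse (real n ^ 2))" by (rule inverse_power_summable) simp
    then show "summable (\<lambda>j. inverse (real (Suc j) ^ 2))" by (subst summable_Suc_iff)
  qed
  have "(\<Sum>j. ennreal (F x / (F (level \<eta> (Suc j)) - F (level \<eta> j)))) \<le> (\<Sum>j. ennreal (D * inverse (real (Suc j) ^ 2)))"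
    by (intro suminf_le ennreal_leI term_le) auto
  also have "\<dots> = ennreal (\<Sum>j. D * inverse (real (Suc j) ^ 2))"
    by (rule suminf_ennreal2[OF _ summ]) (use \<open>D \<ge> 0\<close> in auto)
  finally show ?thesis by (auto elim: order.strict_trans1)
qed

text \<open>A profitable trade raises the price by more than \<open>cb\<close>, hence by at most three times the total
  spacing of the levels \<open>j * (cb / 3)\<close> it crosses.\<close>

lemma gain_le_crossings:
  assumes cb: "cb > 0" and \<omega>: "\<omega> \<in> space M" and le: "\<nu> \<omega> \<le> \<tau> \<omega>"
  shows "ennreal (disc_pay r (\<lambda>y. exp y - cs) X \<tau> \<omega> - disc_pay r (\<lambda>y. exp y + cb) X \<nu> \<omega>)
     \<le> ennreal cb * (\<Sum>j. ennreal (crossing (level (cb / 3) j) (level (cb / 3) (Suc j)) \<nu> \<tau> \<omega>))"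
proof -
  let ?g = "disc_pay r (\<lambda>y. exp y - cs) X \<tau> \<omega> - disc_pay r (\<lambda>y. exp y + cb) X \<nu> \<omega>"
  define \<eta> where "\<eta> = cb / 3"
  have \<eta>: "\<eta> > 0" using cb by (simp add: \<eta>_def)
  show ?thesis
  proof (cases "?g > 0")
    case False
    then show ?thesis by (simp add: ennreal_neg)
  next
    case True
    have buy0: "disc_pay r (\<lambda>y. exp y + cb) X \<nu> \<omega> \<ge> 0" using cb by (intro disc_pay_nonneg) (simp add: add_nonneg_nonneg)
    then have \<tau>: "\<tau> \<omega> \<noteq> \<infinity>" using True by (auto simp: disc_pay_def split: if_splits)
    then have \<nu>: "\<nu> \<omega> \<noteq> \<infinity>" using le by (auto simp: top_unique)
    define s t where "s = enn2real (\<nu> \<omega>)" and "t = enn2real (\<tau> \<omega>)"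
    have st: "s \<le> t" unfolding s_def t_def using le \<tau> by (intro enn2real_mono) (auto simp: less_top)
    define a c where "a = exp (X s \<omega>)" and "c = exp (X t \<omega>)"
    have e: "exp (- r * t) \<le> exp (- r * s)" using st r by simp
    have "?g = exp (- r * t) * (c - cs) - exp (- r * s) * (a + cb)"
      using \<tau> \<nu> by (simp add: disc_pay_def s_def t_def a_def c_def)
    \<comment> \<open>The purchase comes first and its price is positive, so giving it the smaller
      discount factor of the sale only enlarges the gain.\<close>
    also have "\<dots> \<le> exp (- r * t) * (c - cs) - exp (- r * t) * (a + cb)"
      using e cb by (intro diff_left_mono mult_right_mono) (auto simp: a_def)
    also have "\<dots> = exp (- r * t) * (c - a - cs - cb)" by (simp add: algebra_simps)
    finally have g1: "?g \<le> exp (- r * t) * (c - a - cs - cb)" .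
    then have "exp (- r * t) * (c - a - cs - cb) > 0" using True by linarith
    then have ca: "c - a > 3 * \<eta>" using cs by (simp add: zero_less_mult_iff \<eta>_def)
    have "?g \<le> exp (- r * t) * (c - a)" using cs cb by (intro order.trans[OF g1] mult_left_mono) auto
    then have "ennreal ?g \<le> ennreal (exp (- r * t)) * ennreal (c - a)"
      by (simp add: ennreal_mult'[symmetric] ennreal_leI)
    also have "\<dots> \<le> ennreal (exp (- r * t)) * (ennreal (3 * \<eta>) * (\<Sum>j. if a \<le> real (Suc j) * \<eta> \<and> real (Suc (Suc j)) * \<eta> \<le> c then 1 else 0))"
      using \<eta> ca by (intro mult_left_mono count_levels) (auto simp: a_def)
    also have "\<dots> = ennreal cb * (\<Sum>j. ennreal (exp (- r * t)) * (if a \<le> real (Suc j) * \<eta> \<and> real (Suc (Suc j)) * \<eta> \<le> c then 1 else 0))"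
      by (simp add: \<eta>_def mult.left_commute)
    also have "\<dots> \<le> ennreal cb * (\<Sum>j. ennreal (crossing (level \<eta> j) (level \<eta> (Suc j)) \<nu> \<tau> \<omega>))"
    proof (intro mult_left_mono suminf_le)
      fix j
      have lv: "level \<eta> j < level \<eta> (Suc j)" using \<eta> by (simp add: level_def)
      show "ennreal (exp (- r * t)) * (if a \<le> real (Suc j) * \<eta> \<and> real (Suc (Suc j)) * \<eta> \<le> c then 1 else 0)
         \<le> ennreal (crossing (level \<eta> j) (level \<eta> (Suc j)) \<nu> \<tau> \<omega>)"
      proof (cases "a \<le> real (Suc j) * \<eta> \<and> real (Suc (Suc j)) * \<eta> \<le> c")
        case True
        have "X s \<omega> \<le> level \<eta> j" unfolding level_def using True \<eta> by (subst ln_ge_iff) (auto simp: a_def)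
        moreover have "level \<eta> (Suc j) \<le> ln c" unfolding level_def using True \<eta> by (subst ln_le_cancel_iff) (auto simp: c_def)
        then have "level \<eta> (Suc j) \<le> X t \<omega>" by (simp add: c_def)
        ultimately show ?thesis
          using crossing_ge[of "level \<eta> j" "level \<eta> (Suc j)" \<nu> \<omega> \<tau>] lv \<nu> \<tau> True
          by (simp add: s_def t_def ennreal_leI)
      qed auto
    qed auto
    finally show ?thesis by (simp add: \<eta>_def)
  qed
qed

lemma trades_expectation:
  fixes \<nu> \<tau> :: "nat \<Rightarrow> 'a \<Rightarrow> ennreal"
  assumes cb: "cb > 0" and buy: "\<And>y. V y \<le> exp y + cb"
    and st: "\<And>n. is_stopping_time M B (\<nu> n)" "\<And>n. is_stopping_time M B (\<tau> n)"
    and le: "\<And>n \<omega>. \<omega> \<in> space M \<Longrightarrow> \<nu> n \<omega> \<le> \<tau> n \<omega>" "\<And>n \<omega>. \<omega> \<in> space M \<Longrightarrow> \<tau> n \<omega> \<le> \<nu> (Suc n) \<omega>"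
  defines "g \<equiv> \<lambda>n \<omega>. disc_pay r (\<lambda>y. exp y - cs) X (\<tau> n) \<omega> - disc_pay r (\<lambda>y. exp y + cb) X (\<nu> n) \<omega>"
  assumes summ: "AE \<omega> in M. summable (\<lambda>n. g n \<omega>)" and int: "integrable M (\<lambda>\<omega>. \<Sum>n. g n \<omega>)"
  shows "(\<integral>\<omega>. (\<Sum>n. g n \<omega>) \<partial>M) \<le> 0"
proof (rule integral_suminf_nonpos)
  define l where "l = level (cb / 3)"
  have lt: "l j < l (Suc j)" for j using cb by (simp add: l_def level_def)
  have cm[measurable]: "crossing (l j) (l (Suc j)) (\<nu> n) (\<tau> n) \<in> borel_measurable M" for j n
    using crossing_integral(1)[OF lt st(1) st(2) le(1)] by blast
  show ig: "integrable M (g n)" for n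
    unfolding g_def by (intro Bochner_Integration.integrable_diff sell_integrable buy_integrable cb st)
  show "(\<integral>\<omega>. g n \<omega> \<partial>M) \<le> 0" for n
    unfolding g_def by (rule round_trip[OF cb buy st(1) st(2) le(1)])
  have "(\<integral>\<^sup>+\<omega>. (\<Sum>n. ennreal (g n \<omega>)) \<partial>M) = (\<Sum>n. \<integral>\<^sup>+\<omega>. ennreal (g n \<omega>) \<partial>M)"
    using ig by (intro nn_integral_suminf) auto
  also have "\<dots> \<le> (\<Sum>n. \<integral>\<^sup>+\<omega>. ennreal cb * (\<Sum>j. ennreal (crossing (l j) (l (Suc j)) (\<nu> n) (\<tau> n) \<omega>)) \<partial>M)"
    unfolding g_def l_def by (intro suminf_le nn_integral_mono gain_le_crossings cb le) auto
  also have "\<dots> = (\<Sum>n. ennreal cb * (\<Sum>j. \<integral>\<^sup>+\<omega>. ennreal (crossing (l j) (l (Suc j)) (\<nu> n) (\<tau> n) \<omega>) \<partial>M))"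
    by (simp add: nn_integral_cmult nn_integral_suminf)
  also have "\<dots> = ennreal cb * (\<Sum>n. \<Sum>j. \<integral>\<^sup>+\<omega>. ennreal (crossing (l j) (l (Suc j)) (\<nu> n) (\<tau> n) \<omega>) \<partial>M)"
    by simp
  \<comment> \<open>The sums are exchanged so that for each pair of levels all trades are counted
    together, as the upcrossing bound requires.\<close>
  also have "(\<Sum>n. \<Sum>j. \<integral>\<^sup>+\<omega>. ennreal (crossing (l j) (l (Suc j)) (\<nu> n) (\<tau> n) \<omega>) \<partial>M)
     = (\<Sum>j. \<Sum>n. \<integral>\<^sup>+\<omega>. ennreal (crossing (l j) (l (Suc j)) (\<nu> n) (\<tau> n) \<omega>) \<partial>M)"
  proof -
    let ?a = "\<lambda>n j. \<integral>\<^sup>+\<omega>. ennreal (crossing (l j) (l (Suc j)) (\<nu> n) (\<tau> n) \<omega>) \<partial>M"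
    have "(\<Sum>n. \<Sum>j. ?a n j) = (\<integral>\<^sup>+n. (\<Sum>j. ?a n j) \<partial>count_space UNIV)" by (simp add: nn_integral_count_space_nat)
    also have "\<dots> = (\<Sum>j. \<integral>\<^sup>+n. ?a n j \<partial>count_space UNIV)" by (rule nn_integral_suminf) simp
    finally show ?thesis by (simp add: nn_integral_count_space_nat)
  qed
  also have "\<dots> \<le> (\<Sum>j. ennreal (F x / (F (l (Suc j)) - F (l j))))"
    by (intro suminf_le crossing_series lt st le) auto
  also have "ennreal cb * \<dots> < \<infinity>"
    using level_sum_finite[of "cb / 3"] cb by (simp add: l_def ennreal_mult_less_top)
  finally show "(\<integral>\<^sup>+\<omega>. (\<Sum>n. ennreal (g n \<omega>)) \<partial>M) < \<infinity>" by (simp add: mult_left_mono)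
qed (use summ int in auto)

end

section \<open>Hitting times\<close>

context ou_process
begin

definition hitting_time :: "real \<Rightarrow> 'a \<Rightarrow> ennreal" where
  "hitting_time b \<omega> = (if \<exists>s\<ge>0. b \<le> X s \<omega> then ennreal (Inf {s. 0 \<le> s \<and> b \<le> X s \<omega>}) else \<infinity>)"

lemma hitting_time_attained:
  assumes \<omega>: "\<omega> \<in> space M" and ex: "\<exists>s\<ge>0. b \<le> X s \<omega>"
  obtains T where "hitting_time b \<omega> = ennreal T" "0 \<le> T" "b \<le> X T \<omega>" "\<And>s. 0 \<le> s \<Longrightarrow> b \<le> X s \<omega> \<Longrightarrow> T \<le> s"
proof -
  let ?S = "{s. 0 \<le> s \<and> b \<le> X s \<omega>}"
  have "closed ({0..} \<inter> (\<lambda>s. X s \<omega>) -` {b..})"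
    by (rule continuous_closed_preimage[OF X_continuous[OF \<omega>]]) auto
  also have "{0..} \<inter> (\<lambda>s. X s \<omega>) -` {b..} = ?S" by auto
  finally have cl: "closed ?S" .
  have ne: "?S \<noteq> {}" using ex by auto
  have bdd: "bdd_below ?S" by (rule bdd_belowI[of _ 0]) auto
  have mem: "Inf ?S \<in> ?S" by (rule closed_contains_Inf[OF ne bdd cl])
  show ?thesis
  proof (rule that)
    show "hitting_time b \<omega> = ennreal (Inf ?S)" using ex by (simp add: hitting_time_def)
    show "0 \<le> Inf ?S" "b \<le> X (Inf ?S) \<omega>" using mem by auto
    show "Inf ?S \<le> s" if "0 \<le> s" "b \<le> X s \<omega>" for s using that by (intro cInf_lower bdd) auto
  qed
qed

lemma hitting_time_le_iff:
  assumes \<omega>: "\<omega> \<in> space M" and t: "t \<ge> 0"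
  shows "hitting_time b \<omega> \<le> ennreal t \<longleftrightarrow> (\<exists>s\<in>{0..t}. b \<le> X s \<omega>)"
proof
  assume le: "hitting_time b \<omega> \<le> ennreal t"
  then have "\<exists>s\<ge>0. b \<le> X s \<omega>" by (auto simp: hitting_time_def top_unique split: if_splits)
  from hitting_time_attained[OF \<omega> this] obtain T where "hitting_time b \<omega> = ennreal T" "0 \<le> T" "b \<le> X T \<omega>" by metis
  with le t show "\<exists>s\<in>{0..t}. b \<le> X s \<omega>" by auto
next
  assume "\<exists>s\<in>{0..t}. b \<le> X s \<omega>"
  then obtain s where s: "0 \<le> s" "s \<le> t" "b \<le> X s \<omega>" by auto
  then have "\<exists>s\<ge>0. b \<le> X s \<omega>" by auto
  from hitting_time_attained[OF \<omega> this] obtain T where "hitting_time b \<omega> = ennreal T" "T \<le> s" using s by metis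
  then show "hitting_time b \<omega> \<le> ennreal t" using s by (simp add: ennreal_leI)
qed

text \<open>The filtration is neither completed nor made right continuous, so the event must be
  written with times up to \<open>t\<close> exactly. The maximum over [0, t] reaches
  \<open>b\<close> if and only if the position at dyadic times capped at \<open>t\<close> exceeds
  each b - 1 / (m + 1); one direction uses that the maximum is attained, the other path
  continuity.\<close>

lemma hitting_time_stopping: "is_stopping_time M B (hitting_time b)"
  unfolding is_stopping_time_def
proof (intro allI impI)
  fix t :: real assume t: "t \<ge> 0"
  let ?F = "nat_filtration M B t"
  define \<rho> where "\<rho> k n = min (dyadic k n) t" for k n
  have \<rho>: "0 \<le> \<rho> k n" "\<rho> k n \<le> t" for k n using t by (auto simp: \<rho>_def)
  have [measurable]: "X (\<rho> k n) \<in> borel_measurable ?F" for k n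
    using measurable_nat_filtration_mono[OF X_adapted[OF \<rho>(1)] \<rho>(2)] .
  have "{\<omega> \<in> space ?F. \<forall>m::nat. \<exists>k n. X (\<rho> k n) \<omega> > b - 1 / (real m + 1)} \<in> sets ?F" by measurable
  also have "{\<omega> \<in> space ?F. \<forall>m::nat. \<exists>k n. X (\<rho> k n) \<omega> > b - 1 / (real m + 1)} = {\<omega> \<in> space M. hitting_time b \<omega> \<le> ennreal t}"
  proof (intro Collect_cong conj_cong)
    fix \<omega> assume "\<omega> \<in> space M"
    note \<omega> = this
    show "(\<forall>m::nat. \<exists>k n. X (\<rho> k n) \<omega> > b - 1 / (real m + 1)) \<longleftrightarrow> hitting_time b \<omega> \<le> ennreal t"
      unfolding hitting_time_le_iff[OF \<omega> t]
    proof
      assume near: "\<forall>m::nat. \<exists>k n. X (\<rho> k n) \<omega> > b - 1 / (real m + 1)"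
      have "continuous_on {0..t} (\<lambda>s. X s \<omega>)" by (rule continuous_on_subset[OF X_continuous[OF \<omega>]]) auto
      then obtain s where s: "s \<in> {0..t}" "\<And>u. u \<in> {0..t} \<Longrightarrow> X u \<omega> \<le> X s \<omega>"
        using continuous_attains_sup[of "{0..t}" "\<lambda>s. X s \<omega>"] t by auto
      have "b - 1 / (real m + 1) \<le> X s \<omega>" for m
      proof -
        obtain k n where "X (\<rho> k n) \<omega> > b - 1 / (real m + 1)" using near by blast
        moreover have "X (\<rho> k n) \<omega> \<le> X s \<omega>" by (rule s(2)) (use \<rho> in auto)
        ultimately show ?thesis by simp
      qed
      moreover have "(\<lambda>m. b - 1 / (real m + 1)) \<longlonglongrightarrow> b - 0"
        using LIMSEQ_inverse_real_of_nat by (intro tendsto_diff tendsto_const) (simp add: inverse_eq_divide add.commute)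
      ultimately have "b - 0 \<le> X s \<omega>" by (intro LIMSEQ_le_const2[of _ "b - 0"]) auto
      then show "\<exists>s\<in>{0..t}. b \<le> X s \<omega>" using s by auto
    next
      assume "\<exists>s\<in>{0..t}. b \<le> X s \<omega>"
      then obtain s where s: "0 \<le> s" "s \<le> t" "b \<le> X s \<omega>" by auto
      have "(\<lambda>k. \<rho> k (dyadic_ceil k s)) \<longlonglongrightarrow> min s t"
        unfolding \<rho>_def by (intro tendsto_min dyadic_ceil_tendsto s tendsto_const)
      then have "(\<lambda>k. \<rho> k (dyadic_ceil k s)) \<longlonglongrightarrow> s" using s by simp
      then have lim: "(\<lambda>k. X (\<rho> k (dyadic_ceil k s)) \<omega>) \<longlonglongrightarrow> X s \<omega>"
        by (rule continuous_on_tendsto_compose[OF X_continuous[OF \<omega>]]) (use s \<rho> in auto)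
      show "\<forall>m::nat. \<exists>k n. X (\<rho> k n) \<omega> > b - 1 / (real m + 1)"
      proof
        fix m :: nat
        have "b - 1 / (real m + 1) < X s \<omega>" using s(3) by (smt (verit) divide_pos_pos of_nat_0_le_iff)
        from order_tendstoD(1)[OF lim this] show "\<exists>k n. X (\<rho> k n) \<omega> > b - 1 / (real m + 1)"
          by (auto simp: eventually_sequentially)
      qed
    qed
  qed simp
  finally show "{\<omega> \<in> space M. hitting_time b \<omega> \<le> ennreal t} \<in> sets ?F" .
qed

lemma hitting_time_finite:
  assumes \<omega>: "\<omega> \<in> space M" and xb: "x < b" and fin: "hitting_time b \<omega> \<noteq> \<infinity>"
  shows "X (enn2real (hitting_time b \<omega>)) \<omega> = b"
proof -
  have "\<exists>s\<ge>0. b \<le> X s \<omega>" using fin by (auto simp: hitting_time_def split: if_splits)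
  from hitting_time_attained[OF \<omega> this] obtain T where T: "hitting_time b \<omega> = ennreal T" "0 \<le> T" "b \<le> X T \<omega>"
    "\<And>s. 0 \<le> s \<Longrightarrow> b \<le> X s \<omega> \<Longrightarrow> T \<le> s" by metis
  have "continuous_on {0..T} (\<lambda>s. X s \<omega>)" by (rule continuous_on_subset[OF X_continuous[OF \<omega>]]) auto
  then obtain s where s: "0 \<le> s" "s \<le> T" "X s \<omega> = b"
    using IVT'[of "\<lambda>s. X s \<omega>" 0 b T] T xb X_zero[OF \<omega>] by auto
  then have "s = T" using T(4)[of s] by simp
  then show ?thesis using T s by simp
qed

lemma min_stopping:
  assumes "is_stopping_time M B \<tau>" "is_stopping_time M B \<rho>"
  shows "is_stopping_time M B (\<lambda>\<omega>. min (\<tau> \<omega>) (\<rho> \<omega>))"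
  unfolding is_stopping_time_def
proof (intro allI impI)
  fix t :: real assume t: "t \<ge> 0"
  have "{\<omega> \<in> space M. \<tau> \<omega> \<le> ennreal t} \<union> {\<omega> \<in> space M. \<rho> \<omega> \<le> ennreal t} \<in> sets (nat_filtration M B t)"
    using assms t by (intro sets.Un) (auto simp: is_stopping_time_def)
  also have "{\<omega> \<in> space M. \<tau> \<omega> \<le> ennreal t} \<union> {\<omega> \<in> space M. \<rho> \<omega> \<le> ennreal t} = {\<omega> \<in> space M. min (\<tau> \<omega>) (\<rho> \<omega>) \<le> ennreal t}"
    by (auto simp: min_le_iff_disj)
  finally show "{\<omega> \<in> space M. min (\<tau> \<omega>) (\<rho> \<omega>) \<le> ennreal t} \<in> sets (nat_filtration M B t)" .
qed

end

section \<open>The martingale of F and attainment of the value\<close>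

context switching_process
begin

definition "mart k i \<omega> = ennreal (exp (- r * dyadic k i) * F (X (dyadic k i) \<omega>))"

lemma mart_adapted: "mart k i \<in> borel_measurable (nat_filtration M B (dyadic k i))"
proof -
  have [measurable]: "F \<in> borel_measurable borel" by (intro borel_measurable_continuous_onI F_continuous)
  show ?thesis unfolding mart_def[abs_def] using X_adapted[OF dyadic_nonneg[of k i]] by measurable
qed

lemma mart_measurable [measurable]: "mart k i \<in> borel_measurable M"
  by (rule measurable_nat_filtration_M[OF mart_adapted])

lemma mart_step:
  assumes A: "A \<in> sets (nat_filtration M B (dyadic k i))"
  shows "(\<integral>\<^sup>+\<omega>. mart k (Suc i) \<omega> * indicator A \<omega> \<partial>M) = (\<integral>\<^sup>+\<omega>. mart k i \<omega> * indicator A \<omega> \<partial>M)"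
proof -
  have [measurable]: "A \<in> events" using A nat_filtration_subset by auto
  have [measurable]: "F \<in> borel_measurable borel" by (intro borel_measurable_continuous_onI F_continuous)
  let ?s = "dyadic k i" and ?t = "dyadic k (Suc i)"
  have [measurable]: "X ?s \<in> borel_measurable M" "X ?t \<in> borel_measurable M" by (simp_all add: X_measurable)
  have t: "?t = ?s + 1 / 2 ^ k" by (simp add: dyadic_def add_divide_distrib)
  have e: "exp (- r * ?t) * exp (r * (1 / 2 ^ k)) = exp (- r * ?s)"
    unfolding t exp_add[symmetric] by (simp add: algebra_simps)
  have c: "ennreal (exp (- r * ?t)) * ennreal (exp (r * (1 / 2 ^ k)) * y) = ennreal (exp (- r * ?s) * y)" for y
    unfolding ennreal_mult'[OF exp_ge_zero, symmetric] mult.assoc[symmetric] e ..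
  have "(\<integral>\<^sup>+\<omega>. mart k (Suc i) \<omega> * indicator A \<omega> \<partial>M) = ennreal (exp (- r * ?t)) * (\<integral>\<^sup>+\<omega>. ennreal (F (X ?t \<omega>)) * indicator A \<omega> \<partial>M)"
    by (subst nn_integral_cmult[symmetric]) (auto simp: mart_def ennreal_mult'[OF exp_ge_zero] mult.assoc)
  also have "(\<integral>\<^sup>+\<omega>. ennreal (F (X ?t \<omega>)) * indicator A \<omega> \<partial>M)
      = (\<integral>\<^sup>+\<omega>. ennreal (exp (r * (1 / 2 ^ k)) * F (X ?s \<omega>)) * indicator A \<omega> \<partial>M)"
    by (subst X_markov[OF A]) (simp_all add: F_transition)
  also have "ennreal (exp (- r * ?t)) * \<dots>
      = (\<integral>\<^sup>+\<omega>. ennreal (exp (- r * ?t)) * (ennreal (exp (r * (1 / 2 ^ k)) * F (X ?s \<omega>)) * indicator A \<omega>) \<partial>M)"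
    by (rule nn_integral_cmult[symmetric]) measurable
  also have "\<dots> = (\<integral>\<^sup>+\<omega>. mart k i \<omega> * indicator A \<omega> \<partial>M)"
    unfolding mart_def mult.assoc[symmetric] c ..
  finally show ?thesis .
qed

lemma mart_const:
  assumes A: "A \<in> sets (nat_filtration M B (dyadic k i))" and N: "i \<le> N"
  shows "(\<integral>\<^sup>+\<omega>. mart k N \<omega> * indicator A \<omega> \<partial>M) = (\<integral>\<^sup>+\<omega>. mart k i \<omega> * indicator A \<omega> \<partial>M)"
  using N
proof (induction N rule: dec_induct)
  case (step n)
  have "A \<in> sets (nat_filtration M B (dyadic k n))" using A nat_filtration_mono[OF dyadic_mono[OF step(1)]] by blast
  with step.IH show ?case by (simp add: mart_step)
qed simp

lemma mart_expectation: "(\<integral>\<^sup>+\<omega>. mart k N \<omega> \<partial>M) = ennreal (F x)"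
proof -
  have "space M \<in> sets (nat_filtration M B (dyadic k 0))"
    using sets.top[of "nat_filtration M B (dyadic k 0)"] by simp
  from mart_const[OF this, of N] have "(\<integral>\<^sup>+\<omega>. mart k N \<omega> * indicator (space M) \<omega> \<partial>M) = (\<integral>\<^sup>+\<omega>. mart k 0 \<omega> * indicator (space M) \<omega> \<partial>M)" by simp
  also have "\<dots> = (\<integral>\<^sup>+\<omega>. ennreal (F x) \<partial>M)"
    by (intro nn_integral_cong) (simp add: mart_def dyadic_def X_zero)
  also have "(\<integral>\<^sup>+\<omega>. mart k N \<omega> * indicator (space M) \<omega> \<partial>M) = (\<integral>\<^sup>+\<omega>. mart k N \<omega> \<partial>M)"
    by (intro nn_integral_cong) simp
  finally show ?thesis by (simp add: emeasure_space_1)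
qed

text \<open>A bound, finite on each path, for the values stopped before the horizon at all grid
  levels simultaneously. It frees the tail events from the level \<open>k\<close>.\<close>

definition "mart_sup n \<omega> = (SUP k. SUP i\<in>{..n * 2 ^ k}. mart k i \<omega>)"

lemma mart_sup_measurable [measurable]: "mart_sup n \<in> borel_measurable M"
  unfolding mart_sup_def[abs_def] by measurable

lemma mart_sup_finite:
  assumes \<omega>: "\<omega> \<in> space M"
  shows "\<exists>l::nat. mart_sup n \<omega> \<le> ennreal (real l)"
proof -
  have cont: "continuous_on {0..real n} (\<lambda>t. exp (- r * t) * F (X t \<omega>))"
    by (intro continuous_intros continuous_on_compose2[OF F_continuous[of UNIV]] continuous_on_subset[OF X_continuous[OF \<omega>]]) auto
  obtain s where "\<forall>t\<in>{0..real n}. exp (- r * t) * F (X t \<omega>) \<le> exp (- r * s) * F (X s \<omega>)"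
    using continuous_attains_sup[OF compact_Icc _ cont] by auto
  then obtain C where C: "\<And>t. t \<in> {0..real n} \<Longrightarrow> exp (- r * t) * F (X t \<omega>) \<le> C" by blast
  obtain l :: nat where l: "C \<le> real l" using real_arch_simple by blast
  have "mart k i \<omega> \<le> ennreal (real l)" if "i \<le> n * 2 ^ k" for k i
  proof -
    have "real i \<le> real n * 2 ^ k" using that by (metis of_nat_le_iff of_nat_mult of_nat_numeral of_nat_power)
    then have "dyadic k i \<in> {0..real n}" by (simp add: dyadic_def divide_le_eq)
    from C[OF this] l show ?thesis unfolding mart_def by (intro ennreal_leI) simp
  qed
  then show ?thesis unfolding mart_sup_def by (intro exI[of _ l] SUP_least) auto
qed

text \<open>The stopped martingale is uniformly integrable because it is closed by its value at the
  horizon \<open>n\<close>; this replaces domination, which fails for \<open>F\<close>.\<close>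

lemma stopped_F_lower:
  assumes \<tau>: "is_stopping_time M B \<tau>"
  shows "ennreal (F x) \<le> (\<integral>\<^sup>+\<omega>. ennreal (disc_pay r F X (\<lambda>\<omega>. min (\<tau> \<omega>) (ennreal (real n))) \<omega>) \<partial>M)"
proof -
  define \<rho> where "\<rho> \<omega> = min (\<tau> \<omega>) (ennreal (real n))" for \<omega>
  have \<rho>: "is_stopping_time M B \<rho>" unfolding \<rho>_def[abs_def] by (rule min_stopping[OF \<tau> const_stopping])
  define Q where "Q k i = {\<omega> \<in> space M. \<rho> \<omega> \<le> ennreal (dyadic k i)}" for k i
  have QF: "Q k i \<in> sets (nat_filtration M B (dyadic k i))" for k i
    using \<rho> by (simp add: Q_def is_stopping_time_def)
  have DF: "disjointed (Q k) i \<in> sets (nat_filtration M B (dyadic k i))" for k i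
  proof -
    have "Q k j \<in> sets (nat_filtration M B (dyadic k i))" if "j < i" for j
      using QF[of k j] nat_filtration_mono[OF dyadic_mono[OF less_imp_le[OF that]]] by blast
    then show ?thesis unfolding disjointed_def using QF by (intro sets.Diff sets.finite_UN) auto
  qed
  have Dm[measurable]: "disjointed (Q k) i \<in> events" for k i using DF nat_filtration_subset by blast
  define S where "S k = stopped_value (mart k) (Q k)" for k
  have Sm[measurable]: "S k \<in> borel_measurable M" for k unfolding S_def stopped_value_def[abs_def] by measurable
  have lim: "(\<lambda>k. S k \<omega>) \<longlonglongrightarrow> ennreal (disc_pay r F X \<rho> \<omega>)" if "\<omega> \<in> space M" for \<omega>
    using stopped_value_tendsto[OF that F_continuous, of r \<rho>] unfolding S_def mart_def[abs_def] Q_def .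
  have end_time: "dyadic k (n * 2 ^ k) = real n" for k by (simp add: dyadic_def)
  have full: "\<omega> \<in> Q k (n * 2 ^ k)" if "\<omega> \<in> space M" for \<omega> k
    using that by (simp add: Q_def end_time \<rho>_def)
  have index: "\<exists>i\<le>n * 2 ^ k. \<omega> \<in> disjointed (Q k) i" if "\<omega> \<in> space M" for \<omega> k
  proof -
    define i where "i = (LEAST i. \<omega> \<in> Q k i)"
    have "\<omega> \<in> Q k i" unfolding i_def by (rule LeastI[of "\<lambda>i. \<omega> \<in> Q k i", OF full[OF that]])
    moreover have "i \<le> n * 2 ^ k" unfolding i_def by (rule Least_le[of "\<lambda>i. \<omega> \<in> Q k i", OF full[OF that]])
    moreover have "\<omega> \<notin> Q k j" if "j < i" for j using that unfolding i_def by (rule not_less_Least)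
    ultimately show ?thesis unfolding disjointed_def by auto
  qed
  \<comment> \<open>The martingale at the horizon: \<open>dyadic 0 n\<close> is the time
    \<open>n\<close>, and the value is the same at every grid level.\<close>
  define y where "y = mart 0 n"
  have y: "mart k (n * 2 ^ k) = y" for k by (simp add: y_def mart_def fun_eq_iff end_time) (simp add: dyadic_def)
  have y_int: "(\<integral>\<^sup>+\<omega>. y \<omega> \<partial>M) = ennreal (F x)" unfolding y_def by (rule mart_expectation)
  have ym[measurable]: "y \<in> borel_measurable M" unfolding y_def by measurable
  \<comment> \<open>That the discretised time equals \<open>i\<close> while the value at
    \<open>i\<close> satisfies \<open>P\<close> is an event of the past of \<open>i\<close>. On it
    the stopped value may be replaced under the integral by the terminal value
    \<open>y\<close>.\<close>
  have swap: "(\<integral>\<^sup>+\<omega>. S k \<omega> * indicator {\<omega> \<in> space M. P (S k \<omega>)} \<omega> \<partial>M) = (\<integral>\<^sup>+\<omega>. y \<omega> * indicator {\<omega> \<in> space M. P (S k \<omega>)} \<omega> \<partial>M)"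
    if P: "{z. P z} \<in> sets borel" for P k
  proof -
    let ?N = "n * 2 ^ k"
    let ?E = "\<lambda>i. disjointed (Q k) i \<inter> {\<omega> \<in> space M. P (mart k i \<omega>)}"
    have EF: "?E i \<in> sets (nat_filtration M B (dyadic k i))" for i
    proof (rule sets.Int[OF DF])
      have "mart k i -` {z. P z} \<inter> space (nat_filtration M B (dyadic k i)) \<in> sets (nat_filtration M B (dyadic k i))"
        by (rule measurable_sets[OF mart_adapted P])
      moreover have "mart k i -` {z. P z} \<inter> space (nat_filtration M B (dyadic k i)) = {\<omega> \<in> space M. P (mart k i \<omega>)}" by auto
      ultimately show "{\<omega> \<in> space M. P (mart k i \<omega>)} \<in> sets (nat_filtration M B (dyadic k i))" by simp
    qed
    have Em[measurable]: "?E i \<in> events" for i using EF nat_filtration_subset by blast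
    have decomp: "g \<omega> * indicator {\<omega> \<in> space M. P (S k \<omega>)} \<omega> = (\<Sum>i\<le>?N. h i * indicator (?E i) \<omega>)"
      if \<omega>: "\<omega> \<in> space M" and gh: "\<And>i. \<omega> \<in> disjointed (Q k) i \<Longrightarrow> g \<omega> = h i" for g :: "'a \<Rightarrow> ennreal" and h :: "nat \<Rightarrow> ennreal" and \<omega>
    proof -
      obtain i where i: "i \<le> ?N" "\<omega> \<in> disjointed (Q k) i" using index[OF \<omega>] by blast
      have other: "\<omega> \<notin> disjointed (Q k) j" if "j \<noteq> i" for j
        using disjoint_family_disjointed[of "Q k"] i(2) that by (auto simp: disjoint_family_on_def)
      define t where "t j = h j * indicator (?E j) \<omega>" for j
      have "t j = 0" if "j \<noteq> i" for j using other[OF that] by (simp add: t_def indicator_def)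
      then have "(\<Sum>j\<le>?N. t j) = (\<Sum>j\<in>{i}. t j)"
        using i by (intro sum.mono_neutral_right) auto
      then have "(\<Sum>j\<le>?N. h j * indicator (?E j) \<omega>) = h i * indicator (?E i) \<omega>" unfolding t_def[symmetric] by simp
      then show ?thesis using i \<omega> gh[OF i(2)] by (simp add: S_def stopped_value_eq[OF i(2)] indicator_def)
    qed
    have "(\<integral>\<^sup>+\<omega>. S k \<omega> * indicator {\<omega> \<in> space M. P (S k \<omega>)} \<omega> \<partial>M) = (\<integral>\<^sup>+\<omega>. (\<Sum>i\<le>?N. mart k i \<omega> * indicator (?E i) \<omega>) \<partial>M)"
      by (intro nn_integral_cong decomp) (auto simp: S_def stopped_value_eq)
    also have "\<dots> = (\<Sum>i\<le>?N. \<integral>\<^sup>+\<omega>. mart k i \<omega> * indicator (?E i) \<omega> \<partial>M)"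
      by (rule nn_integral_sum) measurable
    also have "\<dots> = (\<Sum>i\<le>?N. \<integral>\<^sup>+\<omega>. y \<omega> * indicator (?E i) \<omega> \<partial>M)"
      by (intro sum.cong refl) (simp add: mart_const[OF EF, symmetric] y[of k, symmetric])
    also have "\<dots> = (\<integral>\<^sup>+\<omega>. (\<Sum>i\<le>?N. y \<omega> * indicator (?E i) \<omega>) \<partial>M)"
      by (rule nn_integral_sum[symmetric]) measurable
    also have "\<dots> = (\<integral>\<^sup>+\<omega>. y \<omega> * indicator {\<omega> \<in> space M. P (S k \<omega>)} \<omega> \<partial>M)"
      by (intro nn_integral_cong decomp[symmetric]) auto
    finally show ?thesis .
  qed
  have S_sup: "S k \<omega> \<le> mart_sup n \<omega>" if w: "\<omega> \<in> space M" for k \<omega>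
  proof -
    obtain i where i: "i \<le> n * 2 ^ k" "\<omega> \<in> disjointed (Q k) i" using index[OF w] by blast
    show ?thesis unfolding S_def stopped_value_eq[OF i(2)] mart_sup_def
      by (rule SUP_upper2[OF UNIV_I[of k]], rule SUP_upper) (use i(1) in simp)
  qed
  \<comment> \<open>Truncation at \<open>l\<close>: the part above \<open>l\<close> is moved to
    \<open>y\<close> by \<open>swap\<close> and enlarged to an event that does not depend on
    \<open>k\<close>. The limit in \<open>k\<close> is dominated by the constant \<open>l\<close>;
    the later limit in \<open>l\<close> is dominated by \<open>y\<close>.\<close>
  have bound: "ennreal (F x) \<le> (\<integral>\<^sup>+\<omega>. ennreal (disc_pay r F X \<rho> \<omega>) \<partial>M) + (\<integral>\<^sup>+\<omega>. y \<omega> * indicator {\<omega> \<in> space M. mart_sup n \<omega> > ennreal (real l)} \<omega> \<partial>M)" for l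
  proof -
    let ?R = "\<integral>\<^sup>+\<omega>. y \<omega> * indicator {\<omega> \<in> space M. mart_sup n \<omega> > ennreal (real l)} \<omega> \<partial>M"
    have k: "ennreal (F x) \<le> (\<integral>\<^sup>+\<omega>. min (S k \<omega>) (ennreal (real l)) \<partial>M) + ?R" for k
    proof -
      have "ennreal (F x) = (\<integral>\<^sup>+\<omega>. y \<omega> * indicator {\<omega> \<in> space M. True} \<omega> \<partial>M)"
        unfolding y_int[symmetric] by (intro nn_integral_cong) simp
      also have "\<dots> = (\<integral>\<^sup>+\<omega>. S k \<omega> * indicator {\<omega> \<in> space M. True} \<omega> \<partial>M)"
        using swap[of "\<lambda>_. True" k] by simp
      also have "\<dots> \<le> (\<integral>\<^sup>+\<omega>. min (S k \<omega>) (ennreal (real l)) + S k \<omega> * indicator {\<omega> \<in> space M. S k \<omega> > ennreal (real l)} \<omega> \<partial>M)"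
        by (intro nn_integral_mono) (auto simp: indicator_def min_def not_le add_increasing)
      also have "\<dots> = (\<integral>\<^sup>+\<omega>. min (S k \<omega>) (ennreal (real l)) \<partial>M) + (\<integral>\<^sup>+\<omega>. S k \<omega> * indicator {\<omega> \<in> space M. S k \<omega> > ennreal (real l)} \<omega> \<partial>M)"
        by (rule nn_integral_add) measurable
      also have "(\<integral>\<^sup>+\<omega>. S k \<omega> * indicator {\<omega> \<in> space M. S k \<omega> > ennreal (real l)} \<omega> \<partial>M)
         = (\<integral>\<^sup>+\<omega>. y \<omega> * indicator {\<omega> \<in> space M. S k \<omega> > ennreal (real l)} \<omega> \<partial>M)"
        by (rule swap) (simp add: greaterThan_def[symmetric])
      also have "\<dots> \<le> ?R"
        by (intro nn_integral_mono mult_left_mono) (use S_sup in \<open>auto simp: indicator_def intro: less_le_trans\<close>)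
      finally show ?thesis by (simp add: add_left_mono)
    qed
    have "(\<lambda>k. \<integral>\<^sup>+\<omega>. min (S k \<omega>) (ennreal (real l)) \<partial>M) \<longlonglongrightarrow> (\<integral>\<^sup>+\<omega>. min (ennreal (disc_pay r F X \<rho> \<omega>)) (ennreal (real l)) \<partial>M)"
    proof (rule nn_integral_dominated_convergence[where w="\<lambda>_. ennreal (real l)"])
      show "(\<lambda>\<omega>. min (ennreal (disc_pay r F X \<rho> \<omega>)) (ennreal (real l))) \<in> borel_measurable M"
        using disc_pay_measurable[OF \<rho> F_continuous] by measurable
      show "AE \<omega> in M. (\<lambda>k. min (S k \<omega>) (ennreal (real l))) \<longlonglongrightarrow> min (ennreal (disc_pay r F X \<rho> \<omega>)) (ennreal (real l))"
        using lim by (intro AE_I2 tendsto_min tendsto_const)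
    qed (auto simp: emeasure_space_1)
    then have "(\<lambda>k. (\<integral>\<^sup>+\<omega>. min (S k \<omega>) (ennreal (real l)) \<partial>M) + ?R) \<longlonglongrightarrow> (\<integral>\<^sup>+\<omega>. min (ennreal (disc_pay r F X \<rho> \<omega>)) (ennreal (real l)) \<partial>M) + ?R"
      by (intro tendsto_add tendsto_const)
    then have "ennreal (F x) \<le> (\<integral>\<^sup>+\<omega>. min (ennreal (disc_pay r F X \<rho> \<omega>)) (ennreal (real l)) \<partial>M) + ?R"
      by (rule LIMSEQ_le_const) (use k in auto)
    also have "\<dots> \<le> (\<integral>\<^sup>+\<omega>. ennreal (disc_pay r F X \<rho> \<omega>) \<partial>M) + ?R"
      by (intro add_right_mono nn_integral_mono) simp
    finally show ?thesis .
  qed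
  have "(\<lambda>l. \<integral>\<^sup>+\<omega>. y \<omega> * indicator {\<omega> \<in> space M. mart_sup n \<omega> > ennreal (real l)} \<omega> \<partial>M) \<longlonglongrightarrow> (\<integral>\<^sup>+\<omega>. 0 \<partial>M)"
  proof (rule nn_integral_dominated_convergence[where w=y])
    show "(\<integral>\<^sup>+\<omega>. y \<omega> \<partial>M) < \<infinity>" by (simp add: y_int)
    show "AE \<omega> in M. (\<lambda>l. y \<omega> * indicator {\<omega> \<in> space M. mart_sup n \<omega> > ennreal (real l)} \<omega>) \<longlonglongrightarrow> 0"
    proof (rule AE_I2)
      fix \<omega> assume "\<omega> \<in> space M"
      then obtain l0 :: nat where l0: "mart_sup n \<omega> \<le> ennreal (real l0)" using mart_sup_finite by blast
      have "\<forall>\<^sub>F l in sequentially. 0 = y \<omega> * indicator {\<omega> \<in> space M. mart_sup n \<omega> > ennreal (real l)} \<omega>"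
        using eventually_ge_at_top[of l0]
      proof eventually_elim
        case (elim l)
        then have "mart_sup n \<omega> \<le> ennreal (real l)" using l0 by (meson ennreal_leI of_nat_le_iff order.trans)
        then show ?case by (simp add: indicator_def not_less[symmetric])
      qed
      then show "(\<lambda>l. y \<omega> * indicator {\<omega> \<in> space M. mart_sup n \<omega> > ennreal (real l)} \<omega>) \<longlonglongrightarrow> 0"
        by (rule Lim_transform_eventually[OF tendsto_const])
    qed
  qed (auto simp: indicator_def)
  then have "(\<lambda>l. (\<integral>\<^sup>+\<omega>. ennreal (disc_pay r F X \<rho> \<omega>) \<partial>M) + (\<integral>\<^sup>+\<omega>. y \<omega> * indicator {\<omega> \<in> space M. mart_sup n \<omega> > ennreal (real l)} \<omega> \<partial>M))
      \<longlonglongrightarrow> (\<integral>\<^sup>+\<omega>. ennreal (disc_pay r F X \<rho> \<omega>) \<partial>M) + 0"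
    by (intro tendsto_add tendsto_const) simp
  then have "ennreal (F x) \<le> (\<integral>\<^sup>+\<omega>. ennreal (disc_pay r F X \<rho> \<omega>) \<partial>M) + 0"
    by (rule LIMSEQ_le_const) (use bound in auto)
  then show ?thesis by (simp add: \<rho>_def[abs_def])
qed

text \<open>At a finite hitting time the process sits exactly at \<open>b\<close>, because it starts
  below. If the horizon \<open>n\<close> comes first it is still below \<open>b\<close>, and
  \<open>F\<close> contributes at most F b exp(- r n). In the limit F x / F b is at most the mean
  discount at the hitting time.\<close>

lemma hitting_value:
  assumes xb: "x < b"
  shows "(\<integral>\<omega>. disc_pay r (\<lambda>y. exp y - cs) X (hitting_time b) \<omega> \<partial>M) \<ge> K * F x"
proof -
  let ?\<tau> = "hitting_time b"
  let ?p = "\<integral>\<omega>. disc_pay r (\<lambda>_. 1) X ?\<tau> \<omega> \<partial>M"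
  note st = hitting_time_stopping[of b]
  have int: "integrable M (disc_pay r (\<lambda>_. 1) X ?\<tau>)"
    by (rule disc_pay_integrable[OF st, where c=1]) auto
  have step: "F x \<le> F b * ?p + F b * exp (- r) ^ n" for n
  proof -
    have "disc_pay r F X (\<lambda>\<omega>. min (?\<tau> \<omega>) (ennreal (real n))) \<omega> \<le> F b * disc_pay r (\<lambda>_. 1) X ?\<tau> \<omega> + F b * exp (- r) ^ n"
      if \<omega>: "\<omega> \<in> space M" for \<omega>
    proof (cases "?\<tau> \<omega> \<le> ennreal (real n)")
      case True
      then have fin: "?\<tau> \<omega> \<noteq> \<infinity>" by (auto simp: top_unique)
      have "disc_pay r F X (\<lambda>\<omega>. min (?\<tau> \<omega>) (ennreal (real n))) \<omega> = F b * disc_pay r (\<lambda>_. 1) X ?\<tau> \<omega>"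
        using True fin hitting_time_finite[OF \<omega> xb fin] by (simp add: disc_pay_def min_def)
      then show ?thesis using F_pos[of b] by simp
    next
      case False
      then have "\<not> b \<le> X (real n) \<omega>" using hitting_time_le_iff[OF \<omega>, of "real n" b] by auto
      then have "F (X (real n) \<omega>) \<le> F b" by (intro F_mono) simp
      moreover have "disc_pay r F X (\<lambda>\<omega>. min (?\<tau> \<omega>) (ennreal (real n))) \<omega> = exp (- r) ^ n * F (X (real n) \<omega>)"
        using False by (simp add: disc_pay_def min_def exp_of_nat_mult[symmetric] mult.commute)
      ultimately have "disc_pay r F X (\<lambda>\<omega>. min (?\<tau> \<omega>) (ennreal (real n))) \<omega> \<le> F b * exp (- r) ^ n"
        by (simp add: mult.commute)
      moreover have "F b * disc_pay r (\<lambda>_. 1) X ?\<tau> \<omega> \<ge> 0"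
        using F_pos[of b] by (intro mult_nonneg_nonneg disc_pay_nonneg) auto
      ultimately show ?thesis by simp
    qed
    then have "ennreal (F x) \<le> (\<integral>\<^sup>+\<omega>. ennreal (F b * disc_pay r (\<lambda>_. 1) X ?\<tau> \<omega> + F b * exp (- r) ^ n) \<partial>M)"
      by (intro order.trans[OF stopped_F_lower[OF st, of n]] nn_integral_mono ennreal_leI)
    also have "\<dots> = ennreal (\<integral>\<omega>. F b * disc_pay r (\<lambda>_. 1) X ?\<tau> \<omega> + F b * exp (- r) ^ n \<partial>M)"
      using int F_pos[of b]
      by (intro nn_integral_eq_integral AE_I2 add_nonneg_nonneg mult_nonneg_nonneg disc_pay_nonneg) auto
    also have "(\<integral>\<omega>. F b * disc_pay r (\<lambda>_. 1) X ?\<tau> \<omega> + F b * exp (- r) ^ n \<partial>M) = F b * ?p + F b * exp (- r) ^ n"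
      using int by (simp add: prob_space)
    finally have "ennreal (F x) \<le> ennreal (F b * ?p + F b * exp (- r) ^ n)" .
    moreover have "?p \<ge> 0" by (intro integral_nonneg_AE AE_I2 disc_pay_nonneg) simp
    then have "0 \<le> F b * ?p + F b * exp (- r) ^ n" using F_pos[of b] by simp
    ultimately show ?thesis by (metis ennreal_le_iff)
  qed
  have "(\<lambda>n. F b * ?p + F b * exp (- r) ^ n) \<longlonglongrightarrow> F b * ?p + F b * 0"
    by (intro tendsto_intros LIMSEQ_power_zero) (use r in simp)
  then have "F x \<le> F b * ?p + F b * 0" by (rule LIMSEQ_le_const) (use step in auto)
  then have "K * F x \<le> K * (F b * ?p)" using K_pos by simp
  also have "\<dots> = (exp b - cs) * ?p" using KF_b by (simp add: mult.assoc[symmetric])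
  also have "\<dots> = (\<integral>\<omega>. (exp b - cs) * disc_pay r (\<lambda>_. 1) X ?\<tau> \<omega> \<partial>M)" by simp
  also have "\<dots> = (\<integral>\<omega>. disc_pay r (\<lambda>y. exp y - cs) X ?\<tau> \<omega> \<partial>M)"
    by (intro Bochner_Integration.integral_cong refl) (auto simp: disc_pay_def hitting_time_finite[OF _ xb])
  finally show ?thesis .
qed

section \<open>The two value functions\<close>

lemma J_value:
  assumes cb: "cb > 0" and buy: "\<And>y. V y \<le> exp y + cb"
  shows "J_tilde M B X r (\<lambda>y. exp y - cs) (\<lambda>y. exp y + cb) = 0"
proof (rule antisym)
  show "J_tilde M B X r (\<lambda>y. exp y - cs) (\<lambda>y. exp y + cb) \<le> 0"
    unfolding J_tilde_def
  proof (rule SUP_least, clarify)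
    fix \<nu> \<tau>
    assume "\<forall>n. is_stopping_time M B (\<nu> n) \<and> is_stopping_time M B (\<tau> n)"
      "\<forall>\<omega>\<in>space M. \<forall>n. \<nu> n \<omega> \<le> \<tau> n \<omega> \<and> \<tau> n \<omega> \<le> \<nu> (Suc n) \<omega>"
      "admissible_pay M (\<lambda>n \<omega>. disc_pay r (\<lambda>y. exp y - cs) X (\<tau> n) \<omega> - disc_pay r (\<lambda>y. exp y + cb) X (\<nu> n) \<omega>)"
    then show "ereal (integral\<^sup>L M (\<lambda>\<omega>. \<Sum>n. disc_pay r (\<lambda>y. exp y - cs) X (\<tau> n) \<omega> - disc_pay r (\<lambda>y. exp y + cb) X (\<nu> n) \<omega>)) \<le> 0"
      using trades_expectation[OF cb buy, of \<nu> \<tau>] by (auto simp: admissible_pay_def zero_ereal_def)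
  qed
  show "0 \<le> J_tilde M B X r (\<lambda>y. exp y - cs) (\<lambda>y. exp y + cb)"
    unfolding J_tilde_def
    \<comment> \<open>Never trading: all times are infinite, where \<open>disc_pay\<close> is
      0.\<close>
    by (rule SUP_upper2[of "\<lambda>_ _. 0"])
       (auto simp: admissible_pay_def disc_pay_def const_stopping zero_ereal_def intro!: exI[of _ "\<lambda>_ _. \<infinity>"])
qed

text \<open>After the first sale the position is flat, so the remaining series has mean at most 0 by
  \<open>trades_expectation\<close>. Its admissibility is inherited because the first sale is
  integrable by itself.\<close>

lemma long_strategy_upper:
  fixes \<nu> \<tau> :: "nat \<Rightarrow> 'a \<Rightarrow> ennreal"
  assumes cb: "cb > 0" and buy: "\<And>y. V y \<le> exp y + cb"
    and st: "\<And>n. is_stopping_time M B (\<nu> (Suc n))" "\<And>n. is_stopping_time M B (\<tau> n)"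
    and le: "\<And>n \<omega>. \<omega> \<in> space M \<Longrightarrow> \<tau> n \<omega> \<le> \<nu> (Suc n) \<omega>" "\<And>n \<omega>. \<omega> \<in> space M \<Longrightarrow> \<nu> (Suc n) \<omega> \<le> \<tau> (Suc n) \<omega>"
  defines "g \<equiv> \<lambda>n \<omega>. if n = 0 then disc_pay r (\<lambda>y. exp y - cs) X (\<tau> 0) \<omega>
      else disc_pay r (\<lambda>y. exp y - cs) X (\<tau> n) \<omega> - disc_pay r (\<lambda>y. exp y + cb) X (\<nu> n) \<omega>"
  assumes adm: "admissible_pay M g"
  shows "(\<integral>\<omega>. (\<Sum>n. g n \<omega>) \<partial>M) \<le> V x"
proof -
  have summ: "AE \<omega> in M. summable (\<lambda>n. g n \<omega>)" and int: "integrable M (\<lambda>\<omega>. \<Sum>n. g n \<omega>)"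
    using adm by (auto simp: admissible_pay_def)
  have i0: "integrable M (g 0)" unfolding g_def by (simp add: sell_integrable st)
  have iS: "integrable M (g (Suc n))" for n
    unfolding g_def using sell_integrable[OF st(2)] buy_integrable[OF cb st(1)] by simp
  have [measurable]: "g n \<in> borel_measurable M" for n using i0 iS by (cases n) auto
  have gS: "g (Suc n) \<omega> = disc_pay r (\<lambda>y. exp y - cs) X (\<tau> (Suc n)) \<omega> - disc_pay r (\<lambda>y. exp y + cb) X (\<nu> (Suc n)) \<omega>" for n \<omega>
    by (simp add: g_def)
  have split: "AE \<omega> in M. (\<Sum>n. g (Suc n) \<omega>) = (\<Sum>n. g n \<omega>) - g 0 \<omega>"
    using summ by eventually_elim (rule suminf_split_head)
  have intS: "integrable M (\<lambda>\<omega>. \<Sum>n. g (Suc n) \<omega>)"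
    by (subst integrable_cong_AE[OF _ _ split]) (use int i0 in auto)
  have "(\<integral>\<omega>. (\<Sum>n. g (Suc n) \<omega>) \<partial>M) \<le> 0"
    unfolding gS
  proof (rule trades_expectation[where \<nu>="\<lambda>n. \<nu> (Suc n)" and \<tau>="\<lambda>n. \<tau> (Suc n)", OF cb buy st(1) st(2) le(2) le(1)])
    show "AE \<omega> in M. summable (\<lambda>n. disc_pay r (\<lambda>y. exp y - cs) X (\<tau> (Suc n)) \<omega> - disc_pay r (\<lambda>y. exp y + cb) X (\<nu> (Suc n)) \<omega>)"
      using summ
    proof eventually_elim
      case (elim \<omega>)
      then have "summable (\<lambda>n. g (Suc n) \<omega>)" by (subst summable_Suc_iff)
      then show ?case unfolding gS .
    qed
    show "integrable M (\<lambda>\<omega>. \<Sum>n. disc_pay r (\<lambda>y. exp y - cs) X (\<tau> (Suc n)) \<omega> - disc_pay r (\<lambda>y. exp y + cb) X (\<nu> (Suc n)) \<omega>)"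
      using intS unfolding gS .
  qed
  moreover have "(\<integral>\<omega>. (\<Sum>n. g (Suc n) \<omega>) \<partial>M) = (\<integral>\<omega>. (\<Sum>n. g n \<omega>) - g 0 \<omega> \<partial>M)"
    by (rule integral_cong_AE[OF _ _ split]) auto
  moreover have "(\<integral>\<omega>. g 0 \<omega> \<partial>M) \<le> V x" unfolding g_def using first_sale[OF st(2)] by simp
  ultimately show ?thesis using int i0 by simp
qed

lemma V_attained: "\<exists>\<tau>. is_stopping_time M B \<tau> \<and> V x \<le> (\<integral>\<omega>. disc_pay r (\<lambda>y. exp y - cs) X \<tau> \<omega> \<partial>M)"
proof (cases "x < b")
  case True
  then show ?thesis using hitting_value hitting_time_stopping[of b] by (intro exI[of _ "hitting_time b"]) (simp add: V_def)
next
  case False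
  then show ?thesis by (intro exI[of _ "\<lambda>_. 0"]) (simp add: V_def const_stopping disc_pay_start)
qed

lemma V_value:
  assumes cb: "cb > 0" and buy: "\<And>y. V y \<le> exp y + cb"
  shows "V_tilde M B X r (\<lambda>y. exp y - cs) (\<lambda>y. exp y + cb) = ereal (V x)"
proof (rule antisym)
  show "V_tilde M B X r (\<lambda>y. exp y - cs) (\<lambda>y. exp y + cb) \<le> ereal (V x)"
    unfolding V_tilde_def by (rule SUP_least) (auto intro!: long_strategy_upper[OF cb buy])
  obtain \<tau> where \<tau>: "is_stopping_time M B \<tau>" "V x \<le> (\<integral>\<omega>. disc_pay r (\<lambda>y. exp y - cs) X \<tau> \<omega> \<partial>M)"
    using V_attained by blast
  \<comment> \<open>One sale at the time that attains \<open>V x\<close>, and no further trade; the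
    infinite times contribute 0.\<close>
  let ?\<tau> = "\<lambda>n::nat. if n = 0 then \<tau> else (\<lambda>_. \<infinity>)"
  let ?g = "\<lambda>(n::nat) \<omega>. if n = 0 then disc_pay r (\<lambda>y. exp y - cs) X \<tau> \<omega> else 0"
  have sum: "(\<Sum>n. ?g n \<omega>) = disc_pay r (\<lambda>y. exp y - cs) X \<tau> \<omega>" for \<omega>
    by (subst suminf_finite[of "{0}"]) auto
  show "ereal (V x) \<le> V_tilde M B X r (\<lambda>y. exp y - cs) (\<lambda>y. exp y + cb)"
    unfolding V_tilde_def
  proof (rule SUP_upper2[of ?g], intro CollectI exI conjI)
    show "\<forall>n. is_stopping_time M B ((\<lambda>_ _. \<infinity>) (Suc n)) \<and> is_stopping_time M B (?\<tau> n)"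
      using \<tau>(1) by (simp add: const_stopping)
    show "?g = (\<lambda>n \<omega>. if n = 0 then disc_pay r (\<lambda>y. exp y - cs) X (?\<tau> 0) \<omega>
         else disc_pay r (\<lambda>y. exp y - cs) X (?\<tau> n) \<omega> - disc_pay r (\<lambda>y. exp y + cb) X ((\<lambda>_ _. \<infinity>) n) \<omega>)"
      by (auto simp: fun_eq_iff disc_pay_def)
    have "summable (\<lambda>n. ?g n \<omega>)" for \<omega> by (rule summable_finite[of "{0}"]) auto
    then show "admissible_pay M ?g" unfolding admissible_pay_def sum using sell_integrable[OF \<tau>(1)] by auto
    show "ereal (V x) \<le> ereal (integral\<^sup>L M (\<lambda>\<omega>. \<Sum>n. ?g n \<omega>))" using \<tau>(2) by (simp add: sum)
  qed auto
qed

end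

text \<open>The noise is additive, so the stochastic differential equation is an integral equation
  on each path. The family \<open>X x\<close>, driven by one Brownian motion, takes the place of
  expectation given the starting point.\<close>

theorem theorem3p3:
  fixes M :: "'a measure" and B :: "real \<Rightarrow> 'a \<Rightarrow> real"
    and X :: "real \<Rightarrow> real \<Rightarrow> 'a \<Rightarrow> real"
    and \<mu> \<sigma> \<theta> r cs cb bstar :: real
  assumes BM: "standard_BM M B"
    and OU: "\<And>x \<omega>. \<omega> \<in> space M \<Longrightarrow> continuous_on {0..} (\<lambda>t. X x t \<omega>)"
    and OU_eq: "\<And>x \<omega> t. \<omega> \<in> space M \<Longrightarrow> t \<ge> 0 \<Longrightarrow>
         X x t \<omega> = x + integral {0..t} (\<lambda>s. \<mu> * (\<theta> - X x s \<omega>)) + \<sigma> * B t \<omega>"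
    and pos: "\<mu> > 0" "\<sigma> > 0" "r > 0" "cs > 0" "cb > 0"
    and bstar: "exp bstar * F_OU \<mu> \<theta> \<sigma> r bstar
                  = (exp bstar - cs) * deriv (F_OU \<mu> \<theta> \<sigma> r) bstar"
    and cond:
      "(let F = F_OU \<mu> \<theta> \<sigma> r;
            fb = (\<lambda>x. (\<mu> * \<theta> + \<sigma>\<^sup>2 / 2 - r) - \<mu> * x - r * cb * exp (- x))
        in (\<forall>x y. fb x = 0 \<longrightarrow> fb y = 0 \<longrightarrow> x = y)
         \<or> (\<exists>xb1 xb2. xb1 < xb2 \<and> {x. fb x = 0} = {xb1, xb2} \<and>
              (\<exists>a \<in> {xb1<..<xb2}. F a * exp a = deriv F a * (exp a + cb) \<and>
                   (exp a + cb) / F a \<ge> (exp bstar - cs) / F bstar))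
         \<or> (\<exists>xb1 xb2. xb1 < xb2 \<and> {x. fb x = 0} = {xb1, xb2} \<and>
              \<not> (\<exists>a \<in> {xb1<..<xb2}. F a * exp a = deriv F a * (exp a + cb))))"
  shows "(\<forall>x. J_tilde M B (X x) r (\<lambda>y. exp y - cs) (\<lambda>y. exp y + cb) = 0) \<and>
         (\<forall>x. V_tilde M B (X x) r (\<lambda>y. exp y - cs) (\<lambda>y. exp y + cb)
           = ereal (if x < bstar
                    then (exp bstar - cs) / F_OU \<mu> \<theta> \<sigma> r bstar * F_OU \<mu> \<theta> \<sigma> r x
                    else exp x - cs))"
proof -
  interpret ou_parameters \<mu> \<sigma> \<theta> r using pos by unfold_locales
  have dF: "deriv F = F1"
    by (intro ext DERIV_imp_deriv F_deriv)
  have b: "exp bstar * F bstar = (exp bstar - cs) * F1 bstar"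
    using bstar unfolding F_OU_eq dF .
  have proc: "switching_process M B (X x) \<mu> \<sigma> \<theta> x r cs bstar" for x
    using BM OU OU_eq pos b by unfold_locales auto
  interpret S: switching \<mu> \<sigma> \<theta> r cs bstar
    using pos b by unfold_locales auto
  have buy: "S.V y \<le> exp y + cb" for y
    using cond unfolding Let_def F_OU_eq dF f_def[symmetric] S.K_def[symmetric]
    by (intro S.V_le_buy pos)
  show ?thesis
    using switching_process.J_value[OF proc pos(5) buy] switching_process.V_value[OF proc pos(5) buy]
    by (simp add: S.V_def S.K_def F_OU_eq)
qed

end
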